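(* Let $d\ge 1$, let $g\in L^2(\mathbb{R}^d)$ and let $N$ be a subset of $\mathbb{Z}^d$ such that $N\cap(-N)=\emptyset$ and $N\cup(-N)\cup\{0\}=\mathbb{Z}^d$. Consider the Gabor system $$\mathcal{G}(g)=\{T_\lambda M_\gamma g\}_{\lambda\in\mathbb{Z}^d\cup(\mathbf{1/2}+\mathbb{Z}^d),\ \gamma\in\mathbb{Z}^d}$$ and the Wilson system $$\mathcal{W}(g)=\{T_\lambda g\}_{\lambda\in\mathbb{Z}^d}\ \cup\ \big\{\tfrac{1}{\sqrt2}T_\lambda(M_\gamma+(-1)^{|\gamma|}M_{-\gamma})g\big\}_{\lambda\in\mathbb{Z}^d,\gamma\in N}\ \cup\ \big\{\tfrac{1}{\sqrt2}T_{\lambda+\mathbf{1/2}}(M_\gamma-(-1)^{|\gamma|}M_{-\gamma})g\big\}_{\lambda\in\mathbb{Z}^d,\gamma\in N}.$$ Suppose that $\hat g(\omega)=\overline{\hat g(\omega)}$ for a.e. $\omega\in\mathbb{R}^d$. Then the following holds: (i) The Gabor system $\mathcal{G}(g)$ is a Bessel sequence with bound $b$ if and only if the Wilson system $\mathcal{W}(g)$ is a Bessel sequence with bound $b/2$. In either (and hence both) cases the frame operator $S_{\mathcal{G}}$ of $\mathcal{G}(g)$ and the frame operator $S_{\mathcal{W}}$ of $\mathcal{W}(g)$ satisfy $S_{\mathcal{G}}=2S_{\mathcal{W}}$. (ii) The Gabor system $\mathcal{G}(g)$ is a frame for $L^2(\mathbb{R}^d)$ with bounds $2a$ and $2b$ if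 and only if the Wilson system $\mathcal{W}(g)$ is a Riesz basis for $L^2(\mathbb{R}^d)$ with bounds $a$ and $b$. (iii) The Gabor system $\mathcal{G}(g)$ is a tight frame for $L^2(\mathbb{R}^d)$ with frame bound $2$ if and only if the Wilson system $\mathcal{W}(g)$ is an orthonormal basis for $L^2(\mathbb{R}^d)$.
   Context: For $\lambda,\gamma\in\mathbb{R}^d$ and $f\in L^2(\mathbb{R}^d)$: $T_\lambda f(x)=f(x-\lambda)$ and $M_\gamma f(x)=e^{2\pi i\langle x,\gamma\rangle}f(x)$. The Fourier transform is the unitary extension to $L^2(\mathbb{R}^d)$ of $\hat f(\omega)=\int_{\mathbb{R}^d}f(x)e^{-2\pi i\langle\omega,x\rangle}\,dx$. $\mathbf{1/2}=(1/2,\dots,1/2)\in\mathbb{R}^d$ and $\mathbf{1/2}+\mathbb{Z}^d=\{\mathbf{1/2}+z: z\in\mathbb{Z}^d\}$. For $n\in\mathbb{Z}^d$, $(-1)^{|n|}=(-1)^{n_1+\cdots+n_d}$. All systems are families indexed by the displayed index sets. A countable family $\{f_j\}$ in $L^2(\mathbb{R}^d)$ is a Bessel sequence with bound $b$ if $\sum_j|\langle f,f_j\rangle|^2\le b\|f\|^2$ for all $f\in L^2(\mathbb{R}^d)$; its frame operator is then $Sf=\sum_j\langle f,f_j\rangle f_j$. It is a frame with bounds $a,b>0$ if $a\|f\|^2\le\sum_j|\langle f,f_j\rangle|^2\le b\|f\|^2$ for all $f$; a tight frame with bound $a$ if equality holds with $a=b$. It is a Riesz basis for $L^2(\mathbb{R}^d)$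 with bounds $a,b>0$ if its linear span is dense and $a\sum_j|c_j|^2\le\|\sum_jc_jf_j\|^2\le b\sum_j|c_j|^2$ for all finitely supported scalar sequences $(c_j)$. *)

theory Defs
  imports "HOL-Analysis.Analysis"
begin

text \<open>Elements of $L^2$ are represented by functions; equality in $L^2$ is equality almost
  everywhere. The norm of a function outside \<open>L2fun\<close> is a junk value, so every notion below
  demands membership in \<open>L2fun\<close> before it uses the norm.\<close>

definition L2fun :: "(real ^ 'd \<Rightarrow> complex) \<Rightarrow> bool" where
  "L2fun f \<longleftrightarrow> f \<in> borel_measurable lebesgue \<and> integrable lebesgue (\<lambda>x. (cmod (f x))\<^sup>2)"

definition L2ip :: "(real ^ 'd \<Rightarrow> complex) \<Rightarrow> (real ^ 'd \<Rightarrow> complex) \<Rightarrow> complex" where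
  "L2ip f h = (LINT x|lebesgue. f x * cnj (h x))"

definition L2nrm :: "(real ^ 'd \<Rightarrow> complex) \<Rightarrow> real" where
  "L2nrm f = sqrt (LINT x|lebesgue. (cmod (f x))\<^sup>2)"

definition L2_tendsto ::
    "(nat \<Rightarrow> real ^ 'd \<Rightarrow> complex) \<Rightarrow> (real ^ 'd \<Rightarrow> complex) \<Rightarrow> bool" where
  "L2_tendsto h f \<longleftrightarrow> (\<forall>n. L2fun (h n)) \<and> L2fun f
     \<and> (\<lambda>n. L2nrm (\<lambda>x. h n x - f x)) \<longlonglongrightarrow> 0"

text \<open>Unconditional convergence in $L^2$, analogous to the library's \<open>has_sum\<close>.\<close>

definition L2_has_sum ::
    "('i \<Rightarrow> real ^ 'd \<Rightarrow> complex) \<Rightarrow> 'i set \<Rightarrow> (real ^ 'd \<Rightarrow> complex) \<Rightarrow> bool" where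
  "L2_has_sum F I s \<longleftrightarrow> (\<forall>j\<in>I. L2fun (F j)) \<and> L2fun s
     \<and> ((\<lambda>A. L2nrm (\<lambda>x. (\<Sum>j\<in>A. F j x) - s x)) \<longlongrightarrow> 0) (finite_subsets_at_top I)"

definition fourier_integral :: "(real ^ 'd \<Rightarrow> complex) \<Rightarrow> real ^ 'd \<Rightarrow> complex" where
  "fourier_integral f \<omega> =
     (LINT x|lebesgue. f x * exp (- 2 * of_real pi * \<i> * of_real (\<omega> \<bullet> x)))"

text \<open>\<open>fourier_L2 f F\<close> states that \<open>F\<close> represents the Fourier transform of \<open>f\<close>. The
  continuous extension to $L^2$ of the Fourier integral on $L^1 \cap L^2$ is the operator whose
  graph is the closure of the graph of that integral; \<open>F\<close> is determined up to a null set.\<close>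

definition fourier_L2 :: "(real ^ 'd \<Rightarrow> complex) \<Rightarrow> (real ^ 'd \<Rightarrow> complex) \<Rightarrow> bool" where
  "fourier_L2 f F \<longleftrightarrow>
     (\<exists>h. (\<forall>n. integrable lebesgue (h n)) \<and> L2_tendsto h f
        \<and> L2_tendsto (\<lambda>n. fourier_integral (h n)) F)"

definition bessel_seq :: "'i set \<Rightarrow> ('i \<Rightarrow> real ^ 'd \<Rightarrow> complex) \<Rightarrow> real \<Rightarrow> bool" where
  "bessel_seq I F b \<longleftrightarrow> (\<forall>j\<in>I. L2fun (F j)) \<and>
     (\<forall>f. L2fun f \<longrightarrow>
        (\<lambda>j. (cmod (L2ip f (F j)))\<^sup>2) summable_on I \<and>
        (\<Sum>\<^sub>\<infinity>j\<in>I. (cmod (L2ip f (F j)))\<^sup>2) \<le> b * (L2nrm f)\<^sup>2)"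

text \<open>Since the values of \<open>S\<close> are representatives, a family has many frame operators in this
  sense, any two of which agree almost everywhere on each \<open>f\<close> in \<open>L2fun\<close>.\<close>

definition is_frame_operator ::
    "'i set \<Rightarrow> ('i \<Rightarrow> real ^ 'd \<Rightarrow> complex)
      \<Rightarrow> ((real ^ 'd \<Rightarrow> complex) \<Rightarrow> real ^ 'd \<Rightarrow> complex) \<Rightarrow> bool" where
  "is_frame_operator I F S \<longleftrightarrow>
     (\<forall>f. L2fun f \<longrightarrow> L2_has_sum (\<lambda>j x. L2ip f (F j) * F j x) I (S f))"

definition is_frame :: "'i set \<Rightarrow> ('i \<Rightarrow> real ^ 'd \<Rightarrow> complex) \<Rightarrow> real \<Rightarrow> real \<Rightarrow> bool" where
  "is_frame I F a b \<longleftrightarrow> 0 < a \<and> 0 < b \<and> (\<forall>j\<in>I. L2fun (F j)) \<and>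
     (\<forall>f. L2fun f \<longrightarrow>
        (\<lambda>j. (cmod (L2ip f (F j)))\<^sup>2) summable_on I \<and>
        a * (L2nrm f)\<^sup>2 \<le> (\<Sum>\<^sub>\<infinity>j\<in>I. (cmod (L2ip f (F j)))\<^sup>2) \<and>
        (\<Sum>\<^sub>\<infinity>j\<in>I. (cmod (L2ip f (F j)))\<^sup>2) \<le> b * (L2nrm f)\<^sup>2)"

definition is_tight_frame :: "'i set \<Rightarrow> ('i \<Rightarrow> real ^ 'd \<Rightarrow> complex) \<Rightarrow> real \<Rightarrow> bool" where
  "is_tight_frame I F a \<longleftrightarrow> is_frame I F a a"

definition dense_span :: "'i set \<Rightarrow> ('i \<Rightarrow> real ^ 'd \<Rightarrow> complex) \<Rightarrow> bool" where
  "dense_span I F \<longleftrightarrow>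
     (\<forall>f \<epsilon>. L2fun f \<longrightarrow> 0 < \<epsilon> \<longrightarrow>
        (\<exists>A c. finite A \<and> A \<subseteq> I \<and> L2nrm (\<lambda>x. f x - (\<Sum>j\<in>A. c j * F j x)) < \<epsilon>))"

definition is_riesz_basis ::
    "'i set \<Rightarrow> ('i \<Rightarrow> real ^ 'd \<Rightarrow> complex) \<Rightarrow> real \<Rightarrow> real \<Rightarrow> bool" where
  "is_riesz_basis I F a b \<longleftrightarrow> 0 < a \<and> 0 < b \<and> (\<forall>j\<in>I. L2fun (F j)) \<and> dense_span I F \<and>
     (\<forall>A c. finite A \<longrightarrow> A \<subseteq> I \<longrightarrow>
        a * (\<Sum>j\<in>A. (cmod (c j))\<^sup>2) \<le> (L2nrm (\<lambda>x. \<Sum>j\<in>A. c j * F j x))\<^sup>2 \<and>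
        (L2nrm (\<lambda>x. \<Sum>j\<in>A. c j * F j x))\<^sup>2 \<le> b * (\<Sum>j\<in>A. (cmod (c j))\<^sup>2))"

definition is_orthonormal_basis :: "'i set \<Rightarrow> ('i \<Rightarrow> real ^ 'd \<Rightarrow> complex) \<Rightarrow> bool" where
  "is_orthonormal_basis I F \<longleftrightarrow> (\<forall>j\<in>I. L2fun (F j)) \<and> dense_span I F \<and>
     (\<forall>j\<in>I. \<forall>k\<in>I. L2ip (F j) (F k) = (if j = k then 1 else 0))"

definition transl :: "real ^ 'd \<Rightarrow> (real ^ 'd \<Rightarrow> complex) \<Rightarrow> real ^ 'd \<Rightarrow> complex" where
  "transl l f x = f (x - l)"

definition modul :: "real ^ 'd \<Rightarrow> (real ^ 'd \<Rightarrow> complex) \<Rightarrow> real ^ 'd \<Rightarrow> complex" where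
  "modul \<gamma> f x = exp (2 * of_real pi * \<i> * of_real (x \<bullet> \<gamma>)) * f x"

definition ivec :: "int ^ 'd \<Rightarrow> real ^ 'd" where
  "ivec n = (\<chi> i. real_of_int (n $ i))"

definition half :: "real ^ 'd" where
  "half = (\<chi> i. 1 / 2)"

definition sgn_vec :: "int ^ 'd \<Rightarrow> complex" where
  "sgn_vec n = (- 1) powi (\<Sum>i\<in>UNIV. n $ i)"

definition gabor_index :: "((real ^ 'd) \<times> (int ^ 'd)) set" where
  "gabor_index = (range ivec \<union> (+) half ` range ivec) \<times> UNIV"

fun gabor :: "(real ^ 'd \<Rightarrow> complex) \<Rightarrow> (real ^ 'd) \<times> (int ^ 'd) \<Rightarrow> real ^ 'd \<Rightarrow> complex" where
  "gabor g (l, \<gamma>) = transl l (modul (ivec \<gamma>) g)"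

text \<open>The Wilson system is the disjoint union of three indexed families, so its index set is a
  disjoint sum.\<close>

type_synonym 'd wilson_idx =
  "(int ^ 'd) + ((int ^ 'd) \<times> (int ^ 'd)) + ((int ^ 'd) \<times> (int ^ 'd))"

definition wilson_index :: "(int ^ 'd) set \<Rightarrow> 'd wilson_idx set" where
  "wilson_index N = UNIV <+> (UNIV \<times> N) <+> (UNIV \<times> N)"

fun wilson :: "(real ^ 'd \<Rightarrow> complex) \<Rightarrow> 'd wilson_idx \<Rightarrow> real ^ 'd \<Rightarrow> complex" where
  "wilson g (Inl l) = transl (ivec l) g"
| "wilson g (Inr (Inl (l, \<gamma>))) =
     (\<lambda>x. of_real (1 / sqrt 2) *
        transl (ivec l) (\<lambda>y. modul (ivec \<gamma>) g y + sgn_vec \<gamma> * modul (- ivec \<gamma>) g y) x)"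
| "wilson g (Inr (Inr (l, \<gamma>))) =
     (\<lambda>x. of_real (1 / sqrt 2) *
        transl (ivec l + half) (\<lambda>y. modul (ivec \<gamma>) g y - sgn_vec \<gamma> * modul (- ivec \<gamma>) g y) x)"

end

theory Submission
  imports Defs "HOL-Probability.Characteristic_Functions"
begin

text \<open>
  The integer shifts \<open>tf_shift k\<close>, where \<open>k\<close> ranges over pairs of integer vectors, form an abelian group
  of unitary operators, and the half shift commutes with them up to the sign \<open>sgn_of k\<close>. Up to signs the
  Gabor system therefore consists of the orbits of the two windows \<open>g\<close> and \<open>half_shift g\<close> under this
  group. A member of the Wilson system is a multiple of
  \<open>tf_shift k v + tf_shift (flip k) v\<close> with \<open>v = g\<close>, or of \<open>tf_shift k v - tf_shift (flip k) v\<close> with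
  \<open>v = half_shift g\<close>, the second term in both cases twisted by \<open>sgn_of k\<close>, where \<open>flip\<close> negates the
  frequency (\<open>wilson_eq_orbit_sum\<close>). A real Fourier transform means that \<open>g\<close> is invariant under
  \<open>reflect\<close>, that is, \<open>g (- x) = cnj (g x)\<close> almost everywhere (\<open>reflect_eq_if_fourier_real\<close>).

  The invariance enters twice. First, it gives symmetries of the lattice values of the ambiguity
  functions of \<open>g\<close> and \<open>half_shift g\<close> under \<open>flip\<close>. By these the Gram matrix of the Wilson system is one
  half of the sum of two Gram matrices: those of the orbit sums formed with \<open>g\<close> throughout and with
  \<open>half_shift g\<close> throughout (\<open>wilson_gram\<close>). The integer shifts of the unit cube are an orthonormal
  basis, and so are the orbit sums \<open>v\<^sub>j\<close> of the cube (\<open>orbit_cube_basis\<close>). Parseval's identity for the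
  former turns the Gram identity into a statement on the Gabor coefficients of a finite sum
  \<open>f = \<Sum>j. c j * v\<^sub>j\<close>: their sum of squares is
  twice the square of the norm of the Wilson sum with the coefficients \<open>c\<close>
  (\<open>gabor_lincomb_energy\<close>). As the norm of \<open>f\<close> is the norm of \<open>c\<close>, the Riesz inequalities of the Wilson
  system are the frame inequalities of the Gabor system on a dense subspace.

  Second, if the Gabor system is a Bessel sequence, the sum of \<open>\<langle>f, w\<rangle> \<langle>w, h\<rangle>\<close> over the Wilson system is
  one half of the corresponding sum over the Gabor system (\<open>wilson_form_half_gabor_form\<close>). The squares
  contribute exactly this, and there remain two families of mixed terms with opposite signs. Written in
  terms of \<open>f\<close> and the half shift of the reflection of \<open>h\<close>, the two families have the same sum with
  these functions exchanged, and that sum is symmetric in them (\<open>paired_sum_symmetric\<close>). This gives the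
  relation between the frame operators, and it makes the Wilson system a frame whenever the Gabor system
  is one; the linear span of a frame is dense (\<open>frame_dense_span\<close>). The statement on orthonormal bases
  is the case \<open>a = b = 1\<close> of the one on Riesz bases.

  The analytic input is the completeness of \<open>L\<^sup>2\<close> (\<open>L2_complete_geometric\<close>) and the uniqueness of Fourier
  coefficients and transforms of integrable functions; both forms of uniqueness come from the
  Stone-Weierstrass theorem on the torus (\<open>coeffs_vanish_wrap\<close>).
\<close>

section \<open>The space of square-integrable functions\<close>

lemma L2fun_meas: "L2fun f \<Longrightarrow> f \<in> borel_measurable lebesgue"
  by (simp add: L2fun_def)

lemma L2fun_integrable_sq: "L2fun f \<Longrightarrow> integrable lebesgue (\<lambda>x. (cmod (f x))\<^sup>2)"
  by (simp add: L2fun_def)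

lemma L2fun_integrable_prod:
  assumes "L2fun f" "L2fun h"
  shows "integrable lebesgue (\<lambda>x. f x * h x)"
proof (rule Bochner_Integration.integrable_bound)
  show "integrable lebesgue (\<lambda>x. (cmod (f x))\<^sup>2 + (cmod (h x))\<^sup>2)"
    using assms by (simp add: L2fun_integrable_sq)
  show "(\<lambda>x. f x * h x) \<in> borel_measurable lebesgue"
    using assms by (intro borel_measurable_times L2fun_meas)
  have "a * b \<le> a\<^sup>2 + b\<^sup>2" if "0 \<le> a" "0 \<le> b" for a b :: real
    using sum_squares_bound[of a b] that mult_nonneg_nonneg[of a b] by linarith
  then show "AE x in lebesgue. cmod (f x * h x) \<le> norm ((cmod (f x))\<^sup>2 + (cmod (h x))\<^sup>2)"
    by (simp add: norm_mult)
qed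

lemma L2fun_cnj: "L2fun f \<Longrightarrow> L2fun (\<lambda>x. cnj (f x))"
  unfolding L2fun_def
  using measurable_compose[OF _ borel_measurable_continuous_onI[OF continuous_on_cnj[OF continuous_on_id]]]
  by auto

lemma L2fun_integrable_ip:
  "L2fun f \<Longrightarrow> L2fun h \<Longrightarrow> integrable lebesgue (\<lambda>x. f x * cnj (h x))"
  by (intro L2fun_integrable_prod L2fun_cnj)

lemma L2fun_zero [simp]: "L2fun (\<lambda>x. 0)"
  by (simp add: L2fun_def)

lemma L2fun_cmult: "L2fun f \<Longrightarrow> L2fun (\<lambda>x. c * f x)"
  by (auto simp: L2fun_def norm_mult power_mult_distrib)

lemma L2fun_add:
  assumes "L2fun f" "L2fun h"
  shows "L2fun (\<lambda>x. f x + h x)"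
proof -
  have "integrable lebesgue (\<lambda>x. (cmod (f x + h x))\<^sup>2)"
  proof (rule Bochner_Integration.integrable_bound)
    show "integrable lebesgue (\<lambda>x. 2 * (cmod (f x))\<^sup>2 + 2 * (cmod (h x))\<^sup>2)"
      using assms by (simp add: L2fun_integrable_sq)
    show "(\<lambda>x. (cmod (f x + h x))\<^sup>2) \<in> borel_measurable lebesgue"
      using assms[THEN L2fun_meas] by simp
    have "(cmod (a + b))\<^sup>2 \<le> 2 * (cmod a)\<^sup>2 + 2 * (cmod b)\<^sup>2" for a b
    proof -
      have "(cmod (a + b))\<^sup>2 \<le> (cmod a + cmod b)\<^sup>2"
        by (simp add: norm_triangle_ineq power_mono)
      also have "\<dots> \<le> 2 * (cmod a)\<^sup>2 + 2 * (cmod b)\<^sup>2"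
        using sum_squares_bound[of "cmod a" "cmod b"] by (simp add: power2_sum)
      finally show ?thesis .
    qed
    then show "AE x in lebesgue. norm ((cmod (f x + h x))\<^sup>2)
        \<le> norm (2 * (cmod (f x))\<^sup>2 + 2 * (cmod (h x))\<^sup>2)" by simp
  qed
  then show ?thesis using assms[THEN L2fun_meas] by (simp add: L2fun_def)
qed

lemma L2fun_diff: "L2fun f \<Longrightarrow> L2fun h \<Longrightarrow> L2fun (\<lambda>x. f x - h x)"
  using L2fun_add[of f "\<lambda>x. (-1) * h x"] L2fun_cmult[of h "-1"] by simp

lemma L2fun_sum: "(\<And>j. j \<in> A \<Longrightarrow> L2fun (F j)) \<Longrightarrow> L2fun (\<lambda>x. \<Sum>j\<in>A. F j x)"
  by (induction A rule: infinite_finite_induct) (auto intro!: L2fun_add)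

lemma L2fun_lincomb: "(\<And>j. j \<in> A \<Longrightarrow> L2fun (F j)) \<Longrightarrow> L2fun (\<lambda>x. \<Sum>j\<in>A. c j * F j x)"
  by (intro L2fun_sum L2fun_cmult)

lemma L2ip_add_left:
  "L2fun f \<Longrightarrow> L2fun h \<Longrightarrow> L2fun k \<Longrightarrow> L2ip (\<lambda>x. f x + h x) k = L2ip f k + L2ip h k"
  unfolding L2ip_def by (simp add: distrib_right L2fun_integrable_ip)

lemma L2ip_diff_left:
  "L2fun f \<Longrightarrow> L2fun h \<Longrightarrow> L2fun k \<Longrightarrow> L2ip (\<lambda>x. f x - h x) k = L2ip f k - L2ip h k"
  unfolding L2ip_def by (simp add: left_diff_distrib L2fun_integrable_ip)

lemma L2ip_cmult_left: "L2ip (\<lambda>x. c * f x) k = c * L2ip f k"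
  unfolding L2ip_def by (simp add: mult.assoc)

lemma L2ip_zero_left [simp]: "L2ip (\<lambda>x. 0) k = 0"
  unfolding L2ip_def by simp

lemma cnj_L2ip: "cnj (L2ip f h) = L2ip h f"
  unfolding L2ip_def by (simp add: mult.commute flip: Bochner_Integration.integral_cnj)

lemma L2ip_add_right:
  "L2fun f \<Longrightarrow> L2fun h \<Longrightarrow> L2fun k \<Longrightarrow> L2ip k (\<lambda>x. f x + h x) = L2ip k f + L2ip k h"
  unfolding L2ip_def by (simp add: distrib_left L2fun_integrable_ip)

lemma L2ip_diff_right:
  "L2fun f \<Longrightarrow> L2fun h \<Longrightarrow> L2fun k \<Longrightarrow> L2ip k (\<lambda>x. f x - h x) = L2ip k f - L2ip k h"
  unfolding L2ip_def by (simp add: right_diff_distrib L2fun_integrable_ip)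

lemma L2ip_cmult_right: "L2ip k (\<lambda>x. c * f x) = cnj c * L2ip k f"
  unfolding L2ip_def by (simp add: mult.left_commute)

lemma L2ip_zero_right [simp]: "L2ip k (\<lambda>x. 0) = 0"
  unfolding L2ip_def by simp

lemma L2ip_sum_left:
  assumes "\<And>j. j \<in> A \<Longrightarrow> L2fun (F j)" "L2fun k"
  shows "L2ip (\<lambda>x. \<Sum>j\<in>A. F j x) k = (\<Sum>j\<in>A. L2ip (F j) k)"
  using assms(1)
  by (induction A rule: infinite_finite_induct) (auto simp: L2ip_add_left L2fun_sum assms(2))

lemma L2ip_sum_right:
  assumes "\<And>j. j \<in> A \<Longrightarrow> L2fun (F j)" "L2fun k"
  shows "L2ip k (\<lambda>x. \<Sum>j\<in>A. F j x) = (\<Sum>j\<in>A. L2ip k (F j))"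
  using assms(1)
  by (induction A rule: infinite_finite_induct) (auto simp: L2ip_add_right L2fun_sum assms(2))

lemma L2ip_lincomb_left:
  assumes "\<And>j. j \<in> A \<Longrightarrow> L2fun (F j)" "L2fun k"
  shows "L2ip (\<lambda>x. \<Sum>j\<in>A. c j * F j x) k = (\<Sum>j\<in>A. c j * L2ip (F j) k)"
  by (subst L2ip_sum_left) (auto simp: assms L2fun_cmult L2ip_cmult_left)

lemma L2ip_lincomb_right:
  assumes "\<And>j. j \<in> A \<Longrightarrow> L2fun (F j)" "L2fun k"
  shows "L2ip k (\<lambda>x. \<Sum>j\<in>A. c j * F j x) = (\<Sum>j\<in>A. cnj (c j) * L2ip k (F j))"
  by (subst L2ip_sum_right) (auto simp: assms L2fun_cmult L2ip_cmult_right)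

lemma L2nrm_nonneg [simp]: "0 \<le> L2nrm f"
  by (simp add: L2nrm_def)

lemma L2nrm_sq: "(L2nrm f)\<^sup>2 = (LINT x|lebesgue. (cmod (f x))\<^sup>2)"
  by (simp add: L2nrm_def)

lemma L2ip_self: "L2ip f f = of_real ((L2nrm f)\<^sup>2)"
  by (simp add: L2ip_def L2nrm_sq complex_norm_square[symmetric] flip: integral_complex_of_real)

lemma L2nrm_sq_Re: "(L2nrm f)\<^sup>2 = Re (L2ip f f)"
  by (simp add: L2ip_self)

lemma L2nrm_cong_AE:
  assumes "L2fun f" "L2fun h" "AE x in lebesgue. f x = h x" 
  shows "L2nrm f = L2nrm h"
  unfolding L2nrm_def 
  by (rule arg_cong[where f=sqrt], rule integral_cong_AE)
     (use assms L2fun_integrable_sq[THEN borel_measurable_integrable] in \<open>auto elim!: eventually_mono\<close>)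

lemma L2ip_cong_AE:
  assumes "L2fun f" "L2fun f'" "L2fun h" "L2fun h'"
    "AE x in lebesgue. f x = f' x" "AE x in lebesgue. h x = h' x"
  shows "L2ip f h = L2ip f' h'"
  unfolding L2ip_def 
proof (rule integral_cong_AE)
  show "AE x in lebesgue. f x * cnj (h x) = f' x * cnj (h' x)"
    using assms(5,6) by eventually_elim simp
qed (use assms L2fun_integrable_ip[THEN borel_measurable_integrable] in auto)

lemma L2nrm_cmult: "L2nrm (\<lambda>x. c * f x) = cmod c * L2nrm f"
  by (simp add: L2nrm_def norm_mult power_mult_distrib real_sqrt_mult)

lemma L2nrm_minus_commute: "L2nrm (\<lambda>x. f x - h x) = L2nrm (\<lambda>x. h x - f x)"
  by (simp add: L2nrm_def norm_minus_commute)

lemma L2nrm_add_sq: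
  assumes "L2fun f" "L2fun h"
  shows "(L2nrm (\<lambda>x. f x + h x))\<^sup>2 = (L2nrm f)\<^sup>2 + 2 * Re (L2ip f h) + (L2nrm h)\<^sup>2"
proof -
  have "Re (L2ip h f) = Re (L2ip f h)" by (subst cnj_L2ip[symmetric]) simp
  then show ?thesis using assms
    by (simp add: L2nrm_sq_Re L2ip_add_left L2ip_add_right L2fun_add)
qed

lemma L2nrm_diff_sq:
  assumes "L2fun f" "L2fun h"
  shows "(L2nrm (\<lambda>x. f x - h x))\<^sup>2 = (L2nrm f)\<^sup>2 - 2 * Re (L2ip f h) + (L2nrm h)\<^sup>2"
proof -
  have "Re (L2ip h f) = Re (L2ip f h)" by (subst cnj_L2ip[symmetric]) simp
  then show ?thesis using assms
    by (simp add: L2nrm_sq_Re L2ip_diff_left L2ip_diff_right L2fun_diff)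
qed

lemma L2nrm_eq_0_AE:
  assumes "L2fun f"
  shows "L2nrm f = 0 \<longleftrightarrow> (AE x in lebesgue. f x = 0)"
  using integral_nonneg_eq_0_iff_AE[OF L2fun_integrable_sq[OF assms]]
  by (simp add: L2nrm_def)

text \<open>The projection of \<open>f\<close> to the line spanned by \<open>h\<close> is not longer than \<open>f\<close>.\<close>

lemma L2_Cauchy_Schwarz:
  assumes "L2fun f" "L2fun h"
  shows "cmod (L2ip f h) \<le> L2nrm f * L2nrm h"
proof (cases "L2nrm h = 0")
  case True
  then have "AE x in lebesgue. h x = 0" using assms by (simp add: L2nrm_eq_0_AE)
  then have "L2ip f h = L2ip f (\<lambda>x. 0)"
    using assms by (intro L2ip_cong_AE) auto
  then show ?thesis by simp
next
  case False
  define n where "n = (L2nrm h)\<^sup>2"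
  have n: "n > 0" using False by (simp add: n_def)
  define p where "p = L2ip f h"
  \<comment> \<open>\<open>t * h\<close> is the projection of \<open>f\<close>.\<close>
  define t where "t = p / complex_of_real n"
  have "0 \<le> (L2nrm (\<lambda>x. f x - t * h x))\<^sup>2" by simp
  also have "\<dots> = (L2nrm f)\<^sup>2 - 2 * Re (cnj t * p) + (cmod t)\<^sup>2 * n"
    by (subst L2nrm_diff_sq)
       (auto simp: assms L2fun_cmult L2ip_cmult_right p_def n_def L2nrm_cmult power_mult_distrib)
  also have "Re (cnj t * p) = (cmod p)\<^sup>2 / n"
    unfolding cmod_power2 by (simp add: t_def power2_eq_square add_divide_distrib)
  also have "(cmod t)\<^sup>2 * n = (cmod p)\<^sup>2 / n"
    using n by (simp add: t_def norm_divide power2_eq_square field_simps)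
  finally have "(cmod p)\<^sup>2 \<le> (L2nrm f)\<^sup>2 * n"
    using n by (simp add: field_simps)
  then have "(cmod p)\<^sup>2 \<le> (L2nrm f * L2nrm h)\<^sup>2"
    by (simp add: n_def power_mult_distrib)
  then show ?thesis unfolding p_def
    by (rule power2_le_imp_le) simp
qed

lemma L2nrm_triangle:
  assumes "L2fun f" "L2fun h"
  shows "L2nrm (\<lambda>x. f x + h x) \<le> L2nrm f + L2nrm h"
proof (rule power2_le_imp_le)
  have "Re (L2ip f h) \<le> L2nrm f * L2nrm h"
    using L2_Cauchy_Schwarz[OF assms] complex_Re_le_cmod[of "L2ip f h"] by linarith
  then show "(L2nrm (\<lambda>x. f x + h x))\<^sup>2 \<le> (L2nrm f + L2nrm h)\<^sup>2"
    using assms by (simp add: L2nrm_add_sq power2_sum)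
qed simp

lemma L2nrm_triangle_diff:
  assumes "L2fun f" "L2fun h" "L2fun k"
  shows "L2nrm (\<lambda>x. f x - k x) \<le> L2nrm (\<lambda>x. f x - h x) + L2nrm (\<lambda>x. h x - k x)"
  using L2nrm_triangle[of "\<lambda>x. f x - h x" "\<lambda>x. h x - k x"] assms by (simp add: L2fun_diff)

lemma L2nrm_triangle_abs:
  assumes "L2fun f" "L2fun h"
  shows "\<bar>L2nrm f - L2nrm h\<bar> \<le> L2nrm (\<lambda>x. f x - h x)"
proof -
  have "L2nrm f \<le> L2nrm (\<lambda>x. f x - h x) + L2nrm h"
    using L2nrm_triangle[of "\<lambda>x. f x - h x" h] assms by (simp add: L2fun_diff)
  moreover have "L2nrm h \<le> L2nrm (\<lambda>x. h x - f x) + L2nrm f"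
    using L2nrm_triangle[of "\<lambda>x. h x - f x" f] assms by (simp add: L2fun_diff)
  ultimately show ?thesis by (simp add: L2nrm_minus_commute[of h f])
qed

lemma L2ip_tendsto:
  assumes "((\<lambda>A. L2nrm (\<lambda>x. h A x - f x)) \<longlongrightarrow> 0) F" "\<And>A. L2fun (h A)" "L2fun f" "L2fun k"
  shows "((\<lambda>A. L2ip (h A) k) \<longlongrightarrow> L2ip f k) F"
proof (rule LIM_zero_cancel, rule Lim_null_comparison)
  show "((\<lambda>A. L2nrm (\<lambda>x. h A x - f x) * L2nrm k) \<longlongrightarrow> 0) F"
    using tendsto_mult_right[OF assms(1), of "L2nrm k"] by simp
  show "\<forall>\<^sub>F A in F. cmod (L2ip (h A) k - L2ip f k) \<le> L2nrm (\<lambda>x. h A x - f x) * L2nrm k"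
  proof (intro always_eventually allI)
    fix A show "cmod (L2ip (h A) k - L2ip f k) \<le> L2nrm (\<lambda>x. h A x - f x) * L2nrm k"
      using assms L2_Cauchy_Schwarz[of "\<lambda>x. h A x - f x" k] by (simp add: L2fun_diff L2ip_diff_left)
  qed
qed

lemma L2nrm_tendsto:
  assumes "((\<lambda>A. L2nrm (\<lambda>x. h A x - f x)) \<longlongrightarrow> 0) F" "\<And>A. L2fun (h A)" "L2fun f"
  shows "((\<lambda>A. L2nrm (h A)) \<longlongrightarrow> L2nrm f) F"
  by (rule LIM_zero_cancel, rule Lim_null_comparison[OF _ assms(1)])
     (use L2nrm_triangle_abs assms in \<open>auto intro!: always_eventually\<close>)

text \<open>A sum in \<open>L2_has_sum\<close> constrains the terms with index in \<open>I\<close> only, whereas \<open>L2ip_tendsto\<close>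
  asks for membership at every point of the filter; the partial sums are therefore cut to \<open>I\<close>.\<close>

lemma L2_has_sum_cut:
  assumes "L2_has_sum F I s"
  shows "((\<lambda>A. L2nrm (\<lambda>x. (\<Sum>j\<in>A \<inter> I. F j x) - s x)) \<longlongrightarrow> 0) (finite_subsets_at_top I)"
proof (rule tendsto_cong[THEN iffD1])
  show "((\<lambda>A. L2nrm (\<lambda>x. (\<Sum>j\<in>A. F j x) - s x)) \<longlongrightarrow> 0) (finite_subsets_at_top I)"
    using assms by (simp add: L2_has_sum_def)
  show "\<forall>\<^sub>F A in finite_subsets_at_top I. L2nrm (\<lambda>x. (\<Sum>j\<in>A. F j x) - s x)
      = L2nrm (\<lambda>x. (\<Sum>j\<in>A \<inter> I. F j x) - s x)"
    by (rule eventually_finite_subsets_at_top_weakI) (simp add: Int_absorb2)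
qed

lemma L2_has_sum_ip:
  assumes "L2_has_sum F I s" "L2fun k"
  shows "((\<lambda>j. L2ip (F j) k) has_sum L2ip s k) I"
proof -
  have F: "\<And>j. j \<in> I \<Longrightarrow> L2fun (F j)" and s: "L2fun s" using assms by (auto simp: L2_has_sum_def)
  have "((\<lambda>A. L2ip (\<lambda>x. \<Sum>j\<in>A \<inter> I. F j x) k) \<longlongrightarrow> L2ip s k) (finite_subsets_at_top I)"
    by (rule L2ip_tendsto[OF L2_has_sum_cut[OF assms(1)]]) (auto intro!: L2fun_sum F s assms)
  moreover have "\<forall>\<^sub>F A in finite_subsets_at_top I. L2ip (\<lambda>x. \<Sum>j\<in>A \<inter> I. F j x) k = (\<Sum>j\<in>A. L2ip (F j) k)"
    by (rule eventually_finite_subsets_at_top_weakI)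
       (use F assms in \<open>auto simp: Int_absorb2 L2ip_sum_left subset_iff\<close>)
  ultimately show ?thesis unfolding has_sum_def
    by (rule tendsto_cong[THEN iffD1, rotated])
qed

section \<open>Completeness and orthonormal expansions\<close>

text \<open>Riesz and Fischer. The weights \<open>2 ^ n\<close> still leave the integrals of the squared increments
  summable, so at almost every point the increments are dominated by a geometric sequence.
  Completeness is used for sequences that converge geometrically only; such sequences come with
  an explicit rate.\<close>

lemma L2_complete_geometric:
  assumes h: "\<And>n. L2fun (h n)"
    and inc: "\<And>n. L2nrm (\<lambda>x. h (Suc n) x - h n x) \<le> (1/2) ^ n"
  shows "\<exists>s. L2fun s \<and> (\<forall>n. L2nrm (\<lambda>x. h n x - s x) \<le> 2 * (1/2) ^ n)"
proof -
  have dist: "L2nrm (\<lambda>x. h (n + k) x - h n x) \<le> 2 * (1/2) ^ n - 2 * (1/2) ^ (n + k)" for n k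
  proof (induction k)
    case 0
    show ?case by (simp add: L2nrm_def)
  next
    case (Suc k)
    have "L2nrm (\<lambda>x. h (n + Suc k) x - h n x)
        \<le> L2nrm (\<lambda>x. h (Suc (n + k)) x - h (n + k) x) + L2nrm (\<lambda>x. h (n + k) x - h n x)"
      using L2nrm_triangle_diff[OF h h h] by simp
    also have "\<dots> \<le> (1/2) ^ (n + k) + (2 * (1/2) ^ n - 2 * (1/2) ^ (n + k))"
      by (intro add_mono inc Suc)
    finally show ?case by simp
  qed
  have hm [measurable]: "h n \<in> borel_measurable lebesgue" for n
    using h by (rule L2fun_meas)
  define D where "D n x = 2 ^ n * (cmod (h (Suc n) x - h n x))\<^sup>2" for n x
  have D_int: "(\<integral>\<^sup>+x. ennreal (D n x) \<partial>lebesgue) \<le> ennreal ((1/2) ^ n)" for n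
  proof -
    have "(\<integral>\<^sup>+x. ennreal (D n x) \<partial>lebesgue) = ennreal (LINT x|lebesgue. D n x)"
      unfolding D_def by (intro nn_integral_eq_integral) (auto intro!: L2fun_integrable_sq L2fun_diff h)
    also have "(LINT x|lebesgue. D n x) = 2 ^ n * (L2nrm (\<lambda>x. h (Suc n) x - h n x))\<^sup>2"
      by (simp add: D_def L2nrm_sq)
    also have "\<dots> \<le> 2 ^ n * ((1/2) ^ n)\<^sup>2"
      by (intro mult_left_mono power_mono inc) auto
    also have "\<dots> = (1/2) ^ n" by (simp add: power2_eq_square flip: power_mult_distrib)
    finally show ?thesis by (simp add: ennreal_leI)
  qed
  have "(\<integral>\<^sup>+x. (\<Sum>n. ennreal (D n x)) \<partial>lebesgue) = (\<Sum>n. \<integral>\<^sup>+x. ennreal (D n x) \<partial>lebesgue)"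
    unfolding D_def by (intro nn_integral_suminf) measurable
  also have "\<dots> \<le> (\<Sum>n. ennreal ((1/2) ^ n))"
    by (intro suminf_le D_int) auto
  also have "\<dots> < \<infinity>"
    by (subst suminf_ennreal2) auto
  finally have "AE x in lebesgue. (\<Sum>n. ennreal (D n x)) \<noteq> \<infinity>"
    unfolding D_def by (intro nn_integral_PInf_AE) auto
  then have conv: "AE x in lebesgue. convergent (\<lambda>n. h n x)"
  proof eventually_elim
    case (elim x)
    then obtain C where C: "(\<Sum>n. ennreal (D n x)) = ennreal C" "C \<ge> 0"
      by (cases "\<Sum>n. ennreal (D n x)") auto
    have "ennreal (D n x) \<le> ennreal C" for n
      unfolding C(1)[symmetric] using sum_le_suminf[of "\<lambda>n. ennreal (D n x)" "{n}"] by auto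
    then have DC: "D n x \<le> C" for n using C(2) by (simp add: ennreal_le_iff)
    have le: "cmod (h (Suc n) x - h n x) \<le> sqrt C * (sqrt (1/2)) ^ n" for n
    proof (rule power2_le_imp_le)
      have "(sqrt (1/2) ^ n)\<^sup>2 = (1/2) ^ n"
        by (simp add: power_mult[symmetric] mult.commute[of n]) (simp add: power_mult)
      then have "(sqrt C * (sqrt (1/2)) ^ n)\<^sup>2 = C * (1/2) ^ n"
        using C(2) by (simp add: power_mult_distrib)
      moreover have "(cmod (h (Suc n) x - h n x))\<^sup>2 \<le> C * (1/2) ^ n"
        using DC[of n] by (simp add: D_def field_simps)
      ultimately show "(cmod (h (Suc n) x - h n x))\<^sup>2 \<le> (sqrt C * (sqrt (1/2)) ^ n)\<^sup>2" by simp
    qed (use C in simp)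
    have "summable (\<lambda>n. sqrt C * (sqrt (1/2)) ^ n)"
      by (intro summable_mult summable_geometric) (simp add: real_sqrt_lt_1_iff)
    then have "summable (\<lambda>n. h (Suc n) x - h n x)"
      by (rule summable_comparison_test'[where N=0]) (use le in auto)
    then have "convergent (\<lambda>n. \<Sum>k<n. h (Suc k) x - h k x)"
      by (simp add: summable_iff_convergent)
    then have "convergent (\<lambda>n. h n x - h 0 x)"
      by (simp add: sum_lessThan_telescope[of "\<lambda>k. h k x"])
    then have "convergent (\<lambda>n. (h n x - h 0 x) + h 0 x)"
      by (intro convergent_add convergent_const)
    then show ?case by simp
  qed
  define s where "s x = lim (\<lambda>n. h n x)" for x
  have [measurable]: "s \<in> borel_measurable lebesgue"
    unfolding s_def by (rule borel_measurable_lim_metric) simp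
  have lim: "AE x in lebesgue. (\<lambda>n. h n x) \<longlonglongrightarrow> s x"
    using conv by eventually_elim (simp add: s_def convergent_LIMSEQ_iff)
  have nn: "(\<integral>\<^sup>+x. ennreal ((cmod (h n x - s x))\<^sup>2) \<partial>lebesgue) \<le> ennreal ((2 * (1/2) ^ n)\<^sup>2)" for n
  proof -
    have "(\<integral>\<^sup>+x. ennreal ((cmod (h n x - s x))\<^sup>2) \<partial>lebesgue)
        = (\<integral>\<^sup>+x. liminf (\<lambda>k. ennreal ((cmod (h n x - h (n + k) x))\<^sup>2)) \<partial>lebesgue)"
    proof (rule nn_integral_cong_AE)
      show "AE x in lebesgue. ennreal ((cmod (h n x - s x))\<^sup>2)
          = liminf (\<lambda>k. ennreal ((cmod (h n x - h (n + k) x))\<^sup>2))"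
        using lim
      proof eventually_elim
        case (elim x)
        have "(\<lambda>k. h (n + k) x) \<longlonglongrightarrow> s x"
          using LIMSEQ_ignore_initial_segment[OF elim, of n] by (simp add: add.commute)
        then have "(\<lambda>k. ennreal ((cmod (h n x - h (n + k) x))\<^sup>2))
            \<longlonglongrightarrow> ennreal ((cmod (h n x - s x))\<^sup>2)"
          by (intro tendsto_ennrealI tendsto_intros)
        then show ?case by (intro lim_imp_Liminf[symmetric]) auto
      qed
    qed
    also have "\<dots> \<le> liminf (\<lambda>k. \<integral>\<^sup>+x. ennreal ((cmod (h n x - h (n + k) x))\<^sup>2) \<partial>lebesgue)"
      by (intro nn_integral_liminf) measurable
    also have "\<dots> \<le> liminf (\<lambda>k. ennreal ((2 * (1/2) ^ n)\<^sup>2))"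
    proof (intro Liminf_mono always_eventually allI)
      fix k
      have "(\<integral>\<^sup>+x. ennreal ((cmod (h n x - h (n + k) x))\<^sup>2) \<partial>lebesgue)
          = ennreal ((L2nrm (\<lambda>x. h n x - h (n + k) x))\<^sup>2)"
        unfolding L2nrm_sq by (intro nn_integral_eq_integral L2fun_integrable_sq L2fun_diff h) auto
      also have "\<dots> \<le> ennreal ((2 * (1/2) ^ n)\<^sup>2)"
      proof (intro ennreal_leI power_mono)
        have "(0::real) \<le> 2 * (1/2) ^ (n + k)" by simp
        then show "L2nrm (\<lambda>x. h n x - h (n + k) x) \<le> 2 * (1/2) ^ n"
          using dist[where n=n and k=k] L2nrm_minus_commute[of "h n" "h (n + k)"] by linarith
      qed simp
      finally show "(\<integral>\<^sup>+x. ennreal ((cmod (h n x - h (n + k) x))\<^sup>2) \<partial>lebesgue)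
          \<le> ennreal ((2 * (1/2) ^ n)\<^sup>2)" .
    qed
    also have "\<dots> = ennreal ((2 * (1/2) ^ n)\<^sup>2)" by (simp add: Liminf_const)
    finally show ?thesis .
  qed
  have diff: "L2fun (\<lambda>x. h n x - s x)" for n
    unfolding L2fun_def integrable_iff_bounded
    using nn[of n] by (auto intro: le_less_trans)
  then have "L2fun s"
    using L2fun_diff[OF h[of 0] diff[of 0]] by simp
  moreover have "L2nrm (\<lambda>x. h n x - s x) \<le> 2 * (1/2) ^ n" for n
  proof (rule power2_le_imp_le)
    have "ennreal ((L2nrm (\<lambda>x. h n x - s x))\<^sup>2) \<le> ennreal ((2 * (1/2) ^ n)\<^sup>2)"
      unfolding L2nrm_sq using nn[of n] nn_integral_eq_integral[OF L2fun_integrable_sq[OF diff[of n]]]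
      by simp
    then show "(L2nrm (\<lambda>x. h n x - s x))\<^sup>2 \<le> (2 * (1/2) ^ n)\<^sup>2"
      by (subst (asm) ennreal_le_iff) auto
  qed simp
  ultimately show ?thesis by blast
qed

lemma summable_on_small_tails:
  fixes c :: "'i \<Rightarrow> real"
  assumes "c summable_on I" "\<And>j. j \<in> I \<Longrightarrow> 0 \<le> c j" "0 < e"
  shows "\<exists>K. finite K \<and> K \<subseteq> I \<and> (\<forall>A. finite A \<longrightarrow> A \<subseteq> I \<longrightarrow> A \<inter> K = {} \<longrightarrow> sum c A \<le> e)"
proof -
  have "(sum c \<longlongrightarrow> infsum c I) (finite_subsets_at_top I)"
    using assms(1) by (simp add: has_sum_infsum flip: has_sum_def)
  then have "\<forall>\<^sub>F A in finite_subsets_at_top I. dist (sum c A) (infsum c I) < e"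
    using assms(3) by (simp add: tendsto_iff)
  then obtain K where K: "finite K" "K \<subseteq> I" "dist (sum c K) (infsum c I) < e"
    unfolding eventually_finite_subsets_at_top by blast
  have "sum c A \<le> e" if A: "finite A" "A \<subseteq> I" "A \<inter> K = {}" for A
  proof -
    have "sum c A + sum c K = sum c (A \<union> K)" using A K by (simp add: sum.union_disjoint)
    also have "\<dots> \<le> infsum c I"
      by (rule finite_sum_le_infsum) (use A K assms in auto)
    finally show ?thesis using K(3) by (simp add: dist_real_def)
  qed
  then show ?thesis using K by blast
qed

lemma L2_has_sum_synthesis:
  assumes F: "\<And>j. j \<in> I \<Longrightarrow> L2fun (F j)" and b: "0 \<le> b"
    and bound: "\<And>A. finite A \<Longrightarrow> A \<subseteq> I \<Longrightarrow>
      (L2nrm (\<lambda>x. \<Sum>j\<in>A. c j * F j x))\<^sup>2 \<le> b * (\<Sum>j\<in>A. (cmod (c j))\<^sup>2)"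
    and c: "(\<lambda>j. (cmod (c j))\<^sup>2) summable_on I"
  shows "\<exists>s. L2_has_sum (\<lambda>j x. c j * F j x) I s"
proof -
  \<comment> \<open>Tails of this size give sums of norm at most \<open>(1/2) ^ n\<close>; the summand \<open>1\<close> allows \<open>b = 0\<close>.\<close>
  define e where "e n = (1/4) ^ n / (b + 1)" for n
  have "\<exists>K. finite K \<and> K \<subseteq> I \<and> (\<forall>A. finite A \<longrightarrow> A \<subseteq> I \<longrightarrow> A \<inter> K = {} \<longrightarrow>
      (\<Sum>j\<in>A. (cmod (c j))\<^sup>2) \<le> e n)" for n
    by (rule summable_on_small_tails[OF c]) (use b in \<open>auto simp: e_def\<close>)
  then obtain K where K: "\<And>n. finite (K n)" "\<And>n. K n \<subseteq> I"
    "\<And>n A. finite A \<Longrightarrow> A \<subseteq> I \<Longrightarrow> A \<inter> K n = {} \<Longrightarrow> (\<Sum>j\<in>A. (cmod (c j))\<^sup>2) \<le> e n"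
    by metis
  define L where "L n = (\<Union>m\<le>n. K m)" for n
  have L: "finite (L n)" "L n \<subseteq> I" "K n \<subseteq> L n" "L n \<subseteq> L (Suc n)" for n
    using K(1,2) by (auto simp: L_def intro: le_SucI)
  have small: "L2nrm (\<lambda>x. \<Sum>j\<in>A. c j * F j x) \<le> (1/2) ^ n"
    if A: "finite A" "A \<subseteq> I" "A \<inter> L n = {}" for A n
  proof (rule power2_le_imp_le)
    have "(L2nrm (\<lambda>x. \<Sum>j\<in>A. c j * F j x))\<^sup>2 \<le> b * (\<Sum>j\<in>A. (cmod (c j))\<^sup>2)"
      using A by (intro bound)
    also have "\<dots> \<le> (b + 1) * e n"
      using A L(3)[of n] b by (intro mult_mono K(3) sum_nonneg) auto
    also have "\<dots> = ((1/2) ^ n)\<^sup>2"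
      using b by (simp add: e_def power2_eq_square flip: power_mult_distrib)
    finally show "(L2nrm (\<lambda>x. \<Sum>j\<in>A. c j * F j x))\<^sup>2 \<le> ((1/2) ^ n)\<^sup>2" .
  qed simp
  define h where "h n x = (\<Sum>j\<in>L n. c j * F j x)" for n x
  have h: "L2fun (h n)" for n
    unfolding h_def using L(2) F by (intro L2fun_lincomb) auto
  have split: "(\<Sum>j\<in>A. c j * F j x) - h n x = (\<Sum>j\<in>A - L n. c j * F j x)"
    if "finite A" "L n \<subseteq> A" for A n x
    unfolding h_def using that L(1) by (simp add: sum_diff)
  have "L2nrm (\<lambda>x. h (Suc n) x - h n x) \<le> (1/2) ^ n" for n
  proof -
    have "(\<lambda>x. h (Suc n) x - h n x) = (\<lambda>x. \<Sum>j\<in>L (Suc n) - L n. c j * F j x)"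
      using split[of "L (Suc n)" n] L(1,4) by (simp add: h_def fun_eq_iff)
    then show ?thesis using small[of "L (Suc n) - L n" n] L(1,2) by auto
  qed
  from L2_complete_geometric[OF h this] obtain s where
    s: "L2fun s" "\<And>n. L2nrm (\<lambda>x. h n x - s x) \<le> 2 * (1/2) ^ n" by blast
  have near: "L2nrm (\<lambda>x. (\<Sum>j\<in>A. c j * F j x) - s x) \<le> 3 * (1/2) ^ n"
    if A: "finite A" "A \<subseteq> I" "L n \<subseteq> A" for A n
  proof -
    have "L2nrm (\<lambda>x. (\<Sum>j\<in>A. c j * F j x) - s x)
        \<le> L2nrm (\<lambda>x. (\<Sum>j\<in>A. c j * F j x) - h n x) + L2nrm (\<lambda>x. h n x - s x)"
      using A F by (intro L2nrm_triangle_diff L2fun_lincomb h s) auto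
    also have "(\<lambda>x. (\<Sum>j\<in>A. c j * F j x) - h n x) = (\<lambda>x. \<Sum>j\<in>A - L n. c j * F j x)"
      using split A by auto
    also have "L2nrm \<dots> + L2nrm (\<lambda>x. h n x - s x) \<le> (1/2) ^ n + 2 * (1/2) ^ n"
      using A by (intro add_mono small s) auto
    finally show ?thesis by simp
  qed
  have "((\<lambda>A. L2nrm (\<lambda>x. (\<Sum>j\<in>A. c j * F j x) - s x)) \<longlongrightarrow> 0) (finite_subsets_at_top I)"
  proof (rule tendstoI)
    fix r :: real assume r: "r > 0"
    have "(\<lambda>n. 3 * (1/2::real) ^ n) \<longlonglongrightarrow> 3 * 0"
      by (intro tendsto_mult_left LIMSEQ_realpow_zero) auto
    then have "\<forall>\<^sub>F n in sequentially. 3 * (1/2::real) ^ n < r"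
      using r by (intro order_tendstoD) auto
    then obtain n where n: "3 * (1/2::real) ^ n < r" by (auto simp: eventually_sequentially)
    show "\<forall>\<^sub>F A in finite_subsets_at_top I.
        dist (L2nrm (\<lambda>x. (\<Sum>j\<in>A. c j * F j x) - s x)) 0 < r"
      unfolding eventually_finite_subsets_at_top
      using near[where n=n] n L(1,2)[of n] by (intro exI[of _ "L n"]) fastforce
  qed
  then show ?thesis
    using F s by (auto simp: L2_has_sum_def intro!: L2fun_cmult)
qed

text \<open>The adjoint of the analysis operator has the same norm as the analysis operator.\<close>

lemma bessel_seq_synthesis_bound:
  assumes bes: "bessel_seq I F b" and b: "0 \<le> b" and A: "finite A" "A \<subseteq> I"
  shows "(L2nrm (\<lambda>x. \<Sum>j\<in>A. c j * F j x))\<^sup>2 \<le> b * (\<Sum>j\<in>A. (cmod (c j))\<^sup>2)"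
proof -
  define h where "h x = (\<Sum>j\<in>A. c j * F j x)" for x
  have F: "\<And>j. j \<in> A \<Longrightarrow> L2fun (F j)" using bes A by (auto simp: bessel_seq_def)
  have h: "L2fun h" unfolding h_def using F by (intro L2fun_lincomb)
  have "(\<Sum>j\<in>A. (cmod (L2ip h (F j)))\<^sup>2) \<le> (\<Sum>\<^sub>\<infinity>j\<in>I. (cmod (L2ip h (F j)))\<^sup>2)"
    using bes h A by (intro finite_sum_le_infsum) (auto simp: bessel_seq_def)
  also have "\<dots> \<le> b * (L2nrm h)\<^sup>2" using bes h by (auto simp: bessel_seq_def)
  finally have coef: "(\<Sum>j\<in>A. (cmod (L2ip h (F j)))\<^sup>2) \<le> b * (L2nrm h)\<^sup>2" .
  have "L2ip h h = (\<Sum>j\<in>A. c j * L2ip (F j) h)"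
    using L2ip_lincomb_left[of A F h c, OF F h] by (simp flip: h_def)
  then have "(L2nrm h)\<^sup>2 = cmod (\<Sum>j\<in>A. c j * L2ip (F j) h)"
    by (metis L2ip_self norm_of_real abs_of_nonneg zero_le_power2)
  also have "\<dots> \<le> (\<Sum>j\<in>A. cmod (c j) * cmod (L2ip h (F j)))"
    by (rule order_trans[OF norm_sum]) (simp add: norm_mult flip: cnj_L2ip[of h])
  finally have "((L2nrm h)\<^sup>2)\<^sup>2 \<le> (\<Sum>j\<in>A. cmod (c j) * cmod (L2ip h (F j)))\<^sup>2"
    by (intro power_mono) auto
  also have "\<dots> \<le> (\<Sum>j\<in>A. (cmod (c j))\<^sup>2) * (\<Sum>j\<in>A. (cmod (L2ip h (F j)))\<^sup>2)"
    by (rule Cauchy_Schwarz_ineq_sum)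
  also have "\<dots> \<le> (\<Sum>j\<in>A. (cmod (c j))\<^sup>2) * (b * (L2nrm h)\<^sup>2)"
    by (intro mult_left_mono coef sum_nonneg) auto
  finally have "(L2nrm h)\<^sup>2 * (L2nrm h)\<^sup>2 \<le> (b * (\<Sum>j\<in>A. (cmod (c j))\<^sup>2)) * (L2nrm h)\<^sup>2"
    by (simp add: power2_eq_square[of "(L2nrm h)\<^sup>2"] mult_ac)
  moreover have "0 \<le> b * (\<Sum>j\<in>A. (cmod (c j))\<^sup>2)"
    using b by (simp add: sum_nonneg)
  ultimately have "(L2nrm h)\<^sup>2 \<le> b * (\<Sum>j\<in>A. (cmod (c j))\<^sup>2)"
  proof (cases "L2nrm h = 0")
    case False
    then have "0 < (L2nrm h)\<^sup>2" by simp
    with \<open>(L2nrm h)\<^sup>2 * (L2nrm h)\<^sup>2 \<le> _\<close> show ?thesis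
      by (rule mult_right_le_imp_le)
  qed simp
  then show ?thesis by (simp add: h_def[abs_def])
qed

lemma bessel_seq_has_sum:
  assumes "bessel_seq I F b" "0 \<le> b" "(\<lambda>j. (cmod (c j))\<^sup>2) summable_on I"
  shows "\<exists>s. L2_has_sum (\<lambda>j x. c j * F j x) I s"
  using assms(1,3) bessel_seq_synthesis_bound[OF assms(1,2)]
  by (intro L2_has_sum_synthesis[OF _ assms(2)]) (auto simp: bessel_seq_def)

lemma bessel_seq_frame_operator:
  assumes "bessel_seq I F b" "0 \<le> b"
  shows "\<exists>S. is_frame_operator I F S"
proof -
  have "\<exists>s. L2_has_sum (\<lambda>j x. L2ip f (F j) * F j x) I s" if "L2fun f" for f
    using assms that by (intro bessel_seq_has_sum[OF assms]) (auto simp: bessel_seq_def)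
  then show ?thesis unfolding is_frame_operator_def by metis
qed

lemma bessel_seqI_finite:
  assumes "\<And>j. j \<in> I \<Longrightarrow> L2fun (F j)"
    and "\<And>f A. L2fun f \<Longrightarrow> finite A \<Longrightarrow> A \<subseteq> I \<Longrightarrow> (\<Sum>j\<in>A. (cmod (L2ip f (F j)))\<^sup>2) \<le> b * (L2nrm f)\<^sup>2"
  shows "bessel_seq I F b"
proof -
  have s: "(\<lambda>j. (cmod (L2ip f (F j)))\<^sup>2) summable_on I" if "L2fun f" for f
    using assms(2)[OF that] by (intro nonneg_bdd_above_summable_on) (auto intro!: bdd_aboveI2)
  moreover have "(\<Sum>\<^sub>\<infinity>j\<in>I. (cmod (L2ip f (F j)))\<^sup>2) \<le> b * (L2nrm f)\<^sup>2" if "L2fun f" for f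
    using s[OF that] assms(2)[OF that] by (intro infsum_le_finite_sums) auto
  ultimately show ?thesis using assms(1) by (simp add: bessel_seq_def)
qed

locale orthonormal_family =
  fixes I :: "'i set" and F :: "'i \<Rightarrow> real ^ 'd \<Rightarrow> complex"
  assumes fam_L2: "\<And>j. j \<in> I \<Longrightarrow> L2fun (F j)"
    and fam_ip: "\<And>i j. i \<in> I \<Longrightarrow> j \<in> I \<Longrightarrow> L2ip (F i) (F j) = (if i = j then 1 else 0)"
begin

lemma ip_lincomb:
  assumes "finite A" "A \<subseteq> I" "k \<in> I"
  shows "L2ip (\<lambda>x. \<Sum>j\<in>A. c j * F j x) (F k) = (if k \<in> A then c k else 0)"
proof -
  have "L2ip (\<lambda>x. \<Sum>j\<in>A. c j * F j x) (F k) = (\<Sum>j\<in>A. c j * L2ip (F j) (F k))"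
    using assms fam_L2 by (intro L2ip_lincomb_left) auto
  also have "\<dots> = (\<Sum>j\<in>A. if j = k then c k else 0)"
    using assms by (intro sum.cong refl) (auto simp: fam_ip subset_iff)
  finally show ?thesis using assms(1) by simp
qed

lemma nrm_lincomb:
  assumes "finite A" "A \<subseteq> I"
  shows "(L2nrm (\<lambda>x. \<Sum>j\<in>A. c j * F j x))\<^sup>2 = (\<Sum>j\<in>A. (cmod (c j))\<^sup>2)"
proof -
  let ?h = "\<lambda>x. \<Sum>j\<in>A. c j * F j x"
  have "L2ip ?h ?h = (\<Sum>j\<in>A. cnj (c j) * L2ip ?h (F j))"
    using assms fam_L2 by (intro L2ip_lincomb_right L2fun_lincomb) auto
  also have "\<dots> = (\<Sum>j\<in>A. of_real ((cmod (c j))\<^sup>2))"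
    using assms by (intro sum.cong refl) (auto simp: ip_lincomb subset_iff complex_norm_square mult.commute simp del: of_real_power)
  finally have "of_real ((L2nrm ?h)\<^sup>2) = (of_real (\<Sum>j\<in>A. (cmod (c j))\<^sup>2) :: complex)"
    by (simp add: L2ip_self)
  then show ?thesis by (simp only: of_real_eq_iff)
qed

lemma bessel: "bessel_seq I F 1"
proof (rule bessel_seqI_finite)
  fix f :: "real ^ 'd \<Rightarrow> complex" and A assume f: "L2fun f" and A: "finite A" "A \<subseteq> I"
  let ?h = "\<lambda>x. \<Sum>j\<in>A. L2ip f (F j) * F j x"
  have h: "L2fun ?h" using A fam_L2 by (intro L2fun_lincomb) auto
  have "L2ip f ?h = (\<Sum>j\<in>A. cnj (L2ip f (F j)) * L2ip f (F j))"
    using A fam_L2 f by (intro L2ip_lincomb_right) auto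
  also have "\<dots> = of_real (\<Sum>j\<in>A. (cmod (L2ip f (F j)))\<^sup>2)"
    unfolding of_real_sum complex_norm_square by (simp add: mult.commute)
  finally have "Re (L2ip f ?h) = (\<Sum>j\<in>A. (cmod (L2ip f (F j)))\<^sup>2)" by simp
  moreover have "0 \<le> (L2nrm (\<lambda>x. f x - ?h x))\<^sup>2" by simp
  ultimately show "(\<Sum>j\<in>A. (cmod (L2ip f (F j)))\<^sup>2) \<le> 1 * (L2nrm f)\<^sup>2"
    unfolding L2nrm_diff_sq[OF f h] nrm_lincomb[OF A] by linarith
qed (rule fam_L2)

end

locale orthonormal_basis = orthonormal_family I F
  for I :: "'i set" and F :: "'i \<Rightarrow> real ^ 'd \<Rightarrow> complex" +
  assumes total: "\<And>f. L2fun f \<Longrightarrow> (\<And>j. j \<in> I \<Longrightarrow> L2ip f (F j) = 0) \<Longrightarrow> L2nrm f = 0"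
begin

text \<open>The series of the expansion converges because the space is complete, and the difference to
  its limit is orthogonal to the whole family.\<close>

lemma expansion:
  assumes f: "L2fun f"
  shows "L2_has_sum (\<lambda>j x. L2ip f (F j) * F j x) I f"
proof -
  from bessel f have "(\<lambda>j. (cmod (L2ip f (F j)))\<^sup>2) summable_on I" by (simp add: bessel_seq_def)
  from bessel_seq_has_sum[OF bessel _ this] obtain s
    where s: "L2_has_sum (\<lambda>j x. L2ip f (F j) * F j x) I s" by auto
  have s2: "L2fun s" using s by (simp add: L2_has_sum_def)
  have "L2ip s (F k) = L2ip f (F k)" if k: "k \<in> I" for k
  proof -
    have "((\<lambda>j. L2ip (\<lambda>x. L2ip f (F j) * F j x) (F k)) has_sum L2ip s (F k)) I"
      using L2_has_sum_ip[OF s] fam_L2 k by auto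
    moreover have "((\<lambda>j. L2ip (\<lambda>x. L2ip f (F j) * F j x) (F k)) has_sum L2ip f (F k)) I"
      by (rule has_sum_finite_neutralI[of "{k}"]) (use k in \<open>simp_all add: L2ip_cmult_left fam_ip\<close>)
    ultimately show ?thesis by (rule has_sum_unique)
  qed
  then have "L2nrm (\<lambda>x. s x - f x) = 0"
    using s2 f fam_L2 by (intro total) (simp_all add: L2fun_diff L2ip_diff_left)
  then have near: "L2nrm (\<lambda>x. (\<Sum>j\<in>A. L2ip f (F j) * F j x) - f x)
      \<le> L2nrm (\<lambda>x. (\<Sum>j\<in>A. L2ip f (F j) * F j x) - s x)" if A: "A \<subseteq> I" for A
  proof -
    have "L2fun (\<lambda>x. \<Sum>j\<in>A. L2ip f (F j) * F j x)"
      using A fam_L2 by (intro L2fun_lincomb) auto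
    from L2nrm_triangle_diff[OF this s2 f] \<open>L2nrm (\<lambda>x. s x - f x) = 0\<close> show ?thesis by linarith
  qed
  have "((\<lambda>A. L2nrm (\<lambda>x. (\<Sum>j\<in>A. L2ip f (F j) * F j x) - f x)) \<longlongrightarrow> 0) (finite_subsets_at_top I)"
    by (rule Lim_null_comparison[where g="\<lambda>A. L2nrm (\<lambda>x. (\<Sum>j\<in>A. L2ip f (F j) * F j x) - s x)"])
       (use s in \<open>auto simp: L2_has_sum_def intro!: eventually_finite_subsets_at_top_weakI intro: near\<close>)
  then show ?thesis using f fam_L2 by (auto simp: L2_has_sum_def intro!: L2fun_cmult)
qed

lemma parseval:
  assumes "L2fun f" "L2fun h"
  shows "((\<lambda>j. L2ip f (F j) * cnj (L2ip h (F j))) has_sum L2ip f h) I"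
  using L2_has_sum_ip[OF expansion[OF assms(1)] assms(2)] by (simp add: L2ip_cmult_left cnj_L2ip)

end

section \<open>Uniqueness of Fourier coefficients\<close>

lemma borel_measurable_lebesgue_continuous:
  fixes f :: "'a::euclidean_space \<Rightarrow> 'b::topological_space"
  shows "continuous_on UNIV f \<Longrightarrow> f \<in> borel_measurable lebesgue"
  by (intro measurable_completion) (simp add: borel_measurable_continuous_onI)

lemma modul_modul: "modul a (modul b f) = modul (a + b) f"
  by (simp add: modul_def fun_eq_iff inner_add_right ring_distribs exp_add)

lemma norm_modul: "cmod (modul a f x) = cmod (f x)"
proof -
  have "2 * of_real pi * \<i> * of_real (x \<bullet> a) = \<i> * of_real (2 * pi * (x \<bullet> a))" by simp
  then show ?thesis unfolding modul_def by (simp only: norm_mult norm_exp_i_times mult_1)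
qed

lemma modul_measurable:
  assumes "f \<in> borel_measurable lebesgue"
  shows "modul a f \<in> borel_measurable lebesgue"
proof -
  have "(\<lambda>x. exp (2 * of_real pi * \<i> * of_real (x \<bullet> a))) \<in> borel_measurable lebesgue"
    by (intro borel_measurable_lebesgue_continuous continuous_intros)
  then show ?thesis unfolding modul_def[abs_def] using assms by (rule borel_measurable_times)
qed

lemma modul_integrable: "integrable lebesgue f \<Longrightarrow> integrable lebesgue (modul a f)"
  by (rule Bochner_Integration.integrable_bound[of lebesgue f])
     (auto simp: norm_modul intro: modul_measurable)

lemma modul_add: "modul a (\<lambda>x. f x + h x) = (\<lambda>x. modul a f x + modul a h x)"
  by (simp add: modul_def fun_eq_iff ring_distribs)

lemma modul_cmult: "modul a (\<lambda>x. c * f x) = (\<lambda>x. c * modul a f x)"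
  by (simp add: modul_def fun_eq_iff)

lemma ivec_add: "ivec (m + n) = ivec m + ivec n"
  by (simp add: ivec_def vec_eq_iff)

lemma ivec_minus: "ivec (- n) = - ivec n"
  by (simp add: ivec_def vec_eq_iff)

text \<open>The frequencies of the functions of period \<open>L\<close> in each coordinate are the vectors
  \<open>(1 / L) *\<^sub>R ivec n\<close>.\<close>

definition coeffs_vanish :: "real \<Rightarrow> (real ^ 'd \<Rightarrow> complex) \<Rightarrow> bool" where
  "coeffs_vanish L w \<longleftrightarrow> integrable lebesgue w \<and>
     (\<forall>n. (LINT x|lebesgue. modul ((1 / L) *\<^sub>R ivec n) w x) = 0)"

lemma coeffs_vanish_modul:
  "coeffs_vanish L w \<Longrightarrow> coeffs_vanish L (modul ((1 / L) *\<^sub>R ivec m) w)"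
  by (simp add: coeffs_vanish_def modul_integrable modul_modul flip: scaleR_add_right ivec_add)

lemma coeffs_vanish_add:
  "coeffs_vanish L v \<Longrightarrow> coeffs_vanish L w \<Longrightarrow> coeffs_vanish L (\<lambda>x. v x + w x)"
  by (simp add: coeffs_vanish_def modul_add modul_integrable)

lemma coeffs_vanish_cmult: "coeffs_vanish L w \<Longrightarrow> coeffs_vanish L (\<lambda>x. c * w x)"
  by (simp add: coeffs_vanish_def modul_cmult)

lemma coeffs_vanish_sum:
  "(\<And>i. i \<in> A \<Longrightarrow> coeffs_vanish L (w i)) \<Longrightarrow> coeffs_vanish L (\<lambda>x. \<Sum>i\<in>A. w i x)"
proof (induction A rule: infinite_finite_induct)
  case (insert a A)
  then show ?case using coeffs_vanish_add[of L "w a" "\<lambda>x. \<Sum>i\<in>A. w i x"] by simp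
qed (simp_all add: coeffs_vanish_def modul_def)

definition torus_map :: "real \<Rightarrow> real ^ 'd \<Rightarrow> complex ^ 'd" where
  "torus_map L x = (\<chi> i. cis (2 * pi * x $ i / L))"

definition torus :: "(complex ^ 'd) set" where
  "torus = {z. \<forall>i. cmod (z $ i) = 1}"

lemma torus_map_in: "torus_map L x \<in> torus"
  by (simp add: torus_map_def torus_def)

lemma continuous_on_torus_map: "continuous_on S (torus_map L)"
  unfolding torus_map_def by (cases "L = 0") (auto intro!: continuous_intros)

lemma compact_torus: "compact (torus :: (complex ^ 'd) set)"
  unfolding compact_eq_bounded_closed
proof
  have "norm z \<le> real CARD('d)" if "z \<in> torus" for z :: "complex ^ 'd"
    using that L2_set_le_sum[of UNIV "\<lambda>i. cmod (z $ i)"] by (simp add: norm_vec_def torus_def)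
  then show "bounded (torus :: (complex ^ 'd) set)"
    unfolding bounded_iff by blast
  show "closed (torus :: (complex ^ 'd) set)"
    unfolding torus_def by (intro closed_Collect_all closed_Collect_eq continuous_intros)
qed

lemma coeffs_vanish_torus_component:
  fixes w :: "real ^ 'd \<Rightarrow> complex"
  assumes "coeffs_vanish L w"
  shows "coeffs_vanish L (\<lambda>x. of_real (Re (torus_map L x $ i)) * w x)"
    and "coeffs_vanish L (\<lambda>x. of_real (Im (torus_map L x $ i)) * w x)"
proof -
  define p where "p = modul ((1 / L) *\<^sub>R ivec (axis i 1)) w"
  define m where "m = modul ((1 / L) *\<^sub>R ivec (- axis i 1)) w"
  have "ivec (axis i 1 :: int ^ 'd) = axis i 1"
    by (simp add: ivec_def vec_eq_iff axis_def)
  then have x: "x \<bullet> ivec (axis i 1) = x $ i" for x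
    by (simp add: inner_axis)
  have pm: "p x = cis (2 * pi * x $ i / L) * w x" "m x = cnj (cis (2 * pi * x $ i / L)) * w x" for x
    by (simp_all add: p_def m_def modul_def ivec_minus x cis_conv_exp exp_cnj mult_ac)
  have v: "coeffs_vanish L p" "coeffs_vanish L m"
    using assms by (simp_all add: p_def m_def coeffs_vanish_modul)
  have "(\<lambda>x. of_real (Re (torus_map L x $ i)) * w x) = (\<lambda>x. (1/2) * (p x + m x))"
    by (simp add: pm torus_map_def fun_eq_iff complex_eq_iff)
  then show "coeffs_vanish L (\<lambda>x. of_real (Re (torus_map L x $ i)) * w x)"
    using v by (simp only: coeffs_vanish_cmult coeffs_vanish_add)
  have "(\<lambda>x. of_real (Im (torus_map L x $ i)) * w x) = (\<lambda>x. (- \<i> / 2) * (p x + (- 1) * m x))"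
    by (simp add: pm torus_map_def fun_eq_iff complex_eq_iff)
  then show "coeffs_vanish L (\<lambda>x. of_real (Im (torus_map L x $ i)) * w x)"
    using v by (simp only: coeffs_vanish_cmult coeffs_vanish_add)
qed

text \<open>Polynomials in the real coordinates of the torus are trigonometric polynomials; the class
  of functions with vanishing coefficients is a module over them. Phrasing this as an invariance
  allows an induction over the polynomial without naming its frequencies.\<close>

lemma coeffs_vanish_polynomial:
  assumes "real_polynomial_function p" "coeffs_vanish L w"
  shows "coeffs_vanish L (\<lambda>x. of_real (p (torus_map L x)) * w x)"
  using assms
proof (induction arbitrary: w)
  case (linear f)
  have f: "f z = (\<Sum>i\<in>UNIV. Re (z $ i) * f (axis i 1) + Im (z $ i) * f (axis i \<i>))" for z
  proof -
    have "z = (\<Sum>i\<in>UNIV. Re (z $ i) *\<^sub>R axis i 1 + Im (z $ i) *\<^sub>R axis i \<i>)"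
    proof (subst vec_eq_iff, intro allI)
      fix k
      have "(\<Sum>i\<in>UNIV. Re (z $ i) *\<^sub>R axis i 1 + Im (z $ i) *\<^sub>R axis i \<i>) $ k
          = (\<Sum>i\<in>UNIV. if i = k then z $ k else 0)"
        unfolding sum_component by (intro sum.cong) (auto simp: axis_def complex_eq_iff)
      then show "z $ k = (\<Sum>i\<in>UNIV. Re (z $ i) *\<^sub>R axis i 1 + Im (z $ i) *\<^sub>R axis i \<i>) $ k"
        by simp
    qed
    then have "f z = f (\<Sum>i\<in>UNIV. Re (z $ i) *\<^sub>R axis i 1 + Im (z $ i) *\<^sub>R axis i \<i>)" by simp
    also have "\<dots> = (\<Sum>i\<in>UNIV. Re (z $ i) * f (axis i 1) + Im (z $ i) * f (axis i \<i>))"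
      using bounded_linear.linear[OF linear(1)]
      by (simp add: linear_sum linear_add linear_scale)
    finally show ?thesis .
  qed
  have "(\<lambda>x. of_real (f (torus_map L x)) * w x) = (\<lambda>x. \<Sum>i\<in>UNIV.
      of_real (f (axis i 1)) * (of_real (Re (torus_map L x $ i)) * w x)
      + of_real (f (axis i \<i>)) * (of_real (Im (torus_map L x $ i)) * w x))"
    by (subst f) (simp add: sum_distrib_right distrib_right mult.assoc mult.left_commute)
  then show ?case
    using linear(2)
    by (simp only:) (intro coeffs_vanish_sum coeffs_vanish_add coeffs_vanish_cmult
        coeffs_vanish_torus_component)
next
  case (const c)
  then show ?case by (rule coeffs_vanish_cmult)
next
  case (add f h)
  then show ?case using coeffs_vanish_add[OF add(3)[OF add(5)] add(4)[OF add(5)]]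
    by (simp add: distrib_right)
next
  case (mult f h)
  then show ?case using mult(3)[OF mult(4)[OF mult(5)]] by (simp add: mult.assoc)
qed

text \<open>Stone-Weierstrass: a continuous function on the torus is a uniform limit of polynomials in the
  real coordinates.\<close>

lemma coeffs_vanish_continuous:
  fixes w :: "real ^ 'd \<Rightarrow> complex"
  assumes w: "coeffs_vanish L w" and f: "continuous_on torus f"
  shows "(LINT x|lebesgue. of_real (f (torus_map L x)) * w x) = 0"
proof -
  have wi [measurable]: "integrable lebesgue w" using w by (simp add: coeffs_vanish_def)
  define J where "J = (LINT x|lebesgue. cmod (w x))"
  have fm: "continuous_on UNIV (\<lambda>x. f (torus_map L x))"
    using torus_map_in by (intro continuous_on_compose2[OF f continuous_on_torus_map]) auto
  have small: "cmod (LINT x|lebesgue. of_real (f (torus_map L x)) * w x) \<le> e * J" if e: "0 < e" for e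
  proof -
    obtain p where p: "real_polynomial_function p" "\<And>z. z \<in> torus \<Longrightarrow> \<bar>f z - p z\<bar> < e"
      using Stone_Weierstrass_real_polynomial_function[OF compact_torus f e] by blast
    have pv: "coeffs_vanish L (\<lambda>x. of_real (p (torus_map L x)) * w x)"
      by (rule coeffs_vanish_polynomial[OF p(1) w])
    have "modul 0 h = h" for h :: "real ^ 'd \<Rightarrow> complex" by (simp add: modul_def fun_eq_iff)
    moreover have "(1 / L) *\<^sub>R ivec 0 = (0 :: real ^ 'd)" by (simp add: ivec_def vec_eq_iff)
    ultimately have p0: "(LINT x|lebesgue. of_real (p (torus_map L x)) * w x) = 0"
      using pv unfolding coeffs_vanish_def by metis
    have pi: "integrable lebesgue (\<lambda>x. of_real (p (torus_map L x)) * w x)"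
      using pv by (simp add: coeffs_vanish_def)
    have le: "cmod (of_real (f (torus_map L x) - p (torus_map L x)) * w x) \<le> e * cmod (w x)" for x
      unfolding norm_mult norm_of_real using p(2)[OF torus_map_in[of L x]] 
      by (intro mult_right_mono) auto
    have di: "integrable lebesgue (\<lambda>x. of_real (f (torus_map L x) - p (torus_map L x)) * w x)"
    proof (rule Bochner_Integration.integrable_bound)
      show "integrable lebesgue (\<lambda>x. e * cmod (w x))" using wi by simp
      have "continuous_on UNIV (\<lambda>x. p (torus_map L x))"
        using continuous_real_polymonial_function[OF p(1)]
        by (intro continuous_on_compose2[OF _ continuous_on_torus_map subset_UNIV])
           (simp add: continuous_on_eq_continuous_at)
      then show "(\<lambda>x. of_real (f (torus_map L x) - p (torus_map L x)) * w x) \<in> borel_measurable lebesgue"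
        using fm by (intro borel_measurable_times borel_measurable_integrable[OF wi]
            borel_measurable_lebesgue_continuous continuous_intros)
    qed (use le e in \<open>auto intro!: always_eventually simp: abs_mult order_trans[OF _ abs_ge_self]\<close>)
    have "(LINT x|lebesgue. of_real (f (torus_map L x)) * w x)
        = (LINT x|lebesgue. of_real (f (torus_map L x) - p (torus_map L x)) * w x
             + of_real (p (torus_map L x)) * w x)"
      by (simp add: ring_distribs)
    also have "\<dots> = (LINT x|lebesgue. of_real (f (torus_map L x) - p (torus_map L x)) * w x)"
      using p0 by (subst Bochner_Integration.integral_add[OF di pi]) simp
    also have "cmod \<dots> \<le> (LINT x|lebesgue. e * cmod (w x))"
      by (rule Bochner_Integration.integral_norm_bound_integral[OF di _ le]) (use wi in simp)
    finally show ?thesis by (simp add: J_def)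
  qed
  have "cmod (LINT x|lebesgue. of_real (f (torus_map L x)) * w x) \<le> 0 + e" if "0 < e" for e
  proof -
    have J: "0 \<le> J" by (simp add: J_def)
    have "cmod (LINT x|lebesgue. of_real (f (torus_map L x)) * w x) \<le> e / (J + 1) * J"
      using that J by (intro small) simp
    also have "\<dots> \<le> e" using that J by (simp add: field_simps)
    finally show ?thesis by simp
  qed
  then have "cmod (LINT x|lebesgue. of_real (f (torus_map L x)) * w x) \<le> 0"
    by (rule field_le_epsilon)
  then show ?thesis by simp
qed

text \<open>The representative of \<open>x\<close> modulo the period in the cube of side \<open>L\<close> around the origin.\<close>

definition wrap :: "real \<Rightarrow> real ^ 'd \<Rightarrow> real ^ 'd" where
  "wrap L x = (\<chi> i. L * Arg (torus_map L x $ i) / (2 * pi))"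

lemma wrap_small:
  assumes "0 < L" "\<And>i. \<bar>x $ i\<bar> < L / 2"
  shows "wrap L x = x" "torus_map L x $ i \<noteq> - 1"
proof -
  have "\<bar>2 * pi * x $ i / L\<bar> < pi" for i
  proof -
    have "\<bar>2 * pi * x $ i / L\<bar> = 2 * pi * \<bar>x $ i\<bar> / L" using assms by (simp add: abs_mult)
    also have "\<dots> < pi" using assms(2)[of i] assms(1) by (simp add: field_simps)
    finally show ?thesis .
  qed
  then have "\<bar>2 * pi * x $ i / L\<bar> < pi \<and> 2 * pi * x $ i / L \<in> {- pi<..pi}" for i
    unfolding abs_less_iff greaterThanAtMost_iff by (smt (verit, best))
  then have a: "\<bar>2 * pi * x $ i / L\<bar> < pi" "Arg (torus_map L x $ i) = 2 * pi * x $ i / L" for i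
    by (auto simp: torus_map_def intro: Arg_cis)
  then show "wrap L x = x" using assms(1) by (simp add: wrap_def vec_eq_iff)
  have "Arg (torus_map L x $ i) \<noteq> pi"
    using a[of i] by (metis abs_of_pos less_irrefl pi_gt_zero)
  then show "torus_map L x $ i \<noteq> - 1" using Arg_cis[of pi] by auto
qed

text \<open>A continuous function on the cube of side \<open>L\<close> need not have a continuous periodic
  extension, since the values on opposite faces may differ. The factors
  \<open>min 1 (n * cmod (z $ i + 1))\<close> force the value \<open>0\<close> on the faces and tend to \<open>1\<close> elsewhere.\<close>

lemma coeffs_vanish_wrap:
  fixes w :: "real ^ 'd \<Rightarrow> complex" and \<phi> :: "real ^ 'd \<Rightarrow> real"
  assumes w: "coeffs_vanish L w" and \<phi>: "continuous_on UNIV \<phi>" and B: "\<And>x. \<bar>\<phi> x\<bar> \<le> B"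
  defines "f x \<equiv> (if \<forall>i. torus_map L x $ i \<noteq> - 1 then of_real (\<phi> (wrap L x)) else 0) * w x"
  shows "f \<in> borel_measurable lebesgue" "(LINT x|lebesgue. f x) = 0"
proof -
  have wi [measurable]: "integrable lebesgue w" using w by (simp add: coeffs_vanish_def)
  have B0: "0 \<le> B" using B[of 0] by linarith
  define a :: "complex ^ 'd \<Rightarrow> real ^ 'd" where "a z = (\<chi> i. L * Arg (z $ i) / (2 * pi))" for z
  define cut :: "nat \<Rightarrow> complex ^ 'd \<Rightarrow> real"
    where "cut n z = (\<Prod>i\<in>UNIV. min 1 (real n * cmod (z $ i + 1)))" for n z
  have cut0: "0 \<le> cut n z" "cut n z \<le> 1" for n z
    by (auto simp: cut_def intro!: prod_nonneg prod_le_1)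
  have cut_le: "cut n z \<le> real n * cmod (z $ i + 1)" for n z i
  proof -
    have "cut n z = min 1 (real n * cmod (z $ i + 1)) * (\<Prod>i\<in>UNIV - {i}. min 1 (real n * cmod (z $ i + 1)))"
      unfolding cut_def by (rule prod.remove) auto
    also have "\<dots> \<le> min 1 (real n * cmod (z $ i + 1)) * 1"
      by (intro mult_left_mono prod_le_1) auto
    finally show ?thesis by simp
  qed
  have cont: "continuous_on torus (\<lambda>z. \<phi> (a z) * cut n z)" for n
    unfolding continuous_on_eq_continuous_within
  proof
    fix z :: "complex ^ 'd" assume z: "z \<in> torus"
    show "continuous (at z within torus) (\<lambda>z. \<phi> (a z) * cut n z)"
    proof (cases "\<forall>i. z $ i \<noteq> - 1")
      case True
      have "z $ i \<notin> \<real>\<^sub>\<le>\<^sub>0" for i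
      proof
        assume "z $ i \<in> \<real>\<^sub>\<le>\<^sub>0"
        then obtain r where r: "z $ i = of_real r" "r \<le> 0" by (auto elim!: nonpos_Reals_cases)
        moreover have "cmod (z $ i) = 1" using z by (simp add: torus_def)
        ultimately show False using True by auto
      qed
      then have "isCont a z"
        unfolding a_def
        unfolding isCont_def
        by (intro tendsto_vec_lambda tendsto_intros isCont_tendsto_compose[OF continuous_at_Arg]) auto
      moreover have "isCont \<phi> (a z)" using \<phi> by (simp add: continuous_on_eq_continuous_at)
      ultimately have "isCont (\<lambda>z. \<phi> (a z)) z" by (rule isCont_o2)
      moreover have "isCont (cut n) z"
        unfolding cut_def isCont_def by (intro tendsto_prod tendsto_min tendsto_intros)
      ultimately have "isCont (\<lambda>z. \<phi> (a z) * cut n z) z" by (rule continuous_mult)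
      then show ?thesis by (rule continuous_at_imp_continuous_at_within)
    next
      case False
      then obtain i where i: "z $ i = - 1" by auto
      have "((\<lambda>z. \<phi> (a z) * cut n z) \<longlongrightarrow> 0) (at z within torus)"
      proof (rule Lim_null_comparison)
        have "((\<lambda>y. B * (real n * cmod (y $ i + 1))) \<longlongrightarrow> B * (real n * cmod (z $ i + 1))) (at z within torus)"
          by (intro tendsto_intros)
        then show "((\<lambda>y. B * (real n * cmod (y $ i + 1))) \<longlongrightarrow> 0) (at z within torus)" by (simp add: i)
        show "\<forall>\<^sub>F y in at z within torus. norm (\<phi> (a y) * cut n y) \<le> B * (real n * cmod (y $ i + 1))"
          by (intro always_eventually allI)
             (auto simp: abs_mult cut0 intro!: mult_mono B B0 cut_le)
      qed
      moreover have "cut n z = 0" using cut_le[of n z i] cut0[of n z] i by simp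
      ultimately show ?thesis by (simp add: continuous_within)
    qed
  qed
  have lim: "(\<lambda>n. \<phi> (a (torus_map L x)) * cut n (torus_map L x))
      \<longlonglongrightarrow> (if \<forall>i. torus_map L x $ i \<noteq> - 1 then \<phi> (wrap L x) else 0)" for x
  proof (cases "\<forall>i. torus_map L x $ i \<noteq> - 1")
    case True
    have "(\<lambda>n. cut n (torus_map L x)) \<longlonglongrightarrow> (\<Prod>i\<in>(UNIV::'d set). 1)"
      unfolding cut_def
    proof (intro tendsto_prod)
      fix i
      define r where "r = cmod (torus_map L x $ i + 1)"
      have "r > 0" using True eq_neg_iff_add_eq_0[of "torus_map L x $ i" 1] by (simp add: r_def)
      have "\<forall>\<^sub>F n in sequentially. min 1 (real n * r) = 1"
        using eventually_ge_at_top[of "nat \<lceil>1 / r\<rceil>"]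
      proof eventually_elim
        case (elim n)
        then have "1 / r \<le> real n" using real_nat_ceiling_ge[of "1 / r"] by linarith
        then show ?case using \<open>r > 0\<close> by (simp add: field_simps)
      qed
      then show "(\<lambda>n. min 1 (real n * cmod (torus_map L x $ i + 1))) \<longlonglongrightarrow> 1"
        unfolding r_def by (rule tendsto_eventually)
    qed
    then have "(\<lambda>n. \<phi> (a (torus_map L x)) * cut n (torus_map L x)) \<longlonglongrightarrow> \<phi> (a (torus_map L x)) * 1"
      by (intro tendsto_mult_left) simp
    then show ?thesis using True by (simp add: a_def wrap_def)
  next
    case False
    then obtain i where "torus_map L x $ i = - 1" by auto
    then have "cut n (torus_map L x) = 0" for n
      using cut_le[of n "torus_map L x" i] cut0[of n "torus_map L x"] by simp
    then show ?thesis using False by auto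
  qed
  have meas: "(\<lambda>x. of_real (\<phi> (a (torus_map L x)) * cut n (torus_map L x)) * w x) \<in> borel_measurable lebesgue" for n
  proof (intro borel_measurable_times borel_measurable_integrable[OF wi])
    have "continuous_on UNIV (\<lambda>x. \<phi> (a (torus_map L x)) * cut n (torus_map L x))"
      using torus_map_in
      by (intro continuous_on_compose2[OF cont continuous_on_torus_map]) auto
    then show "(\<lambda>x. complex_of_real (\<phi> (a (torus_map L x)) * cut n (torus_map L x))) \<in> borel_measurable lebesgue"
      by (intro borel_measurable_lebesgue_continuous continuous_on_of_real)
  qed
  have lim': "(\<lambda>n. of_real (\<phi> (a (torus_map L x)) * cut n (torus_map L x)) * w x) \<longlonglongrightarrow> f x" for x
    using tendsto_mult_right[OF tendsto_of_real[OF lim[of x]], of "w x"]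
    by (simp add: f_def if_distrib[of of_real] cong: if_cong)
  show fm: "f \<in> borel_measurable lebesgue"
    using lim' meas by (rule borel_measurable_LIMSEQ_metric[rotated])
  have "(\<lambda>n. LINT x|lebesgue. of_real (\<phi> (a (torus_map L x)) * cut n (torus_map L x)) * w x)
    \<longlonglongrightarrow> (LINT x|lebesgue. f x)"
  proof (rule integral_dominated_convergence[where w="\<lambda>x. B * cmod (w x)"])
    show "AE x in lebesgue. (\<lambda>n. of_real (\<phi> (a (torus_map L x)) * cut n (torus_map L x)) * w x) \<longlonglongrightarrow> f x"
      using lim' by simp
    have "\<bar>\<phi> y\<bar> * cut n z \<le> B * 1" for n y z
      by (intro mult_mono B cut0 B0)
    then show "AE x in lebesgue. norm (of_real (\<phi> (a (torus_map L x)) * cut n (torus_map L x)) * w x) \<le> B * cmod (w x)" for n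
      by (intro always_eventually allI)
         (simp only: norm_mult norm_of_real abs_mult abs_of_nonneg[OF cut0(1)], intro mult_right_mono, auto)
    show "integrable lebesgue (\<lambda>x. B * cmod (w x))" using wi by simp
  qed (rule fm meas)+
  moreover have "(LINT x|lebesgue. of_real (\<phi> (a (torus_map L x)) * cut n (torus_map L x)) * w x) = 0" for n
    by (rule coeffs_vanish_continuous[OF w cont])
  ultimately show "(LINT x|lebesgue. f x) = 0" by (simp add: LIMSEQ_const_iff)
qed

text \<open>Clamped continuous approximants of the sign of \<open>Re w\<close> serve as test functions.\<close>

lemma AE_zero_if_integrals_vanish_Re:
  fixes w :: "real ^ 'd \<Rightarrow> complex"
  assumes wi: "integrable lebesgue w"
    and test: "\<And>\<phi> :: real ^ 'd \<Rightarrow> real. continuous_on UNIV \<phi> \<Longrightarrow> (\<And>x. \<bar>\<phi> x\<bar> \<le> 1) \<Longrightarrow>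
      (LINT x|lebesgue. of_real (\<phi> x) * w x) = 0"
  shows "AE x in lebesgue. Re (w x) = 0"
proof -
  have wm [measurable]: "w \<in> borel_measurable lebesgue" using wi by auto
  define s :: "real ^ 'd \<Rightarrow> real" where "s x = sgn (Re (w x))" for x
  have sm [measurable]: "s \<in> borel_measurable lebesgue" unfolding s_def by measurable
  then have "s measurable_on UNIV"
    using measurable_on_iff_borel_measurable[of UNIV s] by (simp add: lebesgue_on_UNIV_eq)
  then obtain N g where N: "negligible N" and g: "\<And>n::nat. continuous_on UNIV (g n)"
      and lim: "\<And>x. x \<notin> N \<Longrightarrow> (\<lambda>n. g n x) \<longlonglongrightarrow> s x"
    by (auto simp: measurable_on_def)
  define c where "c n x = max (- 1) (min 1 (g n x))" for n x
  have cc: "continuous_on UNIV (c n)" for n 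
    unfolding c_def by (intro continuous_on_max continuous_on_min continuous_on_const g)
  have c1: "\<bar>c n x\<bar> \<le> 1" for n x by (auto simp: c_def)
  have climit: "(\<lambda>n. c n x) \<longlonglongrightarrow> s x" if "x \<notin> N" for x
  proof -
    have "(\<lambda>n. c n x) \<longlonglongrightarrow> max (- 1) (min 1 (s x))"
      unfolding c_def by (intro tendsto_max tendsto_min tendsto_const lim that)
    then show ?thesis by (auto simp: s_def sgn_if split: if_splits)
  qed
  have "(\<lambda>n. LINT x|lebesgue. of_real (c n x) * w x) \<longlonglongrightarrow> (LINT x|lebesgue. of_real (s x) * w x)"
  proof (rule integral_dominated_convergence[where w="\<lambda>x. cmod (w x)"])
    show "(\<lambda>x. of_real (c n x) * w x) \<in> borel_measurable lebesgue" for n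
      by (intro borel_measurable_times[OF _ wm] borel_measurable_lebesgue_continuous
          continuous_on_of_real cc)
    have "AE x in lebesgue. x \<notin> N"
      using N by (auto simp: negligible_iff_null_sets intro: AE_not_in)
    then show "AE x in lebesgue. (\<lambda>n. of_real (c n x) * w x) \<longlonglongrightarrow> of_real (s x) * w x"
      by eventually_elim (intro tendsto_mult tendsto_of_real tendsto_const climit)
    show "AE x in lebesgue. norm (of_real (c n x) * w x) \<le> cmod (w x)" for n
      using c1 by (auto simp: norm_mult intro!: always_eventually mult_left_le_one_le)
  qed (use wi in auto)
  then have "(LINT x|lebesgue. of_real (s x) * w x) = 0"
    using test[OF cc c1] by (simp add: LIMSEQ_const_iff)
  moreover have si: "integrable lebesgue (\<lambda>x. of_real (s x) * w x)"
    by (rule Bochner_Integration.integrable_bound[OF wi])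
       (auto simp: norm_mult s_def sgn_if)
  ultimately have "(LINT x|lebesgue. Re (of_real (s x) * w x)) = 0"
    by (simp only: integral_Re[OF si] zero_complex.sel)
  moreover have "Re (of_real (s x) * w x) = \<bar>Re (w x)\<bar>" for x
    by (simp add: s_def abs_sgn mult.commute)
  ultimately have "(LINT x|lebesgue. \<bar>Re (w x)\<bar>) = 0" by simp
  then show ?thesis
    using integral_nonneg_eq_0_iff_AE[of lebesgue "\<lambda>x. \<bar>Re (w x)\<bar>"] wi by simp
qed

lemma AE_zero_if_integrals_vanish:
  fixes w :: "real ^ 'd \<Rightarrow> complex"
  assumes wi: "integrable lebesgue w"
    and test: "\<And>\<phi> :: real ^ 'd \<Rightarrow> real. continuous_on UNIV \<phi> \<Longrightarrow> (\<And>x. \<bar>\<phi> x\<bar> \<le> 1) \<Longrightarrow>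
      (LINT x|lebesgue. of_real (\<phi> x) * w x) = 0"
  shows "AE x in lebesgue. w x = 0"
proof -
  have "AE x in lebesgue. Re (w x) = 0"
    by (rule AE_zero_if_integrals_vanish_Re[OF wi test])
  moreover have "AE x in lebesgue. Re (- \<i> * w x) = 0"
  proof (rule AE_zero_if_integrals_vanish_Re)
    fix \<phi> :: "real ^ 'd \<Rightarrow> real" assume "continuous_on UNIV \<phi>" "\<And>x. \<bar>\<phi> x\<bar> \<le> 1"
    then have "- \<i> * (LINT x|lebesgue. of_real (\<phi> x) * w x) = 0" by (simp add: test)
    then show "(LINT x|lebesgue. of_real (\<phi> x) * (- \<i> * w x)) = 0"
      by (simp only: integral_mult_right_zero[symmetric] mult.left_commute)
  qed (use wi in simp)
  ultimately show ?thesis by eventually_elim (simp add: complex_eq_iff)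
qed

lemma Fourier_coefficients_unique_cube:
  fixes w :: "real ^ 'd \<Rightarrow> complex"
  assumes wi: "integrable lebesgue w"
    and supp: "\<And>x. w x \<noteq> 0 \<Longrightarrow> \<forall>i. \<bar>x $ i\<bar> < 1 / 2"
    and coeffs: "\<And>n. (LINT x|lebesgue. modul (ivec n) w x) = 0"
  shows "AE x in lebesgue. w x = 0"
proof (rule AE_zero_if_integrals_vanish[OF wi])
  fix \<phi> :: "real ^ 'd \<Rightarrow> real" assume \<phi>: "continuous_on UNIV \<phi>" "\<And>x. \<bar>\<phi> x\<bar> \<le> 1"
  have "(LINT x|lebesgue. (if \<forall>i. torus_map 1 x $ i \<noteq> - 1 then of_real (\<phi> (wrap 1 x)) else 0) * w x) = 0"
    using wi coeffs by (intro coeffs_vanish_wrap[where B=1] \<phi>) (simp add: coeffs_vanish_def)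
  also have "(\<lambda>x. (if \<forall>i. torus_map 1 x $ i \<noteq> - 1 then of_real (\<phi> (wrap 1 x)) else 0) * w x)
      = (\<lambda>x. of_real (\<phi> x) * w x)"
  proof
    fix x show "(if \<forall>i. torus_map 1 x $ i \<noteq> - 1 then of_real (\<phi> (wrap 1 x)) else 0) * w x
        = of_real (\<phi> x) * w x"
    proof (cases "w x = 0")
      case False
      from supp[OF this] show ?thesis using wrap_small[of 1 x] by simp
    qed simp
  qed
  finally show "(LINT x|lebesgue. of_real (\<phi> x) * w x) = 0" .
qed

text \<open>A test function agrees on every compact set with its periodization of large period.\<close>

lemma Fourier_transform_unique:
  fixes w :: "real ^ 'd \<Rightarrow> complex"
  assumes wi: "integrable lebesgue w" and zero: "\<And>y. (LINT x|lebesgue. modul y w x) = 0"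
  shows "AE x in lebesgue. w x = 0"
proof (rule AE_zero_if_integrals_vanish[OF wi])
  have wm [measurable]: "w \<in> borel_measurable lebesgue" using wi by auto
  fix \<phi> :: "real ^ 'd \<Rightarrow> real" assume \<phi>: "continuous_on UNIV \<phi>" "\<And>x. \<bar>\<phi> x\<bar> \<le> 1"
  define f where "f L x = (if \<forall>i. torus_map L x $ i \<noteq> - 1 then of_real (\<phi> (wrap L x)) else 0) * w x" for L x
  have f0: "(LINT x|lebesgue. f L x) = 0" for L
    unfolding f_def
    using wi zero by (intro coeffs_vanish_wrap[where B=1] \<phi>) (simp add: coeffs_vanish_def)
  have "(\<lambda>n. LINT x|lebesgue. f (real (Suc n)) x) \<longlonglongrightarrow> (LINT x|lebesgue. of_real (\<phi> x) * w x)"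
  proof (rule integral_dominated_convergence[where w="\<lambda>x. cmod (w x)"])
    show "(\<lambda>x. of_real (\<phi> x) * w x) \<in> borel_measurable lebesgue"
      by (intro borel_measurable_times[OF _ wm] borel_measurable_lebesgue_continuous
          continuous_on_of_real \<phi>)
    show "f (real (Suc n)) \<in> borel_measurable lebesgue" for n
      unfolding f_def
      using wi zero by (intro coeffs_vanish_wrap[where B=1] \<phi>) (simp add: coeffs_vanish_def)
    show "AE x in lebesgue. (\<lambda>n. f (real (Suc n)) x) \<longlonglongrightarrow> of_real (\<phi> x) * w x"
    proof (rule AE_I2, rule tendsto_eventually)
      fix x :: "real ^ 'd"
      show "\<forall>\<^sub>F n in sequentially. f (real (Suc n)) x = of_real (\<phi> x) * w x"
        using eventually_ge_at_top[of "nat \<lceil>2 * norm x\<rceil>"]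
      proof eventually_elim
        case (elim n)
        have "\<bar>x $ i\<bar> < real (Suc n) / 2" for i
          proof -
          have "2 * \<bar>x $ i\<bar> \<le> 2 * norm x" by (simp add: component_le_norm_cart)
          also have "\<dots> \<le> real (nat \<lceil>2 * norm x\<rceil>)" by (rule real_nat_ceiling_ge)
          also have "\<dots> < real (Suc n)"
            using elim unfolding of_nat_less_iff by (rule le_imp_less_Suc)
          finally show ?thesis by simp
        qed
        then show ?case using wrap_small[of "real (Suc n)" x] by (simp add: f_def)
      qed
    qed
    show "AE x in lebesgue. norm (f (real (Suc n)) x) \<le> cmod (w x)" for n
      using \<phi>(2) by (auto simp: f_def norm_mult intro!: always_eventually mult_left_le_one_le)
  qed (use wi in auto)
  then show "(LINT x|lebesgue. of_real (\<phi> x) * w x) = 0"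
    by (simp add: f0 LIMSEQ_const_iff)
qed

section \<open>Translations, modulations and reflection\<close>

lemma lebesgue_distr_plus: "distr lebesgue lebesgue (\<lambda>x. t + x) = (lebesgue :: 'a::euclidean_space measure)"
    and lebesgue_measurable_plus: "(\<lambda>x. t + x) \<in> (lebesgue :: 'a measure) \<rightarrow>\<^sub>M lebesgue"
  using lebesgue_affine_euclidean[of "\<lambda>_. 1" t] lebesgue_affine_measurable[of "\<lambda>_. 1" t]
  by (simp_all add: euclidean_representation density_1 flip: one_ennreal_def)

lemma lebesgue_distr_uminus: "distr lebesgue lebesgue uminus = (lebesgue :: 'a::euclidean_space measure)"
    and lebesgue_measurable_uminus: "uminus \<in> (lebesgue :: 'a measure) \<rightarrow>\<^sub>M lebesgue"
  using lebesgue_affine_euclidean[of "\<lambda>_. -1" "0::'a"] lebesgue_affine_measurable[of "\<lambda>_. -1" "0::'a"]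
  by (simp_all add: euclidean_representation density_1 sum_negf flip: one_ennreal_def)

lemma measurable_transl: "f \<in> borel_measurable lebesgue \<Longrightarrow> transl l f \<in> borel_measurable lebesgue"
  using measurable_compose[OF lebesgue_measurable_plus[of "- l"]] by (simp add: transl_def[abs_def])

lemma integrable_transl:
  fixes f :: "real ^ 'd \<Rightarrow> 'b::{banach, second_countable_topology}"
  assumes "integrable lebesgue f"
  shows "integrable lebesgue (\<lambda>x. f (x - l))"
proof -
  have f: "f \<in> borel_measurable lebesgue" using assms by auto
  show ?thesis
    using integrable_distr_eq[OF lebesgue_measurable_plus[of "- l"] f, unfolded lebesgue_distr_plus] assms
    by simp
qed

lemma integral_transl:
  fixes f :: "real ^ 'd \<Rightarrow> 'b::{banach, second_countable_topology}"
  assumes "f \<in> borel_measurable lebesgue"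
  shows "(LINT x|lebesgue. f (x - l)) = (LINT x|lebesgue. f x)"
  using integral_distr[OF lebesgue_measurable_plus[of "- l"] assms, unfolded lebesgue_distr_plus]
  by simp

lemma integrable_reflect:
  fixes f :: "real ^ 'd \<Rightarrow> 'b::{banach, second_countable_topology}"
  assumes "integrable lebesgue f"
  shows "integrable lebesgue (\<lambda>x. f (- x))"
proof -
  have f: "f \<in> borel_measurable lebesgue" using assms by auto
  show ?thesis
    using integrable_distr_eq[OF lebesgue_measurable_uminus f] assms
    by (simp add: lebesgue_distr_uminus)
qed

lemma integral_reflect:
  fixes f :: "real ^ 'd \<Rightarrow> 'b::{banach, second_countable_topology}"
  assumes "f \<in> borel_measurable lebesgue"
  shows "(LINT x|lebesgue. f (- x)) = (LINT x|lebesgue. f x)"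
  using integral_distr[OF lebesgue_measurable_uminus assms]
  by (simp add: lebesgue_distr_uminus)

lemma L2fun_transl: "L2fun f \<Longrightarrow> L2fun (transl l f)"
  using integrable_transl[OF L2fun_integrable_sq, of f l]
  by (simp add: L2fun_def measurable_transl) (simp add: transl_def)

lemma L2fun_modul: "L2fun f \<Longrightarrow> L2fun (modul a f)"
  by (simp add: L2fun_def norm_modul modul_measurable)

lemma L2ip_transl:
  assumes "L2fun f" "L2fun h"
  shows "L2ip (transl l f) (transl l h) = L2ip f h"
proof -
  have "(\<lambda>x. f x * cnj (h x)) \<in> borel_measurable lebesgue"
    using L2fun_integrable_ip[OF assms] by auto
  from integral_transl[OF this, of l] show ?thesis by (simp add: L2ip_def transl_def)
qed

lemma exp_2pi_cnj: "cnj (exp (2 * of_real pi * \<i> * of_real t)) = exp (2 * of_real pi * \<i> * of_real (- t))"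
  by (simp add: exp_cnj)

lemma exp_2pi_mult_cnj: "exp (2 * of_real pi * \<i> * of_real t) * cnj (exp (2 * of_real pi * \<i> * of_real t)) = 1"
  by (simp add: exp_cnj flip: exp_add)

lemma L2ip_modul: "L2ip (modul a f) (modul a h) = L2ip f h"
proof -
  have "modul a f x * cnj (modul a h x) = f x * cnj (h x)" for x
  proof -
    define E where "E = exp (2 * of_real pi * \<i> * of_real (x \<bullet> a))"
    have "modul a f x * cnj (modul a h x) = (E * cnj E) * (f x * cnj (h x))"
      unfolding modul_def E_def[symmetric] complex_cnj_mult by (simp only: mult_ac)
    then show ?thesis unfolding E_def exp_2pi_mult_cnj by simp
  qed
  then show ?thesis by (simp add: L2ip_def)
qed

definition reflect :: "(real ^ 'd \<Rightarrow> complex) \<Rightarrow> real ^ 'd \<Rightarrow> complex" where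
  "reflect f x = cnj (f (- x))"

lemma L2fun_reflect:
  assumes "L2fun f"
  shows "L2fun (reflect f)"
proof -
  have "(\<lambda>x. f (- x)) \<in> borel_measurable lebesgue"
    using measurable_compose[OF lebesgue_measurable_uminus L2fun_meas[OF assms]] .
  then have "L2fun (\<lambda>x. f (- x))"
    using integrable_reflect[OF L2fun_integrable_sq[OF assms]] by (simp add: L2fun_def)
  from L2fun_cnj[OF this] show ?thesis by (simp add: reflect_def[abs_def])
qed

lemma L2ip_reflect:
  assumes "L2fun f" "L2fun h"
  shows "L2ip (reflect f) (reflect h) = L2ip h f"
proof -
  have "(\<lambda>x. h x * cnj (f x)) \<in> borel_measurable lebesgue"
    using L2fun_integrable_ip[OF assms(2,1)] by auto
  from integral_reflect[OF this] show ?thesis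
    by (simp add: L2ip_def reflect_def mult.commute)
qed

subsection \<open>The lattice of time-frequency shifts\<close>

text \<open>Integer translations commute with integer modulations, so these shifts form a unitary
  representation of an abelian group.\<close>

definition tf_shift :: "(int ^ 'd) \<times> (int ^ 'd) \<Rightarrow> (real ^ 'd \<Rightarrow> complex) \<Rightarrow> real ^ 'd \<Rightarrow> complex" where
  "tf_shift k f = transl (ivec (fst k)) (modul (ivec (snd k)) f)"

definition half_shift :: "(real ^ 'd \<Rightarrow> complex) \<Rightarrow> real ^ 'd \<Rightarrow> complex" where
  "half_shift f = transl half f"

definition flip :: "(int ^ 'd) \<times> (int ^ 'd) \<Rightarrow> (int ^ 'd) \<times> (int ^ 'd)" where
  "flip k = (fst k, - snd k)"

definition sgn_of :: "(int ^ 'd) \<times> (int ^ 'd) \<Rightarrow> complex" where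
  "sgn_of k = sgn_vec (snd k)"

lemma flip_flip [simp]: "flip (flip k) = k"
  and flip_diff: "flip (k - l) = flip k - flip l"
  by (simp_all add: flip_def prod_eq_iff)

lemma exp_2pi_int: "exp (2 * of_real pi * \<i> * of_real (of_int m)) = 1"
  using exp_integer_2pi[of "of_int m"] by (simp add: mult_ac)

lemma ivec_inner: "ivec m \<bullet> ivec n = of_int (\<Sum>i\<in>UNIV. m $ i * n $ i)"
  by (simp add: ivec_def inner_vec_def)

lemma half_inner: "half \<bullet> ivec n = of_int (\<Sum>i\<in>UNIV. n $ i) / 2"
  by (simp add: half_def ivec_def inner_vec_def sum_divide_distrib)

lemma exp_2pi_half: "exp (2 * of_real pi * \<i> * of_real (half \<bullet> ivec n)) = sgn_vec n"
proof -
  have *: "exp (2 * of_real pi * \<i> * of_real (of_int s / 2)) = exp (\<i> * of_real pi) powi s" for s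
    unfolding exp_power_int by (simp add: mult_ac)
  show ?thesis unfolding half_inner sgn_vec_def * by (simp only: exp_pi_i')
qed

lemma sgn_vec_minus: "sgn_vec (- n) = sgn_vec n"
  by (simp add: sgn_vec_def sum_negf power_int_minus flip: power_int_inverse)

lemma sgn_of_flip [simp]: "sgn_of (flip k) = sgn_of k"
  by (simp add: sgn_of_def flip_def sgn_vec_minus)

lemma sgn_of_add: "sgn_of (k + l) = sgn_of k * sgn_of l"
  by (simp add: sgn_of_def sgn_vec_def sum.distrib power_int_add)

lemma sgn_of_cases: "sgn_of k = 1 \<or> sgn_of k = - 1"
  by (simp add: sgn_of_def sgn_vec_def power_int_minus_left)

lemma sgn_of_sq [simp]: "sgn_of k * sgn_of k = 1" and cnj_sgn_of [simp]: "cnj (sgn_of k) = sgn_of k"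
  using sgn_of_cases[of k] by auto

lemma sgn_of_sq' [simp]: "sgn_of k * (sgn_of k * z) = z"
  by (simp flip: mult.assoc)

lemma sgn_of_minus [simp]: "sgn_of (- k) = sgn_of k"
  by (simp add: sgn_of_def sgn_vec_minus)

lemma sgn_of_diff: "sgn_of (k - l) = sgn_of k * sgn_of l"
  using sgn_of_add[of k "- l"] by simp

lemma norm_sgn_of [simp]: "cmod (sgn_of k) = 1"
  using sgn_of_cases[of k] by auto

lemma L2fun_tf_shift: "L2fun f \<Longrightarrow> L2fun (tf_shift k f)"
  by (simp add: tf_shift_def L2fun_transl L2fun_modul)

lemma L2fun_half_shift: "L2fun f \<Longrightarrow> L2fun (half_shift f)"
  by (simp add: half_shift_def L2fun_transl)

lemma modul_transl_ivec: "modul (ivec n) (transl (ivec m) f) = transl (ivec m) (modul (ivec n) f)"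
proof
  fix x
  define y where "y = x - ivec m"
  define c where "c = 2 * of_real pi * \<i>"
  have "x \<bullet> ivec n = y \<bullet> ivec n + of_int (\<Sum>i\<in>UNIV. m $ i * n $ i)"
    unfolding ivec_inner[symmetric] y_def by (simp add: inner_diff_left)
  then have "exp (c * of_real (x \<bullet> ivec n))
      = exp (c * of_real (y \<bullet> ivec n)) * exp (c * of_real (of_int (\<Sum>i\<in>UNIV. m $ i * n $ i)))"
    by (simp only: of_real_add distrib_left exp_add)
  also have "exp (c * of_real (of_int (\<Sum>i\<in>UNIV. m $ i * n $ i))) = 1"
    unfolding c_def by (rule exp_2pi_int)
  finally show "modul (ivec n) (transl (ivec m) f) x = transl (ivec m) (modul (ivec n) f) x"
    unfolding modul_def transl_def c_def[symmetric] y_def[symmetric] by simp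
qed

lemma transl_transl: "transl a (transl b f) = transl (a + b) f"
  by (simp add: transl_def fun_eq_iff algebra_simps)

lemma tf_shift_add: "tf_shift k (tf_shift l f) = tf_shift (k + l) f"
  by (simp add: tf_shift_def modul_transl_ivec transl_transl modul_modul ivec_add)

lemma ivec_zero: "ivec 0 = 0"
  by (simp add: ivec_def vec_eq_iff)

lemma transl_zero: "transl 0 f = f" and modul_zero: "modul 0 f = f"
  by (simp_all add: transl_def modul_def fun_eq_iff)

lemma tf_shift_zero [simp]: "tf_shift 0 f = f"
  by (simp add: tf_shift_def ivec_zero transl_zero modul_zero)

lemma half_shift_tf: "half_shift (tf_shift k f) = (\<lambda>x. sgn_of k * tf_shift k (half_shift f) x)"
proof
  fix x
  define y where "y = x - ivec (fst k)"
  have e: "x - half - ivec (fst k) = y - half" by (simp add: y_def)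
  have "exp (2 * of_real pi * \<i> * of_real ((y - half) \<bullet> ivec (snd k)))
      = exp (2 * of_real pi * \<i> * of_real (y \<bullet> ivec (snd k))) / sgn_vec (snd k)"
    by (simp only: inner_diff_left of_real_diff right_diff_distrib exp_diff exp_2pi_half)
  also have "\<dots> = sgn_vec (snd k) * exp (2 * of_real pi * \<i> * of_real (y \<bullet> ivec (snd k)))"
    using sgn_of_cases[of k] by (auto simp: sgn_of_def)
  finally show "half_shift (tf_shift k f) x = sgn_of k * tf_shift k (half_shift f) x"
    unfolding half_shift_def tf_shift_def transl_def modul_def sgn_of_def e y_def[symmetric]
    by (simp only: mult.assoc)
qed

text \<open>Two half shifts make one integer shift, by the vector of ones.\<close>

definition one_shift :: "(int ^ 'd) \<times> (int ^ 'd)" where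
  "one_shift = ((\<chi> i. 1), 0)"

lemma flip_one_shift [simp]: "flip one_shift = one_shift"
  and sgn_of_one_shift [simp]: "sgn_of one_shift = 1"
  by (simp_all add: flip_def one_shift_def sgn_of_def sgn_vec_def)

lemma half_shift_half_shift:
  fixes f :: "real ^ 'd \<Rightarrow> complex"
  shows "half_shift (half_shift f) = tf_shift one_shift f"
proof -
  have "half + half = (ivec (fst one_shift) :: real ^ 'd)"
    by (simp only: half_def ivec_def one_shift_def fst_conv vec_eq_iff vector_add_component
        vec_lambda_beta) simp
  then show ?thesis
    by (simp only: half_shift_def tf_shift_def transl_transl)
       (simp only: one_shift_def snd_conv ivec_zero modul_zero)
qed

lemma L2ip_tf_shift:
  assumes "L2fun f" "L2fun h"
  shows "L2ip (tf_shift k f) (tf_shift k h) = L2ip f h"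
  using assms by (simp add: tf_shift_def L2ip_transl L2fun_modul L2ip_modul)

lemma L2ip_tf_shift_diff:
  assumes "L2fun f" "L2fun h"
  shows "L2ip (tf_shift k f) (tf_shift l h) = L2ip (tf_shift (k - l) f) h"
  using L2ip_tf_shift[of "tf_shift (k - l) f" h l] assms
  by (simp add: tf_shift_add L2fun_tf_shift)

lemma L2ip_half_shift:
  "L2fun f \<Longrightarrow> L2fun h \<Longrightarrow> L2ip (half_shift f) (half_shift h) = L2ip f h"
  by (simp add: half_shift_def L2ip_transl)

lemma reflect_tf_shift: "reflect (tf_shift k f) = tf_shift (- flip k) (reflect f)"
proof
  fix x
  have "(- x - ivec (fst k)) \<bullet> ivec (snd k) = - ((x + ivec (fst k)) \<bullet> ivec (snd k))"
    by (simp add: inner_diff_left inner_add_left)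
  then show "reflect (tf_shift k f) x = tf_shift (- flip k) (reflect f) x"
    unfolding reflect_def tf_shift_def transl_def modul_def flip_def complex_cnj_mult exp_2pi_cnj
    by (simp add: ivec_minus)
qed

lemma reflect_half_shift: "reflect (half_shift f) = tf_shift (- one_shift) (half_shift (reflect f))"
proof -
  have "reflect (half_shift f) = transl (- half) (reflect f)"
    by (simp add: reflect_def half_shift_def transl_def fun_eq_iff)
  also have "\<dots> = tf_shift (- one_shift) (half_shift (half_shift (transl (- half) (reflect f))))"
    by (simp add: half_shift_half_shift tf_shift_add)
  also have "half_shift (transl (- half) (reflect f)) = reflect f"
    by (simp add: half_shift_def transl_transl transl_zero)
  finally show ?thesis .
qed

section \<open>An orthonormal basis of shifts of the unit cube\<close>

lemma Basis_cart: "(Basis :: (real ^ 'd) set) = range (\<lambda>i. axis i 1)"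
  by (auto simp: Basis_vec_def)

lemma prod_Basis_cart: "(\<Prod>b\<in>(Basis :: (real ^ 'd) set). F b) = (\<Prod>i\<in>UNIV. F (axis i 1))"
  unfolding Basis_cart by (subst prod.reindex) (auto simp: inj_on_def axis_eq_axis)

lemma integral_prod_cart:
  fixes f :: "'d::finite \<Rightarrow> real \<Rightarrow> complex"
  assumes f: "\<And>i. integrable lborel (f i)"
  shows "integrable lebesgue (\<lambda>x::real ^ 'd. \<Prod>i\<in>UNIV. f i (x $ i))"
    and "(LINT x|lebesgue. (\<Prod>i\<in>UNIV. f i ((x::real ^ 'd) $ i))) = (\<Prod>i\<in>UNIV. (LINT t|lborel. f i t))"
proof -
  interpret product_sigma_finite "\<lambda>_. lborel :: real measure" by standard
  have fm [measurable]: "f i \<in> borel_measurable borel" for i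
    using borel_measurable_integrable[OF f[of i]] by simp
  define F :: "real ^ 'd \<Rightarrow> complex" where "F x = (\<Prod>i\<in>UNIV. f i (x $ i))" for x
  have Fm: "F \<in> borel_measurable borel"
    unfolding F_def by measurable
  let ?B = "Basis :: (real ^ 'd) set"
  define ix :: "real ^ 'd \<Rightarrow> 'd" where "ix b = (THE i. b = axis i 1)" for b
  have ix: "ix (axis i 1) = i" for i unfolding ix_def by (auto simp: axis_eq_axis)
  define T :: "(real ^ 'd \<Rightarrow> real) \<Rightarrow> real ^ 'd" where "T y = (\<Sum>b\<in>?B. y b *\<^sub>R b)" for y
  have Tm: "T \<in> (\<Pi>\<^sub>M b\<in>?B. lborel) \<rightarrow>\<^sub>M borel" unfolding T_def by measurable
  have FT: "F (T y) = (\<Prod>b\<in>?B. f (ix b) (y b))" for y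
  proof -
    have "T y $ i = y (axis i 1)" for i
    proof -
      have "T y $ i = T y \<bullet> axis i 1" by (simp add: inner_axis)
      also have "\<dots> = (\<Sum>b\<in>?B. if b = axis i 1 then y b else 0)"
        unfolding T_def inner_sum_left
        by (intro sum.cong refl) (auto simp: inner_Basis Basis_cart axis_eq_axis inner_axis_axis)
      also have "\<dots> = y (axis i 1)" by (simp add: axis_in_Basis_iff)
      finally show ?thesis .
    qed
    then show ?thesis by (simp add: F_def prod_Basis_cart ix)
  qed
  have lb: "lborel = distr (\<Pi>\<^sub>M b\<in>?B. lborel) borel T"
    unfolding T_def by (rule lborel_eq)
  have "integrable (\<Pi>\<^sub>M b\<in>?B. lborel) (\<lambda>y. F (T y))"
    unfolding FT by (intro product_integrable_prod f) simp
  then have Fi: "integrable lborel F"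
    unfolding lb integrable_distr_eq[OF Tm Fm] .
  then show "integrable lebesgue (\<lambda>x::real ^ 'd. \<Prod>i\<in>UNIV. f i (x $ i))"
    using integrable_completion[of F lborel] Fm by (simp add: F_def[abs_def])
  have "(LINT x|lborel. F x) = (\<integral>y. F (T y) \<partial>(\<Pi>\<^sub>M b\<in>?B. lborel))"
    unfolding lb integral_distr[OF Tm Fm] ..
  also have "\<dots> = (\<Prod>b\<in>?B. (LINT t|lborel. f (ix b) t))"
    unfolding FT by (intro product_integral_prod f) simp
  also have "\<dots> = (\<Prod>i\<in>UNIV. (LINT t|lborel. f i t))"
    by (simp add: prod_Basis_cart ix)
  finally show "(LINT x|lebesgue. (\<Prod>i\<in>UNIV. f i ((x::real ^ 'd) $ i))) = (\<Prod>i\<in>UNIV. (LINT t|lborel. f i t))"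
    using integral_completion[of F lborel] Fm by (simp add: F_def[abs_def])
qed

definition cube :: "real ^ 'd \<Rightarrow> complex" where
  "cube x = (if \<forall>i. \<bar>x $ i\<bar> < 1 / 2 then 1 else 0)"

lemma integral_unit_interval:
  fixes n :: int
  defines "h \<equiv> \<lambda>t. indicator {- 1/2<..<1/2::real} t *\<^sub>R exp (2 * of_real pi * \<i> * of_real (t * of_int n))"
  shows "integrable lborel h" "(LINT t|lborel. h t) = (if n = 0 then 1 else 0)"
proof -
  define e where "e t = exp (2 * of_real pi * \<i> * of_real (t * of_int n))" for t :: real
  define P where "P z = (if n = 0 then z else exp (2 * of_real pi * \<i> * (z * of_int n)) / (2 * of_real pi * \<i> * of_int n))" for z :: complex
  define E where "E t = P (of_real t)" for t :: real
  have P: "(P has_field_derivative exp (2 * of_real pi * \<i> * (z * of_int n))) (at z)" for z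
  proof (cases "n = 0")
    case True
    then have "P = (\<lambda>z. z)" by (simp add: P_def fun_eq_iff)
    then show ?thesis using True by simp
  next
    case False
    then have "P = (\<lambda>z. exp (2 * of_real pi * \<i> * (z * of_int n)) / (2 * of_real pi * \<i> * of_int n))"
      by (simp add: P_def fun_eq_iff)
    then show ?thesis using False by (auto intro!: derivative_eq_intros)
  qed
  have "(E has_vector_derivative e t) (at t within S)" for t S
    using has_vector_derivative_real_field[OF P[of "of_real t"]] by (simp add: E_def[abs_def] e_def)
  moreover have "continuous_on {- 1/2..1/2} e" unfolding e_def by (intro continuous_intros)
  ultimately have I: "has_bochner_integral lborel (\<lambda>t. indicator {- 1/2..1/2} t *\<^sub>R e t) (E (1/2) - E (- 1/2))"
    by (intro has_bochner_integral_FTC_Icc) auto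
  have hm: "h \<in> borel_measurable borel"
    unfolding h_def
    by (rule borel_measurable_scaleR, simp, intro borel_measurable_continuous_onI continuous_intros)
  have ae: "AE t in lborel. indicator {- 1/2..1/2} t *\<^sub>R e t = h t"
    using AE_lborel_singleton[of "1/2::real"] AE_lborel_singleton[of "- 1/2::real"]
    by eventually_elim (auto simp: h_def e_def indicator_def)
  have "has_bochner_integral lborel h (E (1/2) - E (- 1/2))"
    using has_bochner_integral_cong_AE[OF borel_measurable_has_bochner_integral[OF I] _ ae] hm I by simp
  moreover have "E (1/2) - E (- 1/2) = (if n = 0 then 1 else 0)"
  proof (cases "n = 0")
    case False
    have "e (1/2) = e (- 1/2) * exp (2 * of_real pi * \<i> * of_real (of_int n))"
      unfolding e_def exp_add[symmetric] by (rule arg_cong[where f=exp]) (simp add: field_simps)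
    then have "e (1/2) = e (- 1/2)" by (simp only: exp_2pi_int mult_1_right)
    then show ?thesis using False by (simp add: E_def P_def e_def)
  qed (simp add: E_def P_def)
  ultimately show "integrable lborel h" "(LINT t|lborel. h t) = (if n = 0 then 1 else 0)"
    by (auto simp: has_bochner_integral_iff)
qed

lemma modul_cube: "modul (ivec n) cube x = (\<Prod>i\<in>UNIV. indicator {- 1/2<..<1/2::real} (x $ i) *\<^sub>R
    exp (2 * of_real pi * \<i> * of_real (x $ i * of_int (n $ i))))"
proof (cases "\<forall>i. \<bar>x $ i\<bar> < 1 / 2")
  case True
  have "x \<bullet> ivec n = (\<Sum>i\<in>UNIV. x $ i * of_int (n $ i))" by (simp add: inner_vec_def ivec_def)
  then have "modul (ivec n) cube x = (\<Prod>i\<in>UNIV. exp (2 * of_real pi * \<i> * of_real (x $ i * of_int (n $ i))))"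
    using True by (simp add: modul_def cube_def exp_sum[symmetric] sum_distrib_left)
  also have "\<dots> = (\<Prod>i\<in>UNIV. indicator {- 1/2<..<1/2::real} (x $ i) *\<^sub>R
    exp (2 * of_real pi * \<i> * of_real (x $ i * of_int (n $ i))))"
  proof (intro prod.cong refl)
    fix i
    have "x $ i \<in> {- 1/2<..<1/2}" 
      using True[rule_format, of i] unfolding abs_less_iff greaterThanLessThan_iff by auto
    then show "exp (2 * of_real pi * \<i> * of_real (x $ i * of_int (n $ i)))
        = indicator {- 1/2<..<1/2::real} (x $ i) *\<^sub>R exp (2 * of_real pi * \<i> * of_real (x $ i * of_int (n $ i)))"
      by (simp only: indicator_simps scaleR_one)
  qed
  finally show ?thesis .
next
  case False
  then obtain i where "\<not> \<bar>x $ i\<bar> < 1 / 2" by auto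
  then have "indicator {- 1/2<..<1/2::real} (x $ i) = (0::real)" by (auto simp: indicator_def abs_less_iff)
  then have "(\<Prod>i\<in>UNIV. indicator {- 1/2<..<1/2::real} (x $ i) *\<^sub>R
    exp (2 * of_real pi * \<i> * of_real (x $ i * of_int (n $ i)))) = 0"
    by (intro prod_zero) auto
  moreover have "cube x = 0" unfolding cube_def using False by simp
  ultimately show ?thesis by (simp add: modul_def)
qed

lemma integral_modul_cube:
  "integrable lebesgue (modul (ivec n) cube)"
  "(LINT x|lebesgue. modul (ivec n) (cube :: real ^ 'd \<Rightarrow> complex) x) = (if n = 0 then 1 else 0)"
proof -
  show "integrable lebesgue (modul (ivec n) cube)"
    unfolding modul_cube by (intro integral_prod_cart integral_unit_interval)
  have "(LINT x|lebesgue. modul (ivec n) (cube :: real ^ 'd \<Rightarrow> complex) x)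
      = (\<Prod>i\<in>UNIV. if n $ i = 0 then 1 else 0)"
    unfolding modul_cube integral_prod_cart(2)[OF integral_unit_interval(1)] integral_unit_interval(2) ..
  also have "\<dots> = (if n = 0 then 1 else 0)"
  proof (cases "n = 0")
    case False
    then obtain i where "n $ i \<noteq> 0" by (auto simp: vec_eq_iff)
    then have "(\<Prod>i\<in>UNIV. if n $ i = 0 then 1 else 0 :: complex) = 0"
      by (intro prod_zero) auto
    then show ?thesis using False by simp
  qed simp
  finally show "(LINT x|lebesgue. modul (ivec n) (cube :: real ^ 'd \<Rightarrow> complex) x) = (if n = 0 then 1 else 0)" .
qed

lemma L2fun_cube: "L2fun (cube :: real ^ 'd \<Rightarrow> complex)"
proof -
  have c: "integrable lebesgue (cube :: real ^ 'd \<Rightarrow> complex)"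
    using integral_modul_cube(1)[of 0] by (simp add: ivec_zero modul_zero)
  have "(cmod (cube x))\<^sup>2 = cmod (cube x)" for x :: "real ^ 'd" by (simp add: cube_def)
  then show ?thesis
    using borel_measurable_integrable[OF c] integrable_norm[OF c] by (simp add: L2fun_def)
qed

lemma ip_cube: "L2ip (tf_shift k cube) cube = (if k = 0 then 1 else 0)"
proof (cases "fst k = 0")
  case True
  then have "L2ip (tf_shift k cube) cube = (LINT x|lebesgue. modul (ivec (snd k)) cube x * cnj (cube x))"
    by (simp add: L2ip_def tf_shift_def ivec_zero transl_zero)
  also have "(\<lambda>x. modul (ivec (snd k)) cube x * cnj (cube x)) = modul (ivec (snd k)) cube"
    by (auto simp: modul_def cube_def fun_eq_iff)
  finally show ?thesis using True by (simp add: integral_modul_cube prod_eq_iff)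
next
  case False
  then obtain i where i: "fst k $ i \<noteq> 0" by (auto simp: vec_eq_iff)
  have "cube (x - ivec (fst k)) * cube x = 0" for x
  proof (rule ccontr)
    assume "cube (x - ivec (fst k)) * cube x \<noteq> 0"
    then have "\<bar>x $ i - of_int (fst k $ i)\<bar> < 1/2" "\<bar>x $ i\<bar> < 1/2"
      by (auto simp: cube_def ivec_def split: if_splits)
    then have "\<bar>of_int (fst k $ i) :: real\<bar> < 1" by linarith
    then show False using i by linarith
  qed
  then have "(\<lambda>x. tf_shift k cube x * cnj (cube x)) = (\<lambda>x. 0)"
    by (auto simp: tf_shift_def transl_def modul_def fun_eq_iff)
  then show ?thesis using False by (auto simp: L2ip_def simp del: mult_eq_0_iff)
qed

text \<open>An exceptional point has a coordinate in \<open>1 / 2 + \<int>\<close> and lies on one of countably many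
  hyperplanes.\<close>

lemma AE_cube_cover: "AE x in lebesgue. \<exists>l. cube (x - ivec l :: real ^ 'd) = 1"
proof -
  have "AE x in lebesgue. (x :: real ^ 'd) $ i \<noteq> c" for i c
  proof -
    have "{x :: real ^ 'd. x $ i = c} = {x. axis i 1 \<bullet> x = c}" by (simp add: inner_axis')
    then have "{x :: real ^ 'd. x $ i = c} \<in> null_sets lebesgue"
      by (simp add: negligible_hyperplane axis_eq_0_iff flip: negligible_iff_null_sets)
    from AE_not_in[OF this] show ?thesis by simp
  qed
  then have "AE x in lebesgue. \<forall>i. \<forall>m::int. (x :: real ^ 'd) $ i \<noteq> of_int m + 1/2"
    unfolding AE_all_countable by simp
  then show ?thesis
  proof eventually_elim
    case (elim x)
    define l :: "int ^ 'd" where "l = (\<chi> i. \<lfloor>x $ i + 1/2\<rfloor>)"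
    have "\<bar>x $ i - of_int \<lfloor>x $ i + 1/2\<rfloor>\<bar> < 1/2" for i
    proof -
      have "x $ i \<noteq> of_int (\<lfloor>x $ i + 1/2\<rfloor> - 1) + 1/2" 
        using elim by (rule allE[of _ i]) (erule allE)
      then have "x $ i + 1/2 \<noteq> of_int \<lfloor>x $ i + 1/2\<rfloor>" by linarith
      then show ?thesis using floor_correct[of "x $ i + 1/2"] by linarith
    qed
    then have "cube (x - ivec l) = 1" by (simp add: cube_def l_def ivec_def)
    then show ?case by blast
  qed
qed

text \<open>If \<open>f\<close> is orthogonal to all shifts, the Fourier coefficients of each of its translates, cut off
  to the cube, vanish.\<close>

interpretation cube_basis: orthonormal_basis UNIV "\<lambda>k. tf_shift k (cube :: real ^ 'd \<Rightarrow> complex)"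
proof
  fix i j :: "(int ^ 'd) \<times> (int ^ 'd)"
  show "L2fun (tf_shift i (cube :: real ^ 'd \<Rightarrow> complex))" by (intro L2fun_tf_shift L2fun_cube)
  show "L2ip (tf_shift i (cube :: real ^ 'd \<Rightarrow> complex)) (tf_shift j cube) = (if i = j then 1 else 0)"
    by (simp add: L2ip_tf_shift_diff L2fun_cube ip_cube)
next
  fix f :: "real ^ 'd \<Rightarrow> complex"
  assume f: "L2fun f" and orth: "\<And>j. j \<in> UNIV \<Longrightarrow> L2ip f (tf_shift j cube) = 0"
  have piece: "L2nrm (\<lambda>x. f x * transl (ivec l) cube x) = 0" for l
  proof -
    define w where "w x = transl (- ivec l) f x * cube x" for x
    have wi: "integrable lebesgue w"
      unfolding w_def by (intro L2fun_integrable_prod L2fun_transl f L2fun_cube)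
    have "AE x in lebesgue. w x = 0"
    proof (rule Fourier_coefficients_unique_cube[OF wi])
      show "\<forall>i. \<bar>x $ i\<bar> < 1 / 2" if "w x \<noteq> 0" for x
        using that by (auto simp: w_def cube_def split: if_splits)
      show "(LINT x|lebesgue. modul (ivec n) w x) = 0" for n
      proof -
        have "modul (ivec n) w x = transl (- ivec l) f x * cnj (modul (ivec (- n)) cube x)" for x
          unfolding modul_def complex_cnj_mult exp_2pi_cnj
          by (simp add: w_def cube_def ivec_minus)
        then have "(LINT x|lebesgue. modul (ivec n) w x) = L2ip (transl (- ivec l) f) (modul (ivec (- n)) cube)"
          by (simp add: L2ip_def)
        also have "\<dots> = L2ip (transl (ivec l) (transl (- ivec l) f)) (transl (ivec l) (modul (ivec (- n)) cube))"
          by (subst L2ip_transl) (auto intro!: L2fun_transl L2fun_modul f L2fun_cube)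
        also have "\<dots> = L2ip f (tf_shift (l, - n) cube)"
          by (simp add: tf_shift_def transl_transl transl_zero)
        finally show ?thesis using orth by simp
      qed
    qed
    then have "(LINT x|lebesgue. (cmod (w x))\<^sup>2) = (LINT x|(lebesgue :: (real ^ 'd) measure). 0)"
      using wi by (intro integral_cong_AE) (auto elim!: eventually_mono)
    then have "0 = (LINT x|lebesgue. (cmod (w (x - ivec l)))\<^sup>2)"
      using wi by (subst integral_transl) auto
    moreover have "w (x - ivec l) = f x * transl (ivec l) cube x" for x
      by (simp add: w_def transl_def)
    ultimately show ?thesis by (simp add: L2nrm_def)
  qed
  have fc: "L2fun (\<lambda>x. f x * transl (ivec l) cube x)" for l
  proof -
    have "integrable lebesgue (\<lambda>x. (cmod (f x * transl (ivec l) cube x))\<^sup>2)"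
      by (rule Bochner_Integration.integrable_bound[OF L2fun_integrable_sq[OF f]])
         (use L2fun_integrable_prod[OF f L2fun_transl[OF L2fun_cube, of "ivec l"]] in
          \<open>auto simp: transl_def cube_def\<close>)
    then show ?thesis
      using L2fun_integrable_prod[OF f L2fun_transl[OF L2fun_cube, of "ivec l"]] by (auto simp: L2fun_def)
  qed
  have "AE x in lebesgue. \<forall>l. f x * transl (ivec l) cube x = 0"
    unfolding AE_all_countable using piece fc L2nrm_eq_0_AE by blast
  then have "AE x in lebesgue. f x = 0"
    using AE_cube_cover
  proof eventually_elim
    case (elim x)
    then obtain l where "cube (x - ivec l) = 1" by blast
    moreover have "f x * cube (x - ivec l) = 0" 
      using elim(1) unfolding transl_def by (rule spec)
    ultimately show ?case by simp
  qed
  then show "L2nrm f = 0" using f by (simp add: L2nrm_eq_0_AE)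
qed

section \<open>Real Fourier transform means Hermitian symmetry\<close>

lemma sigma_finite_lebesgue: "sigma_finite_measure (lebesgue :: 'a::euclidean_space measure)"
proof
  obtain A :: "'a set set" where A: "countable A \<and> A \<subseteq> sets lborel \<and> \<Union>A = space lborel \<and>
      (\<forall>a\<in>A. emeasure lborel a \<noteq> \<infinity>)"
    using lborel.sigma_finite_countable by (rule exE)
  then have "emeasure lebesgue a \<noteq> \<infinity>" "a \<in> sets lebesgue" if "a \<in> A" for a
    using that emeasure_completion[of a lborel] sets_completionI_sets[of a lborel] by fastforce+
  then show "\<exists>A::'a set set. countable A \<and> A \<subseteq> sets lebesgue \<and> \<Union>A = space lebesgue \<and>
      (\<forall>a\<in>A. emeasure lebesgue a \<noteq> \<infinity>)"
    using A by (intro exI[of _ A] conjI subsetI ballI) simp_all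
qed

lemma fourier_integral_modul: "fourier_integral f \<omega> = (LINT x|lebesgue. modul (- \<omega>) f x)"
  by (simp add: fourier_integral_def modul_def mult.commute inner_commute)

text \<open>Fubini's theorem for the kernel \<open>f x * h \<omega> * exp (- 2 * pi * \<i> * (\<omega> \<bullet> x))\<close>.\<close>

lemma fourier_integral_multiplication:
  fixes f h :: "real ^ 'd \<Rightarrow> complex"
  assumes f: "integrable lebesgue f" and h: "integrable lebesgue h"
  shows "(LINT \<omega>|lebesgue. fourier_integral f \<omega> * h \<omega>) = (LINT x|lebesgue. f x * fourier_integral h x)"
proof -
  interpret L: sigma_finite_measure "lebesgue :: (real ^ 'd) measure" by (rule sigma_finite_lebesgue)
  interpret P: pair_sigma_finite "lebesgue :: (real ^ 'd) measure" "lebesgue :: (real ^ 'd) measure" ..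
  define e where "e t = exp (- 2 * of_real pi * \<i> * of_real t)" for t :: real
  have ne: "cmod (e t) = 1" for t
  proof -
    have "- 2 * of_real pi * \<i> * of_real t = \<i> * of_real (- 2 * pi * t)" by simp
    then show ?thesis unfolding e_def by (simp only: norm_exp_i_times)
  qed
  define k where "k x \<omega> = f x * (h \<omega> * e (\<omega> \<bullet> x))" for x \<omega>
  have [measurable]: "f \<in> borel_measurable lebesgue" "h \<in> borel_measurable lebesgue"
    using f h by auto
  have idm: "(\<lambda>x. x) \<in> borel_measurable (lebesgue :: (real ^ 'd) measure)"
    by (intro borel_measurable_lebesgue_continuous continuous_intros)
  have em: "e \<in> borel_measurable borel"
    unfolding e_def by (intro borel_measurable_continuous_onI continuous_intros)
  have im: "(\<lambda>p. snd p \<bullet> fst p) \<in> borel_measurable ((lebesgue :: (real ^ 'd) measure) \<Otimes>\<^sub>M lebesgue)"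
    by (intro borel_measurable_inner measurable_compose[OF measurable_snd idm]
        measurable_compose[OF measurable_fst idm])
  have km: "case_prod k \<in> borel_measurable (lebesgue \<Otimes>\<^sub>M lebesgue)"
    using measurable_compose[OF im em] unfolding k_def case_prod_beta by measurable
  have knorm: "norm (k x \<omega>) = cmod (f x) * cmod (h \<omega>)" for x \<omega>
    by (simp add: k_def norm_mult ne)
  have hi: "integrable lebesgue (\<lambda>\<omega>. h \<omega> * e (\<omega> \<bullet> x))" for x
    using modul_integrable[OF h, of "- x"] by (simp add: modul_def[abs_def] e_def mult.commute)
  have "integrable (lebesgue \<Otimes>\<^sub>M lebesgue) (case_prod k)"
  proof (rule P.Fubini_integrable[OF km])
    show "integrable lebesgue (\<lambda>x. LINT y|lebesgue. norm (case_prod k (x, y)))"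
      using f by (simp add: knorm)
    show "AE x in lebesgue. integrable lebesgue (\<lambda>y. case_prod k (x, y))"
      unfolding k_def using hi by simp
  qed
  from P.Fubini_integral[OF this]
  have "(LINT \<omega>|lebesgue. LINT x|lebesgue. k x \<omega>) = (LINT x|lebesgue. LINT \<omega>|lebesgue. k x \<omega>)" .
  moreover have "(LINT x|lebesgue. k x \<omega>) = fourier_integral f \<omega> * h \<omega>" for \<omega>
  proof -
    have "k x \<omega> = f x * e (\<omega> \<bullet> x) * h \<omega>" for x by (simp add: k_def mult_ac)
    then show ?thesis by (simp add: fourier_integral_def e_def)
  qed
  moreover have "(LINT \<omega>|lebesgue. k x \<omega>) = f x * fourier_integral h x" for x
    by (simp add: k_def fourier_integral_def e_def inner_commute)
  ultimately show ?thesis by simp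
qed

lemma integrable_exp_sq:
  assumes "0 < c"
  shows "integrable lborel (\<lambda>t::real. complex_of_real (exp (- c * t\<^sup>2)))"
proof -
  define \<sigma> where "\<sigma> = sqrt (1 / (2 * c))"
  have s: "\<sigma>\<^sup>2 = 1 / (2 * c)" using assms by (simp add: \<sigma>_def)
  have "0 < \<sigma>" using assms by (simp add: \<sigma>_def)
  then have "integrable lborel (\<lambda>t. sqrt (2 * pi * \<sigma>\<^sup>2) * normal_density 0 \<sigma> t)" by simp
  moreover have "sqrt (2 * pi * \<sigma>\<^sup>2) * normal_density 0 \<sigma> t = exp (- c * t\<^sup>2)" for t
    using assms by (simp add: normal_density_def s)
  ultimately show ?thesis by (simp add: integrable_of_real)
qed

definition gaussian :: "real \<Rightarrow> real ^ 'd \<Rightarrow> complex" where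
  "gaussian c x = (\<Prod>i\<in>UNIV. of_real (exp (- c * (x $ i)\<^sup>2)))"

lemma gaussian_nonzero: "gaussian c x \<noteq> 0"
  by (simp add: gaussian_def)

lemma integrable_gaussian: "0 < c \<Longrightarrow> integrable lebesgue (gaussian c)"
  unfolding gaussian_def[abs_def] by (intro integral_prod_cart(1) integrable_exp_sq)

lemma L2fun_gaussian:
  assumes "0 < c"
  shows "L2fun (gaussian c :: real ^ 'd \<Rightarrow> complex)"
proof -
  have "(cmod (gaussian c x))\<^sup>2 = cmod (gaussian (2 * c) x)" for x :: "real ^ 'd"
  proof -
    have "(exp (- c * t\<^sup>2))\<^sup>2 = exp (- (2 * c) * t\<^sup>2)" for t :: real
      by (simp add: power2_eq_square flip: exp_add)
    then show ?thesis by (simp add: gaussian_def prod_norm[symmetric] prod_power_distrib)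
  qed
  then show ?thesis
    using assms borel_measurable_integrable[OF integrable_gaussian[of c]]
      integrable_norm[OF integrable_gaussian[of "2 * c"]]
    by (simp add: L2fun_def)
qed

lemma fourier_gaussian_1d:
  "integrable lborel (\<lambda>t. of_real (exp (- (1/2) * t\<^sup>2)) * exp (- 2 * of_real pi * \<i> * of_real (s * t)))"
  "(LINT t|lborel. of_real (exp (- (1/2) * t\<^sup>2)) * exp (- 2 * of_real pi * \<i> * of_real (s * t)))
     = of_real (sqrt (2 * pi)) * of_real (exp (- (2 * pi\<^sup>2) * s\<^sup>2))"
proof -
  let ?f = "\<lambda>t. of_real (exp (- (1/2) * t\<^sup>2)) * exp (- 2 * of_real pi * \<i> * of_real (s * t))"
  have e: "exp (- 2 * of_real pi * \<i> * of_real (s * t)) = iexp ((- 2 * pi * s) * t)" for t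
    by (simp add: mult_ac)
  have m: "(\<lambda>t. iexp ((- 2 * pi * s) * t)) \<in> borel_measurable borel"
    by (intro borel_measurable_continuous_onI continuous_intros)
  show "integrable lborel ?f"
  proof (rule Bochner_Integration.integrable_bound)
    show "integrable lborel (\<lambda>t::real. complex_of_real (exp (- (1/2) * t\<^sup>2)))"
      by (rule integrable_exp_sq) simp
    show "?f \<in> borel_measurable lborel" unfolding e using m by measurable
    show "AE t in lborel. norm (?f t) \<le> norm (complex_of_real (exp (- (1/2) * t\<^sup>2)))"
      unfolding e norm_mult by (simp del: of_real_mult)
  qed
  have d: "of_real (std_normal_density t) * iexp ((- 2 * pi * s) * t) = ?f t / of_real (sqrt (2 * pi))" for t
    unfolding e std_normal_density_def by simp
  have "char std_normal_distribution (- 2 * pi * s)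
      = (LINT t|lborel. std_normal_density t *\<^sub>R iexp ((- 2 * pi * s) * t))"
    unfolding char_def using m by (intro integral_density) auto
  also have "\<dots> = (LINT t|lborel. ?f t / of_real (sqrt (2 * pi)))"
    unfolding scaleR_conv_of_real d ..
  also have "\<dots> = (LINT t|lborel. ?f t) / of_real (sqrt (2 * pi))" by simp
  finally have "(LINT t|lborel. ?f t) = of_real (sqrt (2 * pi)) * char std_normal_distribution (- 2 * pi * s)"
    by simp
  also have "char std_normal_distribution (- 2 * pi * s) = of_real (exp (- (2 * pi\<^sup>2) * s\<^sup>2))"
    unfolding char_std_normal_distribution by (simp add: power2_eq_square mult_ac)
  finally show "(LINT t|lborel. ?f t) = of_real (sqrt (2 * pi)) * of_real (exp (- (2 * pi\<^sup>2) * s\<^sup>2))" .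
qed

lemma fourier_gaussian:
  "fourier_integral (gaussian (1/2)) y = of_real (sqrt (2 * pi)) ^ CARD('d) * gaussian (2 * pi\<^sup>2) (y :: real ^ 'd)"
proof -
  have "gaussian (1/2) x * exp (- 2 * of_real pi * \<i> * of_real (y \<bullet> x))
      = (\<Prod>i\<in>UNIV. of_real (exp (- (1/2) * (x $ i)\<^sup>2)) * exp (- 2 * of_real pi * \<i> * of_real (y $ i * x $ i)))"
    for x :: "real ^ 'd"
    unfolding gaussian_def prod.distrib inner_vec_def
    by (simp add: sum_distrib_left exp_sum)
  then have "fourier_integral (gaussian (1/2)) y
      = (\<Prod>i\<in>UNIV. of_real (sqrt (2 * pi)) * of_real (exp (- (2 * pi\<^sup>2) * (y $ i)\<^sup>2)))"
    unfolding fourier_integral_def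
    by (simp only: integral_prod_cart(2)[OF fourier_gaussian_1d(1)] fourier_gaussian_1d(2))
  then show ?thesis by (simp only: prod.distrib gaussian_def prod_constant)
qed

lemma fourier_transl:
  assumes f: "f \<in> borel_measurable lebesgue"
  shows "fourier_integral (transl y f) x = modul (- y) (fourier_integral f) x"
proof -
  let ?e = "\<lambda>t. exp (2 * of_real pi * \<i> * of_real t)"
  have "fourier_integral (transl y f) x = (LINT z|lebesgue. ?e (x \<bullet> (- y)) * modul (- x) f (z - y))"
    unfolding fourier_integral_modul
  proof (rule Bochner_Integration.integral_cong[OF refl])
    fix z
    have "z \<bullet> (- x) = x \<bullet> (- y) + (z - y) \<bullet> (- x)" by (simp add: inner_diff_left inner_commute[of x y])
    then show "modul (- x) (transl y f) z = ?e (x \<bullet> (- y)) * modul (- x) f (z - y)"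
      unfolding modul_def transl_def
      by (simp only: of_real_add distrib_left exp_add mult.assoc)
  qed
  also have "\<dots> = ?e (x \<bullet> (- y)) * (LINT z|lebesgue. modul (- x) f (z - y))" by simp
  also have "(LINT z|lebesgue. modul (- x) f (z - y)) = fourier_integral f x"
    unfolding fourier_integral_modul by (rule integral_transl[OF modul_measurable[OF f]])
  finally show ?thesis by (simp add: modul_def)
qed

text \<open>The closed graph of the Fourier integral contains no point \<open>(u, 0)\<close> with \<open>u \<noteq> 0\<close>. By the
  multiplication formula \<open>u\<close> is orthogonal to every modulated Gaussian, that is, the Fourier integral
  of the integrable function \<open>u\<close> times a Gaussian vanishes.\<close>

lemma fourier_L2_injective:
  fixes u :: "real ^ 'd \<Rightarrow> complex"
  assumes u: "fourier_L2 u (\<lambda>\<omega>. 0)"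
  shows "AE x in lebesgue. u x = 0"
proof -
  from u obtain k where k: "\<And>n. integrable lebesgue (k n)" "L2_tendsto k u"
      "L2_tendsto (\<lambda>n. fourier_integral (k n)) (\<lambda>\<omega>. 0)"
    unfolding fourier_L2_def by blast
  let ?g = "gaussian (1/2) :: real ^ 'd \<Rightarrow> complex" and ?h = "gaussian (2 * pi\<^sup>2) :: real ^ 'd \<Rightarrow> complex"
  have u2: "L2fun u" and k2: "\<And>n. L2fun (k n)" and F2: "\<And>n. L2fun (fourier_integral (k n))"
    using k by (auto simp: L2_tendsto_def)
  have g2: "L2fun ?g" and h2: "L2fun ?h" and gi: "integrable lebesgue ?g"
    by (auto intro!: L2fun_gaussian integrable_gaussian)
  define C where "C = complex_of_real (sqrt (2 * pi)) ^ CARD('d)"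
  have C: "C \<noteq> 0" by (simp add: C_def)
  have pair: "(LINT x|lebesgue. modul (- y) (\<lambda>x. u x * ?h x) x) = 0" for y
  proof -
    let ?p = "\<lambda>\<omega>. cnj (transl y ?g \<omega>)" and ?q = "\<lambda>x. cnj (modul (- y) ?h x)"
    have p2: "L2fun ?p" and q2: "L2fun ?q"
      by (auto intro!: L2fun_cnj L2fun_transl L2fun_modul g2 h2)
    have eq: "L2ip (fourier_integral (k n)) ?p = C * L2ip (k n) ?q" for n
    proof -
      have ti: "integrable lebesgue (transl y ?g)"
        using integrable_transl[OF gi, of y] by (simp add: transl_def[abs_def])
      have "fourier_integral (transl y ?g) x = C * modul (- y) ?h x" for x
        using gi by (subst fourier_transl) (auto simp: modul_def fourier_gaussian C_def)
      then have "(LINT \<omega>|lebesgue. fourier_integral (k n) \<omega> * transl y ?g \<omega>)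
          = (LINT x|lebesgue. C * (k n x * modul (- y) ?h x))"
        unfolding fourier_integral_multiplication[OF k(1) ti] by (simp add: mult_ac)
      then show ?thesis unfolding L2ip_def by simp
    qed
    have "(\<lambda>n. L2ip (fourier_integral (k n)) ?p) \<longlonglongrightarrow> L2ip (\<lambda>\<omega>. 0) ?p"
      by (rule L2ip_tendsto) (use k p2 F2 in \<open>auto simp: L2_tendsto_def\<close>)
    moreover have "(\<lambda>n. C * L2ip (k n) ?q) \<longlonglongrightarrow> C * L2ip u ?q"
      by (intro tendsto_mult_left L2ip_tendsto) (use k q2 k2 u2 in \<open>auto simp: L2_tendsto_def\<close>)
    ultimately have "C * L2ip u ?q = 0"
      using LIMSEQ_unique unfolding eq by fastforce
    then have "L2ip u ?q = 0" using C by simp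
    then show ?thesis by (simp add: L2ip_def modul_def mult_ac)
  qed
  have "AE x in lebesgue. u x * ?h x = 0"
  proof (rule Fourier_transform_unique)
    show "integrable lebesgue (\<lambda>x. u x * ?h x)" by (rule L2fun_integrable_prod[OF u2 h2])
    show "(LINT x|lebesgue. modul y (\<lambda>x. u x * ?h x) x) = 0" for y using pair[of "- y"] by simp
  qed
  then show ?thesis by eventually_elim (simp add: gaussian_nonzero)
qed

lemma fourier_integral_diff:
  assumes "integrable lebesgue f" "integrable lebesgue h"
  shows "fourier_integral (\<lambda>x. f x - h x) \<omega> = fourier_integral f \<omega> - fourier_integral h \<omega>"
proof -
  have "modul (- \<omega>) (\<lambda>x. f x - h x) = (\<lambda>x. modul (- \<omega>) f x - modul (- \<omega>) h x)"
    by (simp add: modul_def right_diff_distrib fun_eq_iff)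
  then show ?thesis unfolding fourier_integral_modul
    by (simp add: modul_integrable assms)
qed

lemma fourier_integral_reflect:
  assumes f: "f \<in> borel_measurable lebesgue"
  shows "fourier_integral (reflect f) \<omega> = cnj (fourier_integral f \<omega>)"
proof -
  have "modul (- \<omega>) (reflect f) x = cnj (modul (- \<omega>) f (- x))" for x
    unfolding modul_def reflect_def complex_cnj_mult exp_2pi_cnj by simp
  then have "fourier_integral (reflect f) \<omega> = cnj (LINT x|lebesgue. modul (- \<omega>) f (- x))"
    by (simp add: fourier_integral_modul)
  also have "(LINT x|lebesgue. modul (- \<omega>) f (- x)) = fourier_integral f \<omega>"
    unfolding fourier_integral_modul by (rule integral_reflect[OF modul_measurable[OF f]])
  finally show ?thesis .
qed

lemma L2nrm_cnj: "L2nrm (\<lambda>x. cnj (f x)) = L2nrm f"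
  by (simp add: L2nrm_def)

lemma reflect_diff: "reflect (\<lambda>x. f x - h x) = (\<lambda>x. reflect f x - reflect h x)"
  by (simp add: reflect_def fun_eq_iff)

lemma L2nrm_reflect:
  assumes "L2fun f"
  shows "L2nrm (reflect f) = L2nrm f"
proof -
  have "(L2nrm (reflect f))\<^sup>2 = (L2nrm f)\<^sup>2" by (simp add: L2nrm_sq_Re L2ip_reflect assms)
  then show ?thesis by simp
qed

text \<open>If \<open>h n\<close> converges to \<open>g\<close>, then the Fourier integrals of \<open>h n - reflect (h n)\<close> are twice the
  imaginary parts of those of \<open>h n\<close>, up to the factor \<open>\<i>\<close>, and converge to \<open>0\<close>.\<close>

lemma reflect_eq_if_fourier_real:
  fixes g :: "real ^ 'd \<Rightarrow> complex"
  assumes "fourier_L2 g G" and real: "AE \<omega> in lebesgue. G \<omega> = cnj (G \<omega>)"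
  shows "AE x in lebesgue. reflect g x = g x"
proof -
  from assms(1) obtain h where hi: "\<And>n. integrable lebesgue (h n)" and hg: "L2_tendsto h g"
      and FG: "L2_tendsto (\<lambda>n. fourier_integral (h n)) G"
    unfolding fourier_L2_def by blast
  let ?F = "\<lambda>n. fourier_integral (h n)"
  have g2: "L2fun g" and h2: "\<And>n. L2fun (h n)" and F2: "\<And>n. L2fun (?F n)" and G2: "L2fun G"
    using hg FG by (auto simp: L2_tendsto_def)
  have ri: "integrable lebesgue (reflect (h n))" for n
    using integrable_reflect[OF hi[of n]] unfolding reflect_def[abs_def] by simp
  define k where "k n x = h n x - reflect (h n) x" for n x
  define u where "u x = g x - reflect g x" for x
  have ki: "integrable lebesgue (k n)" for n unfolding k_def using hi ri by simp
  have k2: "L2fun (k n)" for n unfolding k_def by (intro L2fun_diff L2fun_reflect h2)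
  have u2: "L2fun u" unfolding u_def by (intro L2fun_diff L2fun_reflect g2)
  have Fk: "fourier_integral (k n) = (\<lambda>\<omega>. ?F n \<omega> - cnj (?F n \<omega>))" for n
    unfolding k_def using hi ri by (auto simp: fourier_integral_diff fourier_integral_reflect)
  have Fk2: "L2fun (fourier_integral (k n))" for n
    unfolding Fk by (intro L2fun_diff L2fun_cnj F2)
  have lim: "(\<lambda>n. 2 * L2nrm (\<lambda>x. h n x - g x)) \<longlonglongrightarrow> 0" "(\<lambda>n. 2 * L2nrm (\<lambda>\<omega>. ?F n \<omega> - G \<omega>)) \<longlonglongrightarrow> 0"
    using hg FG tendsto_mult_right_zero[of _ sequentially 2] by (simp_all add: L2_tendsto_def)
  have "L2nrm (\<lambda>x. k n x - u x) \<le> 2 * L2nrm (\<lambda>x. h n x - g x)" for n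
  proof -
    have d: "L2fun (\<lambda>x. h n x - g x)" by (intro L2fun_diff h2 g2)
    have "(\<lambda>x. k n x - u x) = (\<lambda>x. (h n x - g x) - reflect (\<lambda>x. h n x - g x) x)"
      by (simp add: k_def u_def reflect_diff fun_eq_iff)
    then show ?thesis
      using L2nrm_triangle_diff[OF d L2fun_zero L2fun_reflect[OF d]] L2nrm_reflect[OF d]
        L2nrm_minus_commute[of "\<lambda>x. 0" "reflect (\<lambda>x. h n x - g x)"] by simp
  qed
  then have "(\<lambda>n. L2nrm (\<lambda>x. k n x - u x)) \<longlonglongrightarrow> 0"
    by (intro Lim_null_comparison[OF always_eventually lim(1)]) simp
  then have "L2_tendsto k u" using k2 u2 by (simp add: L2_tendsto_def)
  moreover have "L2nrm (\<lambda>\<omega>. fourier_integral (k n) \<omega> - 0) \<le> 2 * L2nrm (\<lambda>\<omega>. ?F n \<omega> - G \<omega>)" for n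
  proof -
    have d: "L2fun (\<lambda>\<omega>. ?F n \<omega> - G \<omega>)" by (intro L2fun_diff F2 G2)
    have "L2nrm (fourier_integral (k n)) = L2nrm (\<lambda>\<omega>. (?F n \<omega> - G \<omega>) - cnj (?F n \<omega> - G \<omega>))"
      unfolding Fk
    proof (rule L2nrm_cong_AE)
      show "AE \<omega> in lebesgue. ?F n \<omega> - cnj (?F n \<omega>) = (?F n \<omega> - G \<omega>) - cnj (?F n \<omega> - G \<omega>)"
        using real by eventually_elim simp
    qed (intro L2fun_diff L2fun_cnj F2 d)+
    also have "\<dots> \<le> 2 * L2nrm (\<lambda>\<omega>. ?F n \<omega> - G \<omega>)"
      using L2nrm_triangle_diff[OF d L2fun_zero L2fun_cnj[OF d]] L2nrm_cnj[of "\<lambda>\<omega>. ?F n \<omega> - G \<omega>"]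
        L2nrm_minus_commute[of "\<lambda>x. 0" "\<lambda>\<omega>. cnj (?F n \<omega> - G \<omega>)"] by simp
    finally show ?thesis by simp
  qed
  then have "(\<lambda>n. L2nrm (\<lambda>\<omega>. fourier_integral (k n) \<omega> - 0)) \<longlonglongrightarrow> 0"
    by (intro Lim_null_comparison[OF always_eventually lim(2)]) simp
  then have "L2_tendsto (\<lambda>n. fourier_integral (k n)) (\<lambda>\<omega>. 0)"
    using Fk2 by (simp add: L2_tendsto_def)
  ultimately have "fourier_L2 u (\<lambda>\<omega>. 0)"
    unfolding fourier_L2_def using ki by blast
  from fourier_L2_injective[OF this] show ?thesis
    by eventually_elim (simp add: u_def)
qed

section \<open>Frames and Riesz bases\<close>

lemma has_sum_norm_sq:
  "((\<lambda>j. z j * cnj (z j)) has_sum complex_of_real s) I \<longleftrightarrow> ((\<lambda>j. (cmod (z j))\<^sup>2) has_sum s) I"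
  unfolding complex_norm_square[symmetric] of_real_power[symmetric] by (rule has_sum_of_real_iff)

text \<open>A term \<open>\<langle>f + h, F j\<rangle>\<close> is split by the weighted form of \<open>(x + y)\<^sup>2 \<le> 2 * x\<^sup>2 + 2 * y\<^sup>2\<close>, so that
  the coefficient of the part belonging to \<open>f\<close> can be brought close to \<open>1\<close>.\<close>

lemma bessel_seq_energy_add:
  assumes B: "bessel_seq I F b" and f: "L2fun f" and h: "L2fun h" and t: "0 < t"
  shows "(\<Sum>\<^sub>\<infinity>j\<in>I. (cmod (L2ip (\<lambda>x. f x + h x) (F j)))\<^sup>2)
    \<le> (1 + t) * (\<Sum>\<^sub>\<infinity>j\<in>I. (cmod (L2ip f (F j)))\<^sup>2) + (1 + 1 / t) * (b * (L2nrm h)\<^sup>2)"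
proof -
  have F: "\<And>j. j \<in> I \<Longrightarrow> L2fun (F j)"
    and s: "\<And>f. L2fun f \<Longrightarrow> (\<lambda>j. (cmod (L2ip f (F j)))\<^sup>2) summable_on I"
    and e: "\<And>f. L2fun f \<Longrightarrow> (\<Sum>\<^sub>\<infinity>j\<in>I. (cmod (L2ip f (F j)))\<^sup>2) \<le> b * (L2nrm f)\<^sup>2"
    using B by (auto simp: bessel_seq_def)
  have le: "(cmod (x + y))\<^sup>2 \<le> (1 + t) * (cmod x)\<^sup>2 + (1 + 1 / t) * (cmod y)\<^sup>2" for x y
  proof -
    have "(cmod (x + y))\<^sup>2 \<le> (cmod x + cmod y)\<^sup>2" by (intro power_mono norm_triangle_ineq) simp
    moreover have "0 \<le> (t * cmod x - cmod y)\<^sup>2 / t" using t by simp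
    then have "2 * cmod x * cmod y \<le> t * (cmod x)\<^sup>2 + (cmod y)\<^sup>2 / t"
      using t by (simp add: field_simps power2_eq_square)
    ultimately show ?thesis by (simp add: power2_sum field_simps)
  qed
  have sr: "(\<lambda>j. (1 + t) * (cmod (L2ip f (F j)))\<^sup>2 + (1 + 1 / t) * (cmod (L2ip h (F j)))\<^sup>2) summable_on I"
    by (intro summable_on_add summable_on_cmult_right s f h)
  have "(\<Sum>\<^sub>\<infinity>j\<in>I. (cmod (L2ip (\<lambda>x. f x + h x) (F j)))\<^sup>2)
      \<le> (\<Sum>\<^sub>\<infinity>j\<in>I. (1 + t) * (cmod (L2ip f (F j)))\<^sup>2 + (1 + 1 / t) * (cmod (L2ip h (F j)))\<^sup>2)"
    by (intro infsum_mono s sr L2fun_add f h) (simp add: L2ip_add_left f h F le)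
  also have "\<dots> = (1 + t) * (\<Sum>\<^sub>\<infinity>j\<in>I. (cmod (L2ip f (F j)))\<^sup>2) + (1 + 1 / t) * (\<Sum>\<^sub>\<infinity>j\<in>I. (cmod (L2ip h (F j)))\<^sup>2)"
    by (subst infsum_add) (auto intro!: summable_on_cmult_right s f h simp: infsum_cmult_right s f h)
  also have "\<dots> \<le> (1 + t) * (\<Sum>\<^sub>\<infinity>j\<in>I. (cmod (L2ip f (F j)))\<^sup>2) + (1 + 1 / t) * (b * (L2nrm h)\<^sup>2)"
    using t by (intro add_left_mono mult_left_mono e h) auto
  finally show ?thesis .
qed

text \<open>The Neumann iteration for the inverse of the frame operator, with finite partial sums of the
  frame operator in place of the operator: a step with relaxation parameter \<open>1 / b\<close> shrinks the square
  of the norm at least by the factor \<open>1 - a / (2 * b)\<close>.\<close>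

lemma frame_dense_span:
  assumes fr: "is_frame I F a b"
  shows "dense_span I F"
proof -
  have a: "0 < a" and b: "0 < b" and F: "\<And>j. j \<in> I \<Longrightarrow> L2fun (F j)"
    and low: "\<And>f. L2fun f \<Longrightarrow> a * (L2nrm f)\<^sup>2 \<le> (\<Sum>\<^sub>\<infinity>j\<in>I. (cmod (L2ip f (F j)))\<^sup>2)"
    and B: "bessel_seq I F b"
    using fr by (auto simp: is_frame_def bessel_seq_def)
  \<comment> \<open>The maximum is always the second entry, because the frame inequalities for a function that is
     not null give \<open>a \<le> b\<close>; taking it makes \<open>0 \<le> q\<close> immediate.\<close>
  define q where "q = max 0 (1 - a / (2 * b))"
  have q: "0 \<le> q" "q < 1" using a b by (auto simp: q_def)
  have step: "\<exists>A c. finite A \<and> A \<subseteq> I \<and> (L2nrm (\<lambda>x. f x - (\<Sum>j\<in>A. c j * F j x)))\<^sup>2 \<le> q * (L2nrm f)\<^sup>2"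
    if f: "L2fun f" for f
  proof -
    define E where "E = (\<Sum>\<^sub>\<infinity>j\<in>I. (cmod (L2ip f (F j)))\<^sup>2)"
    have s: "(\<lambda>j. (cmod (L2ip f (F j)))\<^sup>2) summable_on I" using B f by (simp add: bessel_seq_def)
    have "\<exists>A. finite A \<and> A \<subseteq> I \<and> a / 2 * (L2nrm f)\<^sup>2 \<le> (\<Sum>j\<in>A. (cmod (L2ip f (F j)))\<^sup>2)"
    proof (cases "L2nrm f = 0")
      case True
      then show ?thesis by (intro exI[of _ "{}"]) simp
    next
      case False
      then have "0 < a / 2 * (L2nrm f)\<^sup>2" using a by simp
      then have "a / 2 * (L2nrm f)\<^sup>2 < E" using low[OF f] unfolding E_def by linarith
      moreover have "(sum (\<lambda>j. (cmod (L2ip f (F j)))\<^sup>2) \<longlongrightarrow> E) (finite_subsets_at_top I)"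
        unfolding E_def using has_sum_infsum[OF s] by (simp add: has_sum_def)
      ultimately have "\<forall>\<^sub>F A in finite_subsets_at_top I. a / 2 * (L2nrm f)\<^sup>2 < (\<Sum>j\<in>A. (cmod (L2ip f (F j)))\<^sup>2)"
        by (intro order_tendstoD(1)[where y=E])
      then obtain A where "finite A" "A \<subseteq> I" "a / 2 * (L2nrm f)\<^sup>2 < (\<Sum>j\<in>A. (cmod (L2ip f (F j)))\<^sup>2)"
        unfolding eventually_finite_subsets_at_top by blast
      then show ?thesis by (intro exI[of _ A]) simp
    qed
    then obtain A where A: "finite A" "A \<subseteq> I" "a / 2 * (L2nrm f)\<^sup>2 \<le> (\<Sum>j\<in>A. (cmod (L2ip f (F j)))\<^sup>2)"
      by blast
    define s where "s = (\<Sum>j\<in>A. (cmod (L2ip f (F j)))\<^sup>2)"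
    define h where "h x = (\<Sum>j\<in>A. of_real (1 / b) * L2ip f (F j) * F j x)" for x
    have FA: "\<And>j. j \<in> A \<Longrightarrow> L2fun (F j)" using A F by blast
    have h: "L2fun h" unfolding h_def by (intro L2fun_lincomb FA)
    have "L2ip f h = (\<Sum>j\<in>A. cnj (of_real (1 / b) * L2ip f (F j)) * L2ip f (F j))"
      unfolding h_def by (intro L2ip_lincomb_right FA f)
    also have "\<dots> = of_real (s / b)"
    proof -
      have "cnj (of_real r * z) * z = of_real (r * (cmod z)\<^sup>2)" for r z
        by (simp only: of_real_mult complex_norm_square complex_cnj_mult complex_cnj_complex_of_real mult_ac)
      then show ?thesis by (simp only: s_def sum_divide_distrib of_real_sum) simp
    qed
    finally have fh: "Re (L2ip f h) = s / b" by simp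
    have "(L2nrm h)\<^sup>2 \<le> b * (\<Sum>j\<in>A. (cmod (of_real (1 / b) * L2ip f (F j)))\<^sup>2)"
      unfolding h_def[abs_def] using A b by (intro bessel_seq_synthesis_bound[OF B]) auto
    also have "\<dots> = s / b"
      using b by (simp add: s_def norm_mult norm_divide power_mult_distrib power_divide
          sum_divide_distrib[symmetric] power2_eq_square[of b])
    finally have "(L2nrm (\<lambda>x. f x - h x))\<^sup>2 \<le> (L2nrm f)\<^sup>2 - s / b"
      unfolding L2nrm_diff_sq[OF f h] fh by simp
    also have "\<dots> \<le> (1 - a / (2 * b)) * (L2nrm f)\<^sup>2"
      using divide_right_mono[OF A(3), of b] b by (simp add: s_def field_simps)
    also have "\<dots> \<le> q * (L2nrm f)\<^sup>2" by (intro mult_right_mono) (auto simp: q_def)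
    finally show ?thesis
      using A(1,2) unfolding h_def
      by (intro exI[of _ A] exI[of _ "\<lambda>j. of_real (1 / b) * L2ip f (F j)"] conjI)
  qed
  have iter: "\<exists>A c. finite A \<and> A \<subseteq> I \<and> (L2nrm (\<lambda>x. f x - (\<Sum>j\<in>A. c j * F j x)))\<^sup>2 \<le> q ^ n * (L2nrm f)\<^sup>2"
    if f: "L2fun f" for f n
  proof (induction n)
    case 0
    then show ?case by (intro exI[of _ "{}"]) simp
  next
    case (Suc n)
    then obtain A c where A: "finite A" "A \<subseteq> I"
      and le: "(L2nrm (\<lambda>x. f x - (\<Sum>j\<in>A. c j * F j x)))\<^sup>2 \<le> q ^ n * (L2nrm f)\<^sup>2" by blast
    define r where "r x = f x - (\<Sum>j\<in>A. c j * F j x)" for x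
    have "L2fun r" unfolding r_def using A F by (intro L2fun_diff L2fun_lincomb f) auto
    from step[OF this] obtain A' c' where A': "finite A'" "A' \<subseteq> I"
      and le': "(L2nrm (\<lambda>x. r x - (\<Sum>j\<in>A'. c' j * F j x)))\<^sup>2 \<le> q * (L2nrm r)\<^sup>2" by blast
    define d where "d j = (if j \<in> A then c j else 0) + (if j \<in> A' then c' j else 0)" for j
    have "(\<Sum>j\<in>A \<union> A'. d j * F j x) = (\<Sum>j\<in>A. c j * F j x) + (\<Sum>j\<in>A'. c' j * F j x)" for x
    proof -
      have "(\<Sum>j\<in>A \<union> A'. d j * F j x) = (\<Sum>j\<in>A \<union> A'. (if j \<in> A then c j * F j x else 0))
          + (\<Sum>j\<in>A \<union> A'. (if j \<in> A' then c' j * F j x else 0))"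
        unfolding sum.distrib[symmetric] by (intro sum.cong refl) (auto simp: d_def distrib_right)
      then show ?thesis using A A' by (simp add: sum.If_cases Int_absorb1)
    qed
    then have "(\<lambda>x. f x - (\<Sum>j\<in>A \<union> A'. d j * F j x)) = (\<lambda>x. r x - (\<Sum>j\<in>A'. c' j * F j x))"
      by (simp add: r_def fun_eq_iff)
    moreover have "q * (L2nrm r)\<^sup>2 \<le> q * (q ^ n * (L2nrm f)\<^sup>2)"
      using le q by (intro mult_left_mono) (auto simp: r_def[abs_def])
    ultimately have "(L2nrm (\<lambda>x. f x - (\<Sum>j\<in>A \<union> A'. d j * F j x)))\<^sup>2 \<le> q ^ Suc n * (L2nrm f)\<^sup>2"
      using le' by (simp add: mult.assoc)
    then show ?case using A A' by (intro exI[of _ "A \<union> A'"] exI[of _ d]) auto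
  qed
  show ?thesis unfolding dense_span_def
  proof (intro allI impI)
    fix f :: "real ^ 'b \<Rightarrow> complex" and e :: real assume f: "L2fun f" and e: "0 < e"
    have "(\<lambda>n. q ^ n * (L2nrm f)\<^sup>2) \<longlonglongrightarrow> 0"
      using q by (intro tendsto_mult_left_zero LIMSEQ_realpow_zero)
    then have "\<forall>\<^sub>F n in sequentially. q ^ n * (L2nrm f)\<^sup>2 < e\<^sup>2"
      using e by (intro order_tendstoD(2)) auto
    then obtain n where n: "q ^ n * (L2nrm f)\<^sup>2 < e\<^sup>2" by (auto simp: eventually_sequentially)
    from iter[OF f, of n] obtain A c where A: "finite A" "A \<subseteq> I"
      "(L2nrm (\<lambda>x. f x - (\<Sum>j\<in>A. c j * F j x)))\<^sup>2 \<le> q ^ n * (L2nrm f)\<^sup>2" by blast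
    then have "L2nrm (\<lambda>x. f x - (\<Sum>j\<in>A. c j * F j x)) < e"
      using n e by (intro power2_less_imp_less[of _ e]) auto
    then show "\<exists>A c. finite A \<and> A \<subseteq> I \<and> L2nrm (\<lambda>x. f x - (\<Sum>j\<in>A. c j * F j x)) < e"
      using A(1,2) by (intro exI[of _ A] exI[of _ c] conjI)
  qed
qed

lemma riesz_basis_1_1_iff_orthonormal_basis:
  "is_riesz_basis I F 1 1 \<longleftrightarrow> is_orthonormal_basis I F"
proof
  assume R: "is_riesz_basis I F 1 1"
  then have F: "\<And>j. j \<in> I \<Longrightarrow> L2fun (F j)" and D: "dense_span I F"
    by (simp_all add: is_riesz_basis_def)
  have n: "(L2nrm (\<lambda>x. \<Sum>j\<in>A. c j * F j x))\<^sup>2 = (\<Sum>j\<in>A. (cmod (c j))\<^sup>2)"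
    if "finite A" "A \<subseteq> I" for A c
    using R that by (intro order_antisym) (simp_all add: is_riesz_basis_def)
  have n1: "(L2nrm (F j))\<^sup>2 = 1" if "j \<in> I" for j
    using n[of "{j}" "\<lambda>_. 1"] that by simp
  have orth: "L2ip (F i) (F j) = 0" if ij: "i \<in> I" "j \<in> I" "i \<noteq> j" for i j
  proof -
    have "Re (cnj z * L2ip (F i) (F j)) = 0" for z
    proof -
      have "(L2nrm (\<lambda>x. F i x + z * F j x))\<^sup>2 = 1 + (cmod z)\<^sup>2"
        using n[of "{i, j}" "\<lambda>k. if k = i then 1 else z"] ij by simp
      moreover have "(L2nrm (\<lambda>x. z * F j x))\<^sup>2 = (cmod z)\<^sup>2"
        using n1[of j] ij by (simp add: L2nrm_cmult power_mult_distrib)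
      ultimately show ?thesis
        using L2nrm_add_sq[OF F[of i] L2fun_cmult[OF F[of j], of z]] n1[of i] ij
        by (simp add: L2ip_cmult_right)
    qed
    from this[of 1] this[of \<i>] show ?thesis by (simp add: complex_eq_iff)
  qed
  have "L2ip (F i) (F j) = (if i = j then 1 else 0)" if "i \<in> I" "j \<in> I" for i j
    using that orth[of i j] n1[of i] by (cases "i = j") (auto simp: L2ip_self)
  then show "is_orthonormal_basis I F" using F D by (simp add: is_orthonormal_basis_def)
next
  assume O: "is_orthonormal_basis I F"
  then interpret orthonormal_family I F
    by unfold_locales (auto simp: is_orthonormal_basis_def)
  show "is_riesz_basis I F 1 1"
    using O by (auto simp: is_riesz_basis_def is_orthonormal_basis_def nrm_lincomb)
qed

section \<open>The Gram matrix of the Wilson system\<close>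

lemma AE_transl:
  assumes "AE x in lebesgue. f x = h x"
  shows "AE x in lebesgue. transl l f x = transl l h x"
  using AE_distrD[OF lebesgue_measurable_plus[of "- l"], unfolded lebesgue_distr_plus, OF assms]
  by (simp add: transl_def)

lemma AE_tf_shift:
  assumes "AE x in lebesgue. f x = h x"
  shows "AE x in lebesgue. tf_shift k f x = tf_shift k h x"
  unfolding tf_shift_def by (rule AE_transl) (use assms in eventually_elim, simp add: modul_def)

lemma AE_half_shift:
  assumes "AE x in lebesgue. f x = h x"
  shows "AE x in lebesgue. half_shift f x = half_shift h x"
  unfolding half_shift_def by (rule AE_transl[OF assms])

locale hermitian_window =
  fixes g :: "real ^ 'd \<Rightarrow> complex"
  assumes g: "L2fun g" and herm: "AE x in lebesgue. reflect g x = g x"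
begin

abbreviation g' :: "real ^ 'd \<Rightarrow> complex" where "g' \<equiv> half_shift g"

lemma g': "L2fun g'" by (intro L2fun_half_shift g)

lemma ip_reflect_tf: 
  assumes h: "L2fun h"
  shows "L2ip (tf_shift (flip k) g) h = L2ip (reflect h) (tf_shift (- k) g)"
proof -
  have "L2ip (tf_shift (flip k) g) h = L2ip (reflect h) (tf_shift (- k) (reflect g))"
    using L2ip_reflect[OF h L2fun_tf_shift[OF g, of "flip k"]] by (simp add: reflect_tf_shift)
  also have "\<dots> = L2ip (reflect h) (tf_shift (- k) g)"
    using h g by (intro L2ip_cong_AE AE_tf_shift herm L2fun_reflect L2fun_tf_shift) auto
  finally show ?thesis .
qed

lemma ip_reflect_tf':
  assumes h: "L2fun h"
  shows "L2ip (tf_shift (flip k) g') h = L2ip (reflect h) (tf_shift (- k - one_shift) g')"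
proof -
  have "L2ip (tf_shift (flip k) g') h = L2ip (reflect h) (tf_shift (- k - one_shift) (half_shift (reflect g)))"
    using L2ip_reflect[OF h L2fun_tf_shift[OF g', of "flip k"]]
    by (simp add: reflect_tf_shift reflect_half_shift tf_shift_add)
  also have "\<dots> = L2ip (reflect h) (tf_shift (- k - one_shift) g')"
    using h g by (intro L2ip_cong_AE AE_tf_shift AE_half_shift herm L2fun_reflect L2fun_half_shift L2fun_tf_shift) auto
  finally show ?thesis .
qed

text \<open>The ambiguity functions below are sampled on the integer lattice. Their symmetries under
  \<open>flip\<close> are the form in which the reality of the Fourier transform enters the Gram matrix.\<close>

lemma ip_g_flip: "L2ip (tf_shift (flip m) g) g = L2ip (tf_shift m g) g"
proof -
  have "L2ip (tf_shift (flip m) g) g = L2ip (reflect g) (tf_shift (- m) g)"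
    by (rule ip_reflect_tf[OF g])
  also have "\<dots> = L2ip g (tf_shift (- m) g)"
    using g by (intro L2ip_cong_AE herm L2fun_reflect L2fun_tf_shift) auto
  also have "\<dots> = L2ip (tf_shift m g) g"
    using L2ip_tf_shift_diff[OF g g, of 0 "- m"] by simp
  finally show ?thesis .
qed

lemma ip_g'_g': "L2ip (tf_shift m g') g' = sgn_of m * L2ip (tf_shift m g) g"
proof -
  have "L2ip (tf_shift m g) g = L2ip (half_shift (tf_shift m g)) g'"
    using g by (simp add: L2ip_half_shift L2fun_tf_shift)
  also have "\<dots> = sgn_of m * L2ip (tf_shift m g') g'"
    by (simp add: half_shift_tf L2ip_cmult_left)
  finally show ?thesis by simp
qed

lemma ip_g_g'_flip: "L2ip (tf_shift (flip m) g) g' = sgn_of m * L2ip (tf_shift m g) g'"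
proof -
  have a: "L2ip (tf_shift (one_shift - flip k) g) g' = cnj (L2ip (tf_shift k g) g')" for k
  proof -
    have "cnj (L2ip (tf_shift k g) g') = cnj (L2ip (reflect g') (tf_shift (- flip k) g))"
      unfolding ip_reflect_tf[OF g', of "flip k", unfolded flip_flip] ..
    also have "\<dots> = L2ip (tf_shift (- flip k) g) (tf_shift (- one_shift) (half_shift (reflect g)))"
      unfolding cnj_L2ip reflect_half_shift ..
    also have "\<dots> = L2ip (tf_shift (- flip k) g) (tf_shift (- one_shift) g')"
      using g by (intro L2ip_cong_AE AE_tf_shift AE_half_shift herm L2fun_reflect L2fun_half_shift L2fun_tf_shift) auto
    also have "\<dots> = L2ip (tf_shift (one_shift - flip k) g) g'"
      using L2ip_tf_shift_diff[OF g g', of "- flip k" "- one_shift"] by simp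
    finally show ?thesis ..
  qed
  have b: "L2ip (tf_shift k g) g' = sgn_of k * cnj (L2ip (tf_shift (one_shift - k) g) g')" for k
  proof -
    have "L2ip (tf_shift k g) g' = L2ip (half_shift (tf_shift k g)) (half_shift g')"
      by (rule L2ip_half_shift[symmetric, OF L2fun_tf_shift[OF g] g'])
    then have "L2ip (tf_shift k g) g' = sgn_of k * L2ip (tf_shift k g') (tf_shift one_shift g)"
      unfolding half_shift_tf[of k g] half_shift_half_shift[of g]
      using L2ip_cmult_left[of "sgn_of k" "tf_shift k g'" "tf_shift one_shift g"] by (rule trans)
    also have "L2ip (tf_shift k g') (tf_shift one_shift g) = L2ip (tf_shift 0 g') (tf_shift (one_shift - k) g)"
      unfolding L2ip_tf_shift_diff[OF g' g] by simp
    also have "\<dots> = cnj (L2ip (tf_shift (one_shift - k) g) g')"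
      by (simp only: tf_shift_zero cnj_L2ip)
    finally show ?thesis .
  qed
  have "L2ip (tf_shift (flip m) g) g' = sgn_of (flip m) * cnj (cnj (L2ip (tf_shift m g) g'))"
    by (subst b) (simp only: a)
  then show ?thesis by (simp only: sgn_of_flip complex_cnj_cnj)
qed

end

text \<open>Every element of the Wilson system is a multiple of a sum over an orbit of \<open>flip\<close>, of the same
  shape for all three families; for \<open>snd k = 0\<close> the two summands agree. In the last family the window
  is the half shift of \<open>g\<close>, and moving the half shift past the modulation produces the sign in the
  weight.\<close>

fun base_idx :: "('d::finite) wilson_idx \<Rightarrow> (int ^ 'd) \<times> (int ^ 'd)" where
  "base_idx (Inl l) = (l, 0)"
| "base_idx (Inr (Inl p)) = p"
| "base_idx (Inr (Inr p)) = p"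

fun is_odd :: "('d::finite) wilson_idx \<Rightarrow> bool" where
  "is_odd (Inl l) = False"
| "is_odd (Inr (Inl p)) = False"
| "is_odd (Inr (Inr p)) = True"

fun weight :: "('d::finite) wilson_idx \<Rightarrow> complex" where
  "weight (Inl l) = 1 / 2"
| "weight (Inr (Inl p)) = of_real (1 / sqrt 2)"
| "weight (Inr (Inr p)) = sgn_of p * of_real (1 / sqrt 2)"

definition twist :: "('d::finite) wilson_idx \<Rightarrow> complex" where
  "twist j = (if is_odd j then - 1 else 1) * sgn_of (base_idx j)"

definition orbit_sum :: "('d::finite) wilson_idx \<Rightarrow> (real ^ 'd \<Rightarrow> complex) \<Rightarrow> real ^ 'd \<Rightarrow> complex" where
  "orbit_sum j f = (\<lambda>x. weight j * (tf_shift (base_idx j) f x + twist j * tf_shift (flip (base_idx j)) f x))"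

lemma cnj_weight [simp]: "cnj (weight j) = weight j"
  by (cases j rule: weight.cases) auto

lemma cnj_twist [simp]: "cnj (twist j) = twist j"
  by (simp add: twist_def)

lemma L2fun_orbit_sum: "L2fun f \<Longrightarrow> L2fun (orbit_sum j f)"
  unfolding orbit_sum_def by (intro L2fun_cmult L2fun_add L2fun_tf_shift)

lemma L2ip_two_terms:
  assumes "L2fun a" "L2fun b" "L2fun c" "L2fun d"
  shows "L2ip (\<lambda>x. p * (a x + s * b x)) (\<lambda>x. q * (c x + t * d x))
    = p * cnj q * (L2ip a c + cnj t * L2ip a d + s * L2ip b c + s * cnj t * L2ip b d)"
proof -
  have r: "L2ip f (\<lambda>x. c x + t * d x) = L2ip f c + cnj t * L2ip f d" if "L2fun f" for f
    unfolding L2ip_add_right[OF assms(3) L2fun_cmult[OF assms(4)] that] L2ip_cmult_right ..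
  have cd: "L2fun (\<lambda>x. c x + t * d x)" by (intro L2fun_add L2fun_cmult assms)
  have "L2ip (\<lambda>x. a x + s * b x) (\<lambda>x. c x + t * d x)
      = L2ip a (\<lambda>x. c x + t * d x) + s * L2ip b (\<lambda>x. c x + t * d x)"
    unfolding L2ip_add_left[OF assms(1) L2fun_cmult[OF assms(2)] cd] L2ip_cmult_left ..
  also have "\<dots> = L2ip a c + cnj t * L2ip a d + s * L2ip b c + s * cnj t * L2ip b d"
    unfolding r[OF assms(1)] r[OF assms(2)] by (simp add: distrib_left mult.assoc)
  finally have e: "L2ip (\<lambda>x. a x + s * b x) (\<lambda>x. c x + t * d x)
      = L2ip a c + cnj t * L2ip a d + s * L2ip b c + s * cnj t * L2ip b d" .
  show ?thesis
    unfolding L2ip_cmult_left[where f="\<lambda>x. a x + s * b x"]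
      L2ip_cmult_right[where f="\<lambda>x. c x + t * d x"] e by (simp only: mult.assoc)
qed

lemma L2ip_orbit_sum:
  assumes f: "L2fun f" and h: "L2fun h"
  shows "L2ip (orbit_sum i f) (orbit_sum j h) = weight i * weight j *
    (L2ip (tf_shift (base_idx i - base_idx j) f) h
     + twist j * L2ip (tf_shift (base_idx i - flip (base_idx j)) f) h
     + twist i * L2ip (tf_shift (flip (base_idx i) - base_idx j) f) h
     + twist i * twist j * L2ip (tf_shift (flip (base_idx i) - flip (base_idx j)) f) h)"
  unfolding orbit_sum_def
    L2ip_two_terms[OF L2fun_tf_shift[OF f] L2fun_tf_shift[OF f] L2fun_tf_shift[OF h] L2fun_tf_shift[OF h]]
    cnj_weight cnj_twist L2ip_tf_shift_diff[OF f h] ..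

lemma wilson_eq_orbit_sum: "wilson g j = orbit_sum j (if is_odd j then half_shift g else g)"
proof (cases j rule: weight.cases)
  case (1 l)
  have "flip (l, 0) = (l, 0)" "sgn_of (l, 0) = 1"
    by (simp_all add: flip_def sgn_of_def sgn_vec_def)
  then show ?thesis
    by (simp add: 1 orbit_sum_def twist_def tf_shift_def ivec_zero modul_zero fun_eq_iff)
next
  case (2 p)
  then show ?thesis
    by (cases p) (simp add: orbit_sum_def twist_def tf_shift_def transl_def flip_def sgn_of_def ivec_minus fun_eq_iff)
next
  case (3 p)
  define c where "c = complex_of_real (1 / sqrt 2)"
  have h: "tf_shift k (half_shift g) x = sgn_of k * half_shift (tf_shift k g) x" for k x
    by (simp add: half_shift_tf)
  have "wilson g j x = c * (half_shift (tf_shift p g) x - sgn_of p * half_shift (tf_shift (flip p) g) x)" for x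
    by (cases p) (simp add: 3 c_def half_shift_def tf_shift_def transl_def flip_def sgn_of_def ivec_minus
        algebra_simps)
  moreover have "orbit_sum j (half_shift g) x
      = c * (half_shift (tf_shift p g) x - sgn_of p * half_shift (tf_shift (flip p) g) x)" for x
    by (simp add: 3 orbit_sum_def twist_def h c_def right_diff_distrib mult_ac)
  ultimately show ?thesis using 3 by auto
qed

lemma L2fun_wilson: "L2fun g \<Longrightarrow> L2fun (wilson g j)"
  by (simp add: wilson_eq_orbit_sum L2fun_orbit_sum L2fun_half_shift)

context hermitian_window
begin

text \<open>If one index is odd and the other is not, the left side vanishes because \<open>flip\<close> multiplies the
  cross ambiguity function of \<open>g\<close> and its half shift by the sign \<open>sgn_of\<close>, and the two summands on the
  right add up to \<open>0\<close>. Otherwise the summands on the right are equal, or the entry is \<open>0\<close>.\<close>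

lemma wilson_gram:
  "L2ip (wilson g i) (wilson g j)
    = (L2ip (orbit_sum i g) (orbit_sum j g) + L2ip (orbit_sum i g') (orbit_sum j g')) / 2"
proof -
  define k l where "k = base_idx i" and "l = base_idx j"
  have fl: "flip k - l = flip (k - flip l)" "flip k - flip l = flip (k - l)"
    by (simp_all add: flip_diff)
  have s: "sgn_of k = 1 \<or> sgn_of k = - 1" "sgn_of l = 1 \<or> sgn_of l = - 1"
    by (rule sgn_of_cases)+
  have even: "L2ip (orbit_sum i g) (orbit_sum j g) = weight i * weight j *
      ((1 + twist i * twist j) * L2ip (tf_shift (k - l) g) g
       + (twist i + twist j) * L2ip (tf_shift (k - flip l) g) g)"
    unfolding L2ip_orbit_sum[OF g g] k_def[symmetric] l_def[symmetric] fl ip_g_flip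
    by (simp add: algebra_simps)
  have odd: "L2ip (orbit_sum i g') (orbit_sum j g') = weight i * weight j * (sgn_of k * sgn_of l) *
      ((1 + twist i * twist j) * L2ip (tf_shift (k - l) g) g
       + (twist i + twist j) * L2ip (tf_shift (k - flip l) g) g)"
    unfolding L2ip_orbit_sum[OF g' g'] k_def[symmetric] l_def[symmetric] fl ip_g'_g'
    by (simp add: ip_g_flip sgn_of_diff algebra_simps)
  have mixed: "L2ip (orbit_sum i g) (orbit_sum j g') = weight i * weight j *
      ((1 + twist i * twist j * sgn_of k * sgn_of l) * L2ip (tf_shift (k - l) g) g'
       + (twist j + twist i * sgn_of k * sgn_of l) * L2ip (tf_shift (k - flip l) g) g')"
    unfolding L2ip_orbit_sum[OF g g'] k_def[symmetric] l_def[symmetric] fl ip_g_g'_flip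
    by (simp add: sgn_of_diff algebra_simps)
  have mixed': "L2ip (orbit_sum i g') (orbit_sum j g) = cnj (weight j * weight i *
      ((1 + twist j * twist i * sgn_of l * sgn_of k) * L2ip (tf_shift (l - k) g) g'
       + (twist i + twist j * sgn_of l * sgn_of k) * L2ip (tf_shift (l - flip k) g) g'))"
  proof -
    have fl': "flip l - k = flip (l - flip k)" "flip l - flip k = flip (l - k)"
      by (simp_all add: flip_diff)
    show ?thesis
      unfolding cnj_L2ip[of "orbit_sum j g" "orbit_sum i g'", symmetric]
        L2ip_orbit_sum[OF g g'] k_def[symmetric] l_def[symmetric] fl' ip_g_g'_flip
      by (simp add: sgn_of_diff algebra_simps)
  qed
  have tw: "twist i = (if is_odd i then - sgn_of k else sgn_of k)"
      "twist j = (if is_odd j then - sgn_of l else sgn_of l)"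
    by (simp_all add: twist_def k_def l_def)
  show ?thesis
    unfolding wilson_eq_orbit_sum
    by (cases "is_odd i"; cases "is_odd j")
       (use s in \<open>auto simp: even odd mixed mixed' tw\<close>)
qed

end

section \<open>Summation over the index sets\<close>

lemma has_sum_finite_sum:
  fixes F :: "'a \<Rightarrow> 'b \<Rightarrow> complex"
  assumes "\<And>i. i \<in> A \<Longrightarrow> (F i has_sum s i) I"
  shows "((\<lambda>x. \<Sum>i\<in>A. F i x) has_sum (\<Sum>i\<in>A. s i)) I"
  using assms
proof (induction A rule: infinite_finite_induct)
  case (insert a A)
  have "((\<lambda>x. F a x + (\<Sum>i\<in>A. F i x)) has_sum (s a + (\<Sum>i\<in>A. s i))) I"
    by (intro has_sum_add insert.IH insert.prems) auto
  then show ?case using insert.hyps by simp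
qed simp_all

lemma has_sum_neg_reindex:
  fixes f :: "'a::ab_group_add \<Rightarrow> complex"
  shows "((\<lambda>k. f (- k)) has_sum s) UNIV \<longleftrightarrow> (f has_sum s) UNIV"
  by (rule has_sum_reindex_bij_betw[OF bij_betw_byWitness[where f'=uminus]]) auto

lemma has_sum_flip_reindex:
  fixes f :: "(int ^ 'd) \<times> (int ^ 'd) \<Rightarrow> complex"
  shows "((\<lambda>k. f (flip k)) has_sum s) UNIV \<longleftrightarrow> (f has_sum s) UNIV"
  by (rule has_sum_reindex_bij_betw[OF bij_betw_byWitness[where f'=flip]]) auto

lemma inj_ivec: "ivec m = ivec n \<longleftrightarrow> m = n"
  by (simp add: ivec_def vec_eq_iff)

lemma half_plus_ivec_neq: "half + ivec m \<noteq> (ivec n :: real ^ 'd)"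
proof
  fix i :: 'd
  assume "half + ivec m = (ivec n :: real ^ 'd)"
  then have "(half + ivec m :: real ^ 'd) $ i = ivec n $ i" by simp
  then have "1 / 2 = real_of_int (n $ i - m $ i)" by (simp add: half_def ivec_def)
  then have "real_of_int (2 * (n $ i - m $ i)) = real_of_int 1" by simp
  then have "2 * (n $ i - m $ i) = 1" by (simp only: of_int_eq_iff)
  then show False by presburger
qed

definition gabor_int :: "(int ^ 'd) \<times> (int ^ 'd) \<Rightarrow> (real ^ 'd) \<times> (int ^ 'd)" where
  "gabor_int k = (ivec (fst k), snd k)"

definition gabor_half :: "(int ^ 'd) \<times> (int ^ 'd) \<Rightarrow> (real ^ 'd) \<times> (int ^ 'd)" where
  "gabor_half k = (half + ivec (fst k), snd k)"

lemma gabor_index_eq: "gabor_index = range gabor_int \<union> range gabor_half"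
  by (auto simp: gabor_index_def gabor_int_def gabor_half_def image_iff)

lemma inj_gabor_int: "inj gabor_int" and inj_gabor_half: "inj gabor_half"
  by (auto simp: inj_def gabor_int_def gabor_half_def inj_ivec prod_eq_iff)

lemma disjoint_gabor: "range gabor_int \<inter> range gabor_half = {}"
  using half_plus_ivec_neq[symmetric] by (auto simp: gabor_int_def gabor_half_def)

lemma has_sum_gabor_index:
  fixes \<phi> :: "(real ^ 'd) \<times> (int ^ 'd) \<Rightarrow> 'a::topological_comm_monoid_add"
  assumes "((\<lambda>k. \<phi> (gabor_int k)) has_sum s) UNIV" "((\<lambda>k. \<phi> (gabor_half k)) has_sum t) UNIV"
  shows "(\<phi> has_sum (s + t)) gabor_index"
  unfolding gabor_index_eq
  using assms has_sum_reindex[OF inj_gabor_int, of \<phi> s] has_sum_reindex[OF inj_gabor_half, of \<phi> t]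
  by (intro has_sum_Un_disjoint disjoint_gabor) (simp_all add: o_def)

lemma gabor_gabor_int: "gabor g (gabor_int k) = tf_shift k g"
  by (simp add: gabor_int_def tf_shift_def)

lemma gabor_gabor_half: "gabor g (gabor_half k) = (\<lambda>x. sgn_of k * tf_shift k (half_shift g) x)"
proof -
  have "gabor g (gabor_half k) = half_shift (tf_shift k g)"
    by (simp add: gabor_half_def half_shift_def tf_shift_def transl_transl)
  then show ?thesis by (simp only: half_shift_tf)
qed

lemma L2fun_gabor: "L2fun g \<Longrightarrow> L2fun (gabor g j)"
  by (cases j) (simp add: L2fun_transl L2fun_modul)

lemma has_sum_Plus:
  fixes f :: "'b + 'c \<Rightarrow> 'a::topological_comm_monoid_add"
  assumes "((\<lambda>a. f (Inl a)) has_sum x) A" "((\<lambda>b. f (Inr b)) has_sum y) B"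
  shows "(f has_sum (x + y)) (A <+> B)"
  unfolding Plus_def
  using assms has_sum_reindex[of Inl A f x] has_sum_reindex[of Inr B f y]
  by (intro has_sum_Un_disjoint) (auto simp: o_def)

lemma has_sum_wilson_index:
  fixes \<phi> :: "('d::finite) wilson_idx \<Rightarrow> 'a::topological_comm_monoid_add"
  assumes "((\<lambda>l. \<phi> (Inl l)) has_sum r) UNIV"
    and "((\<lambda>p. \<phi> (Inr (Inl p))) has_sum s) (UNIV \<times> N)"
    and "((\<lambda>p. \<phi> (Inr (Inr p))) has_sum t) (UNIV \<times> N)"
  shows "(\<phi> has_sum (r + (s + t))) (wilson_index N)"
  unfolding wilson_index_def
  by (rule has_sum_Plus[OF assms(1) has_sum_Plus[OF assms(2,3)]])

text \<open>The set \<open>N\<close> selects one index from each orbit of \<open>flip\<close> with two elements; the indices with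
  frequency \<open>0\<close> are the fixed points.\<close>

lemma has_sum_flip_orbits:
  fixes \<phi> :: "(int ^ 'd) \<times> (int ^ 'd) \<Rightarrow> complex"
  assumes \<phi>: "(\<phi> has_sum s) UNIV" and inv: "\<And>k. \<phi> (flip k) = \<phi> k"
    and N: "N \<inter> uminus ` N = {}" "N \<union> uminus ` N \<union> {0} = UNIV"
  shows "\<exists>r t. ((\<lambda>l. \<phi> (l, 0)) has_sum r) UNIV \<and> (\<phi> has_sum t) (UNIV \<times> N) \<and> s = r + 2 * t"
proof -
  let ?Z = "(\<lambda>l. (l, 0)) ` (UNIV :: (int ^ 'd) set)"
  have N0: "0 \<notin> N" using N(1) by force
  have s: "\<phi> summable_on A" for A
    using \<phi> by (auto intro: summable_on_subset_banach dest: has_sum_imp_summable)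
  define r t where "r = infsum \<phi> ?Z" and "t = infsum \<phi> (UNIV \<times> N)"
  have r: "(\<phi> has_sum r) ?Z" and t: "(\<phi> has_sum t) (UNIV \<times> N)"
    unfolding r_def t_def by (intro has_sum_infsum s)+
  have inj: "inj_on flip A" for A :: "((int ^ 'd) \<times> (int ^ 'd)) set"
    by (rule inj_on_inverseI[of _ flip]) simp
  have t': "(\<phi> has_sum t) (flip ` (UNIV \<times> N))"
    using t has_sum_reindex[OF inj[of "UNIV \<times> N"], of \<phi> t] by (simp add: o_def inv)
  have fl: "flip ` (UNIV \<times> N) = UNIV \<times> uminus ` N"
    by (force simp: flip_def image_iff)
  have "(\<phi> has_sum (r + (t + t))) (?Z \<union> (UNIV \<times> N \<union> flip ` (UNIV \<times> N)))"
    using N N0 unfolding fl by (intro has_sum_Un_disjoint r t t'[unfolded fl]) auto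
  moreover have "?Z \<union> (UNIV \<times> N \<union> flip ` (UNIV \<times> N)) = UNIV"
    using N(2) unfolding fl by force
  ultimately have "s = r + (t + t)" using \<phi> has_sum_unique by metis
  moreover have "((\<lambda>l. \<phi> (l, 0)) has_sum r) UNIV"
    using r has_sum_reindex[of "\<lambda>l. (l, 0)" UNIV \<phi> r] by (simp add: o_def inj_def)
  ultimately show ?thesis using t by (intro exI[of _ r] exI[of _ t]) simp
qed

section \<open>An orthonormal basis indexed by the Wilson system\<close>

lemma L2ip_orbit_sum_left:
  assumes "L2fun f" "L2fun v"
  shows "L2ip (orbit_sum j f) v
    = weight j * (L2ip (tf_shift (base_idx j) f) v + twist j * L2ip (tf_shift (flip (base_idx j)) f) v)"
proof -
  have c: "L2fun (\<lambda>x. twist j * tf_shift (flip (base_idx j)) f x)"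
    by (intro L2fun_cmult L2fun_tf_shift assms)
  show ?thesis
    unfolding orbit_sum_def L2ip_cmult_left[of "weight j"] L2ip_add_left[OF L2fun_tf_shift[OF assms(1)] c assms(2)]
      L2ip_cmult_left[of "twist j"] ..
qed

lemma L2ip_orbit_sum_right:
  assumes "L2fun f" "L2fun v"
  shows "L2ip v (orbit_sum j f)
    = weight j * (L2ip v (tf_shift (base_idx j) f) + twist j * L2ip v (tf_shift (flip (base_idx j)) f))"
  unfolding cnj_L2ip[of "orbit_sum j f" v, symmetric] L2ip_orbit_sum_left[OF assms]
  by (simp add: cnj_L2ip)

text \<open>For the cube all ambiguity values off the origin vanish, and two orbits with representatives in
  the index set of the Wilson system meet only if they have the same representative. Up to signs and
  normalization the two elements built on one orbit of size two are the sum and the difference of its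
  members.\<close>

lemma orbit_cube_basis:
  fixes N :: "(int ^ 'd) set"
  assumes N: "N \<inter> uminus ` N = {}" "N \<union> uminus ` N \<union> {0} = UNIV"
  shows "orthonormal_basis (wilson_index N) (\<lambda>j. orbit_sum j (cube :: real ^ 'd \<Rightarrow> complex))"
proof
  fix i j :: "'d wilson_idx"
  show "L2fun (orbit_sum i (cube :: real ^ 'd \<Rightarrow> complex))" by (intro L2fun_orbit_sum L2fun_cube)
  assume i: "i \<in> wilson_index N" and j: "j \<in> wilson_index N"
  have N0: "0 \<notin> N" and Nm: "\<And>a b. a \<in> N \<Longrightarrow> b \<in> N \<Longrightarrow> a \<noteq> - b"
    using N(1) by force+
  have two: "complex_of_real (sqrt 2) * complex_of_real (sqrt 2) = 2"
    by (simp flip: of_real_mult)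
  have e: "L2ip (orbit_sum i cube) (orbit_sum j (cube :: real ^ 'd \<Rightarrow> complex)) = weight i * weight j *
    ((if base_idx i = base_idx j then 1 else 0)
     + twist j * (if base_idx i = flip (base_idx j) then 1 else 0)
     + twist i * (if flip (base_idx i) = base_idx j then 1 else 0)
     + twist i * twist j * (if flip (base_idx i) = flip (base_idx j) then 1 else 0))"
    unfolding L2ip_orbit_sum[OF L2fun_cube L2fun_cube] ip_cube by simp
  have s0: "sgn_of (l, 0) = 1" for l :: "int ^ 'd" by (simp add: sgn_of_def sgn_vec_def)
  show "L2ip (orbit_sum i cube) (orbit_sum j (cube :: real ^ 'd \<Rightarrow> complex)) = (if i = j then 1 else 0)"
  proof -
    let ?k = "base_idx i" and ?l = "base_idx j"
    have ff: "flip ?k = flip ?l \<longleftrightarrow> ?k = ?l" "?k = flip ?l \<longleftrightarrow> flip ?k = ?l"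
      by (metis flip_flip)+
    have pos: "snd (base_idx i) = 0 \<and> i = Inl (fst (base_idx i)) \<or> snd (base_idx i) \<in> N \<and> i \<in> range Inr"
      if "i \<in> wilson_index N" for i :: "'d wilson_idx"
      using that by (cases i rule: weight.cases) (auto simp: wilson_index_def)
    show ?thesis
    proof (cases "snd ?k = 0 \<or> snd ?l = 0")
      case True
      then have self: "flip ?k = ?k \<or> flip ?l = ?l" by (auto simp: flip_def prod_eq_iff)
      show ?thesis
      proof (cases "?k = ?l")
        case True
        with \<open>snd ?k = 0 \<or> snd ?l = 0\<close> obtain l where ij: "i = Inl l" "j = Inl l"
          using pos[OF i] pos[OF j] N0 by metis
        show ?thesis unfolding e by (simp add: ij twist_def flip_def s0)
      next
        case False
        then have "flip ?k \<noteq> ?l" "?k \<noteq> flip ?l" using self ff by metis+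
        then show ?thesis unfolding e using False ff by auto
      qed
    next
      case False
      then have N': "snd ?k \<in> N" "snd ?l \<in> N" using pos[OF i] pos[OF j] by auto
      then have ne: "flip ?k \<noteq> ?l" 
        using Nm[of "snd ?l" "snd ?k"] by (metis flip_def snd_conv)
      have "weight i * weight j * ((if ?k = ?l then 1 else 0) * (1 + twist i * twist j)) = (if i = j then 1 else 0)"
      proof (cases "?k = ?l")
        case True
        then have s: "sgn_of ?k * sgn_of ?l = 1" by simp
        obtain i' j' where "i = Inr i'" "j = Inr j'"
          using pos[OF i] pos[OF j] N' N0 by auto
        then show ?thesis
          using True s two by (cases i'; cases j') (auto simp: twist_def field_simps)
      qed auto
      then show ?thesis unfolding e using ne ff by (simp add: algebra_simps)
    qed
  qed
next
  fix f :: "real ^ 'd \<Rightarrow> complex"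
  assume f: "L2fun f" and orth: "\<And>j. j \<in> wilson_index N \<Longrightarrow> L2ip f (orbit_sum j cube) = 0"
  let ?a = "\<lambda>k. L2ip f (tf_shift k cube)"
  have c: "weight j * (?a (base_idx j) + twist j * ?a (flip (base_idx j))) = 0" if "j \<in> wilson_index N" for j
    using orth[OF that] L2ip_orbit_sum_right[OF L2fun_cube f, of j] by simp
  have z: "?a (l, 0) = 0" for l
  proof -
    have "Inl l \<in> wilson_index N" by (auto simp: wilson_index_def)
    from c[OF this] show ?thesis by (simp add: twist_def flip_def sgn_of_def sgn_vec_def)
  qed
  have p: "?a p = 0 \<and> ?a (flip p) = 0" if "snd p \<in> N" for p
  proof -
    have m: "Inr (Inl p) \<in> wilson_index N" "Inr (Inr p) \<in> wilson_index N"
      using that by (cases p, auto simp: wilson_index_def)+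
    have "?a p + sgn_of p * ?a (flip p) = 0"
      using c[OF m(1)] by (simp add: twist_def)
    moreover have "?a p - sgn_of p * ?a (flip p) = 0"
      using c[OF m(2)] sgn_of_cases[of p] by (auto simp: twist_def)
    ultimately have "?a p = 0" "sgn_of p * ?a (flip p) = 0" by (auto simp: complex_eq_iff)
    then show ?thesis using sgn_of_cases[of p] by auto
  qed
  have "?a k = 0" for k
  proof -
    have "snd k \<in> N \<or> - snd k \<in> N \<or> snd k = 0" using N(2) by force
    then show ?thesis
      using p[of k] p[of "flip k"] z[of "fst k"] by (cases k) (auto simp: flip_def)
  qed
  then show "L2nrm f = 0" by (intro cube_basis.total f) simp
qed

section \<open>The Gabor system and the Riesz inequalities\<close>

text \<open>The analysis of a shift of the cube with the window \<open>g\<close> and the analysis of a shift of \<open>g\<close> with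
  the cube give the same coefficients, conjugated and in reverse order. The second analysis is an
  isometry by Parseval's identity.\<close>

lemma cube_shift_form:
  assumes g: "L2fun g"
  shows "((\<lambda>k. L2ip (tf_shift l cube) (tf_shift k g) * cnj (L2ip (tf_shift m cube) (tf_shift k g)))
    has_sum L2ip (tf_shift l g) (tf_shift m g)) UNIV"
proof -
  have "((\<lambda>j. L2ip (tf_shift l g) (tf_shift j cube) * cnj (L2ip (tf_shift m g) (tf_shift j cube)))
      has_sum L2ip (tf_shift l g) (tf_shift m g)) UNIV"
    by (intro cube_basis.parseval L2fun_tf_shift g)
  moreover have "L2ip (tf_shift l g) (tf_shift (l + m - k) cube) = cnj (L2ip (tf_shift m cube) (tf_shift k g))" for k
    unfolding cnj_L2ip L2ip_tf_shift_diff[OF g L2fun_cube] by simp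
  moreover have "cnj (L2ip (tf_shift m g) (tf_shift (l + m - k) cube)) = L2ip (tf_shift l cube) (tf_shift k g)" for k
    unfolding cnj_L2ip L2ip_tf_shift_diff[OF L2fun_cube g] by simp
  moreover have "bij_betw (\<lambda>k. l + m - k) UNIV UNIV"
    by (rule bij_betw_byWitness[where f'="\<lambda>k. l + m - k"]) auto
  ultimately show ?thesis
    using has_sum_reindex_bij_betw[of "\<lambda>k. l + m - k" UNIV UNIV
        "\<lambda>j. L2ip (tf_shift l g) (tf_shift j cube) * cnj (L2ip (tf_shift m g) (tf_shift j cube))"
        "L2ip (tf_shift l g) (tf_shift m g)"]
    by (simp add: mult.commute)
qed

text \<open>Both sides are sesquilinear in the orbits, so the form passes from single shifts to orbit sums.\<close>

lemma orbit_cube_form: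
  assumes g: "L2fun g"
  shows "((\<lambda>k. L2ip (orbit_sum i cube) (tf_shift k g) * cnj (L2ip (orbit_sum j cube) (tf_shift k g)))
    has_sum L2ip (orbit_sum i g) (orbit_sum j g)) UNIV"
proof -
  let ?P = "\<lambda>l m k. L2ip (tf_shift l cube) (tf_shift k g) * cnj (L2ip (tf_shift m cube) (tf_shift k g))"
  let ?k = "base_idx i" and ?l = "base_idx j"
  have "((\<lambda>k. weight i * weight j * (?P ?k ?l k + twist j * ?P ?k (flip ?l) k + twist i * ?P (flip ?k) ?l k
        + twist i * twist j * ?P (flip ?k) (flip ?l) k)) has_sum
      weight i * weight j * (L2ip (tf_shift ?k g) (tf_shift ?l g)
        + twist j * L2ip (tf_shift ?k g) (tf_shift (flip ?l) g)
        + twist i * L2ip (tf_shift (flip ?k) g) (tf_shift ?l g)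
        + twist i * twist j * L2ip (tf_shift (flip ?k) g) (tf_shift (flip ?l) g))) UNIV"
    by (intro has_sum_cmult_right has_sum_add cube_shift_form g)
  moreover have "L2ip (orbit_sum i cube) (tf_shift k g) * cnj (L2ip (orbit_sum j cube) (tf_shift k g))
      = weight i * weight j * (?P ?k ?l k + twist j * ?P ?k (flip ?l) k + twist i * ?P (flip ?k) ?l k
        + twist i * twist j * ?P (flip ?k) (flip ?l) k)" for k
    unfolding L2ip_orbit_sum_left[OF L2fun_cube L2fun_tf_shift[OF g]]
    by (simp only: complex_cnj_mult complex_cnj_add cnj_weight cnj_twist) (simp only: algebra_simps)
  moreover have "L2ip (orbit_sum i g) (orbit_sum j g)
      = weight i * weight j * (L2ip (tf_shift ?k g) (tf_shift ?l g)
        + twist j * L2ip (tf_shift ?k g) (tf_shift (flip ?l) g)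
        + twist i * L2ip (tf_shift (flip ?k) g) (tf_shift ?l g)
        + twist i * twist j * L2ip (tf_shift (flip ?k) g) (tf_shift (flip ?l) g))"
    unfolding orbit_sum_def L2ip_two_terms[OF L2fun_tf_shift[OF g] L2fun_tf_shift[OF g] L2fun_tf_shift[OF g] L2fun_tf_shift[OF g]]
      cnj_weight cnj_twist ..
  ultimately show ?thesis by simp
qed

lemma L2nrm_lincomb_sq:
  assumes "\<And>j. j \<in> A \<Longrightarrow> L2fun (F j)"
  shows "of_real ((L2nrm (\<lambda>x. \<Sum>j\<in>A. c j * F j x))\<^sup>2)
    = (\<Sum>i\<in>A. \<Sum>j\<in>A. c i * cnj (c j) * L2ip (F i) (F j))"
proof -
  let ?h = "\<lambda>x. \<Sum>j\<in>A. c j * F j x"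
  have "L2ip ?h ?h = (\<Sum>i\<in>A. c i * L2ip (F i) ?h)"
    by (intro L2ip_lincomb_left L2fun_lincomb assms)
  also have "\<dots> = (\<Sum>i\<in>A. c i * (\<Sum>j\<in>A. cnj (c j) * L2ip (F i) (F j)))"
    by (intro sum.cong refl arg_cong2[where f="(*)"] L2ip_lincomb_right assms)
  finally show ?thesis by (simp add: L2ip_self sum_distrib_left mult.assoc)
qed

lemma orbit_cube_lincomb_form:
  assumes g: "L2fun g"
  shows "((\<lambda>k. (cmod (L2ip (\<lambda>x. \<Sum>j\<in>A. c j * orbit_sum j cube x) (tf_shift k g)))\<^sup>2)
    has_sum (L2nrm (\<lambda>x. \<Sum>j\<in>A. c j * orbit_sum j g x))\<^sup>2) UNIV"
proof -
  let ?a = "\<lambda>j k. L2ip (orbit_sum j cube) (tf_shift k g)"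
  have "((\<lambda>k. \<Sum>i\<in>A. \<Sum>j\<in>A. c i * cnj (c j) * (?a i k * cnj (?a j k))) has_sum
      (\<Sum>i\<in>A. \<Sum>j\<in>A. c i * cnj (c j) * L2ip (orbit_sum i g) (orbit_sum j g))) UNIV"
    by (intro has_sum_finite_sum has_sum_cmult_right orbit_cube_form g)
  also have "(\<Sum>i\<in>A. \<Sum>j\<in>A. c i * cnj (c j) * L2ip (orbit_sum i g) (orbit_sum j g))
      = of_real ((L2nrm (\<lambda>x. \<Sum>j\<in>A. c j * orbit_sum j g x))\<^sup>2)"
    by (rule L2nrm_lincomb_sq[symmetric]) (intro L2fun_orbit_sum g)
  also have "(\<lambda>k. \<Sum>i\<in>A. \<Sum>j\<in>A. c i * cnj (c j) * (?a i k * cnj (?a j k)))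
      = (\<lambda>k. (\<Sum>j\<in>A. c j * ?a j k) * cnj (\<Sum>j\<in>A. c j * ?a j k))"
    by (simp add: fun_eq_iff sum_product mult_ac)
  also have "(\<lambda>k. \<Sum>j\<in>A. c j * ?a j k) = (\<lambda>k. L2ip (\<lambda>x. \<Sum>j\<in>A. c j * orbit_sum j cube x) (tf_shift k g))"
    by (intro ext L2ip_lincomb_left[symmetric] L2fun_orbit_sum L2fun_tf_shift L2fun_cube g)
  finally show ?thesis unfolding has_sum_norm_sq .
qed

context hermitian_window
begin

text \<open>The Gabor coefficients split into those for \<open>g\<close> and those for its half shift; each part is the
  quadratic form of one of the two Gram matrices in \<open>wilson_gram\<close>.\<close>

lemma gabor_lincomb_energy:
  "((\<lambda>k. (cmod (L2ip (\<lambda>x. \<Sum>j\<in>A. c j * orbit_sum j cube x) (gabor g k)))\<^sup>2)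
    has_sum 2 * (L2nrm (\<lambda>x. \<Sum>j\<in>A. c j * wilson g j x))\<^sup>2) gabor_index"
proof -
  let ?f = "\<lambda>x. \<Sum>j\<in>A. c j * orbit_sum j cube x"
  have "((\<lambda>k. (cmod (L2ip ?f (gabor g k)))\<^sup>2) has_sum
      (L2nrm (\<lambda>x. \<Sum>j\<in>A. c j * orbit_sum j g x))\<^sup>2 + (L2nrm (\<lambda>x. \<Sum>j\<in>A. c j * orbit_sum j g' x))\<^sup>2) gabor_index"
    using orbit_cube_lincomb_form[OF g, where A=A and c=c] orbit_cube_lincomb_form[OF g', where A=A and c=c]
    by (intro has_sum_gabor_index)
       (simp_all add: gabor_gabor_int gabor_gabor_half L2ip_cmult_right norm_mult)
  moreover have "complex_of_real (2 * (L2nrm (\<lambda>x. \<Sum>j\<in>A. c j * wilson g j x))\<^sup>2)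
    = of_real ((L2nrm (\<lambda>x. \<Sum>j\<in>A. c j * orbit_sum j g x))\<^sup>2 + (L2nrm (\<lambda>x. \<Sum>j\<in>A. c j * orbit_sum j g' x))\<^sup>2)"
  proof -
    have "complex_of_real (2 * (L2nrm (\<lambda>x. \<Sum>j\<in>A. c j * wilson g j x))\<^sup>2)
        = 2 * (\<Sum>i\<in>A. \<Sum>j\<in>A. c i * cnj (c j) * L2ip (wilson g i) (wilson g j))"
      unfolding of_real_mult by (subst L2nrm_lincomb_sq) (simp_all add: L2fun_wilson g)
    also have "\<dots> = (\<Sum>i\<in>A. \<Sum>j\<in>A. c i * cnj (c j) * L2ip (orbit_sum i g) (orbit_sum j g))
        + (\<Sum>i\<in>A. \<Sum>j\<in>A. c i * cnj (c j) * L2ip (orbit_sum i g') (orbit_sum j g'))"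
      unfolding wilson_gram sum_distrib_left sum.distrib[symmetric]
      by (intro sum.cong refl) (simp add: distrib_left)
    also have "\<dots> = of_real ((L2nrm (\<lambda>x. \<Sum>j\<in>A. c j * orbit_sum j g x))\<^sup>2)
        + of_real ((L2nrm (\<lambda>x. \<Sum>j\<in>A. c j * orbit_sum j g' x))\<^sup>2)"
      by (subst (1 2) L2nrm_lincomb_sq) (simp_all add: L2fun_orbit_sum g g')
    finally show ?thesis by simp
  qed
  ultimately show ?thesis by (simp only: of_real_eq_iff)
qed

end

section \<open>The energy identity\<close>

lemma bessel_pairing:
  assumes B: "bessel_seq I F b" "0 \<le> b" and c: "(\<lambda>j. (cmod (c j))\<^sup>2) summable_on I"
  shows "\<exists>s. L2fun s \<and> (\<forall>f. L2fun f \<longrightarrow> ((\<lambda>j. L2ip f (F j) * cnj (c j)) has_sum L2ip f s) I)"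
proof -
  obtain s where s: "L2_has_sum (\<lambda>j x. c j * F j x) I s"
    using bessel_seq_has_sum[OF B c] by blast
  have "((\<lambda>j. L2ip f (F j) * cnj (c j)) has_sum L2ip f s) I" if f: "L2fun f" for f
  proof -
    have "((\<lambda>j. L2ip (\<lambda>x. c j * F j x) f) has_sum L2ip s f) I" by (rule L2_has_sum_ip[OF s f])
    then have "((\<lambda>j. cnj (L2ip (\<lambda>x. c j * F j x) f)) has_sum cnj (L2ip s f)) I" by simp
    then show ?thesis by (simp only: L2ip_cmult_left complex_cnj_mult cnj_L2ip mult.commute)
  qed
  then show ?thesis using s by (auto simp: L2_has_sum_def)
qed

text \<open>The paired sum below is symmetric in the two functions. For fixed \<open>f'\<close> both sides are inner
  products of \<open>f\<close> with a fixed function, so an identity for all shifts of the cube extends to all \<open>f\<close>;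
  this is applied in one variable and then in the other. For two shifts of the cube the two sums agree
  term by term after a translation of the index.\<close>

lemma paired_sum_symmetric:
  assumes B1: "bessel_seq UNIV (\<lambda>k. tf_shift k g) b" and B2: "bessel_seq UNIV (\<lambda>k. tf_shift k h) b"
    and b: "0 \<le> b" and f: "L2fun f" and f': "L2fun f'"
  shows "\<exists>z. ((\<lambda>k. L2ip f (tf_shift k g) * L2ip f' (tf_shift (- k) h)) has_sum z) UNIV \<and>
             ((\<lambda>k. L2ip f' (tf_shift k g) * L2ip f (tf_shift (- k) h)) has_sum z) UNIV"
    (is "?Q f f'")
proof -
  have "L2fun (tf_shift 0 g)" "L2fun (tf_shift 0 h)"
    using B1 B2 unfolding bessel_seq_def by blast+
  then have g: "L2fun g" and h: "L2fun h" by simp_all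
  have rep: "\<exists>s. L2fun s \<and> (\<forall>f. L2fun f \<longrightarrow>
      ((\<lambda>k. L2ip f (tf_shift k v) * L2ip f' (tf_shift (- k) w)) has_sum L2ip f s) UNIV)"
    if v: "bessel_seq UNIV (\<lambda>k. tf_shift k v) b" and w: "bessel_seq UNIV (\<lambda>k. tf_shift k w) b"
      and f': "L2fun f'" for v w f'
  proof -
    have "(\<lambda>k. (cmod (L2ip f' (tf_shift k w)))\<^sup>2) summable_on UNIV"
      using w f' by (simp add: bessel_seq_def)
    then have "(\<lambda>k. (cmod (L2ip f' (tf_shift (- k) w)))\<^sup>2) summable_on UNIV"
      by (subst summable_on_reindex_bij_betw[OF bij_betw_byWitness[where f'=uminus]]) auto
    then have "(\<lambda>k. (cmod (cnj (L2ip f' (tf_shift (- k) w))))\<^sup>2) summable_on UNIV" by simp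
    from bessel_pairing[OF v b this] show ?thesis by simp
  qed
  have swap: "?Q f' f" if "?Q f f'" for f f'
    using that by blast
  have extend: "?Q f f'" if f: "L2fun f" and f': "L2fun f'" and cubes: "\<And>p. ?Q (tf_shift p cube) f'" for f f'
  proof -
    obtain s where s: "L2fun s" "\<And>f. L2fun f \<Longrightarrow>
        ((\<lambda>k. L2ip f (tf_shift k g) * L2ip f' (tf_shift (- k) h)) has_sum L2ip f s) UNIV"
      using rep[OF B1 B2 f'] by blast
    obtain t where t: "L2fun t" "\<And>f. L2fun f \<Longrightarrow>
        ((\<lambda>k. L2ip f (tf_shift k h) * L2ip f' (tf_shift (- k) g)) has_sum L2ip f t) UNIV"
      using rep[OF B2 B1 f'] by blast
    have t': "((\<lambda>k. L2ip f' (tf_shift k g) * L2ip f (tf_shift (- k) h)) has_sum L2ip f t) UNIV"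
      if "L2fun f" for f
      using t(2)[OF that] has_sum_neg_reindex[of "\<lambda>k. L2ip f' (tf_shift k g) * L2ip f (tf_shift (- k) h)"]
      by (simp add: mult.commute)
    have "L2ip (tf_shift p cube) s = L2ip (tf_shift p cube) t" for p
      using cubes[of p] s(2)[OF L2fun_tf_shift[OF L2fun_cube, of p]] t'[OF L2fun_tf_shift[OF L2fun_cube, of p]]
      by (auto dest: has_sum_unique)
    then have "L2ip s (tf_shift p cube) = L2ip t (tf_shift p cube)" for p
      by (metis cnj_L2ip)
    then have "L2nrm (\<lambda>x. s x - t x) = 0"
      using s(1) t(1) by (intro cube_basis.total L2fun_diff) (simp_all add: L2ip_diff_left L2fun_tf_shift L2fun_cube)
    then have "L2ip f (\<lambda>x. s x - t x) = 0"
      using L2_Cauchy_Schwarz[OF f L2fun_diff[OF s(1) t(1)]] by simp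
    then have "L2ip f s = L2ip f t" using f s(1) t(1) by (simp add: L2ip_diff_right)
    then show ?thesis using s(2)[OF f] t'[OF f] by auto
  qed
  have base: "?Q (tf_shift p cube) (tf_shift q cube)" for p q
  proof -
    let ?u = "\<lambda>k. L2ip (tf_shift p cube) (tf_shift k g) * L2ip (tf_shift q cube) (tf_shift (- k) h)"
    let ?v = "\<lambda>k. L2ip (tf_shift q cube) (tf_shift k g) * L2ip (tf_shift p cube) (tf_shift (- k) h)"
    obtain z where z: "(?u has_sum z) UNIV"
      using rep[OF B1 B2 L2fun_tf_shift[OF L2fun_cube, of q]] L2fun_tf_shift[OF L2fun_cube, of p] by blast
    have "?v (k + (q - p)) = ?u k" for k
      unfolding L2ip_tf_shift_diff[OF L2fun_cube g] L2ip_tf_shift_diff[OF L2fun_cube h]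
      by (simp add: algebra_simps)
    moreover have "bij_betw (\<lambda>k. k + (q - p)) UNIV UNIV"
      by (rule bij_betw_byWitness[where f'="\<lambda>k. k - (q - p)"]) auto
    ultimately have "(?v has_sum z) UNIV"
      using z has_sum_reindex_bij_betw[of "\<lambda>k. k + (q - p)" UNIV UNIV ?v z] by simp
    then show ?thesis using z by blast
  qed
  have "?Q (tf_shift q cube) f" if "L2fun f" for f q
    by (rule swap, rule extend[OF that L2fun_tf_shift[OF L2fun_cube] base])
  then show ?thesis using extend[OF f f'] f' by blast
qed

lemma gabor_bessel_parts:
  assumes B: "bessel_seq gabor_index (gabor g) b" and g: "L2fun g"
  shows "bessel_seq UNIV (\<lambda>k. tf_shift k g) b" "bessel_seq UNIV (\<lambda>k. tf_shift k (half_shift g)) b"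
proof -
  have fin: "(\<Sum>k\<in>A. (cmod (L2ip f (gabor g (e k))))\<^sup>2) \<le> b * (L2nrm f)\<^sup>2"
    if f: "L2fun f" and A: "finite A" and e: "inj e" "range e \<subseteq> gabor_index" for f A and e :: "'c \<Rightarrow> _"
  proof -
    have "(\<Sum>k\<in>A. (cmod (L2ip f (gabor g (e k))))\<^sup>2) = (\<Sum>j\<in>e ` A. (cmod (L2ip f (gabor g j)))\<^sup>2)"
      using e(1) by (subst sum.reindex) (auto intro: inj_on_subset)
    also have "\<dots> \<le> (\<Sum>\<^sub>\<infinity>j\<in>gabor_index. (cmod (L2ip f (gabor g j)))\<^sup>2)"
      using B f A e(2) by (intro finite_sum_le_infsum) (auto simp: bessel_seq_def)
    also have "\<dots> \<le> b * (L2nrm f)\<^sup>2" using B f by (simp add: bessel_seq_def)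
    finally show ?thesis .
  qed
  show "bessel_seq UNIV (\<lambda>k. tf_shift k g) b"
    using fin[OF _ _ inj_gabor_int]
    by (intro bessel_seqI_finite L2fun_tf_shift g) (auto simp: gabor_index_eq gabor_gabor_int)
  show "bessel_seq UNIV (\<lambda>k. tf_shift k (half_shift g)) b"
    using fin[OF _ _ inj_gabor_half]
    by (intro bessel_seqI_finite L2fun_tf_shift L2fun_half_shift g)
       (auto simp: gabor_index_eq gabor_gabor_half L2ip_cmult_right norm_mult)
qed

context hermitian_window
begin

text \<open>Written over all of the lattice, the terms of the Wilson sum are the squares of the Gabor
  coefficients and mixed terms that couple \<open>k\<close> with \<open>flip k\<close>. Reflection turns the mixed terms of both
  parities into the two sides of the symmetric paired sum for \<open>f\<close> and the half shift of the reflection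
  of \<open>h\<close>; they enter with opposite signs.\<close>

lemma wilson_form_half_gabor_form:
  assumes N: "N \<inter> uminus ` N = {}" "N \<union> uminus ` N \<union> {0} = UNIV"
    and B: "bessel_seq gabor_index (gabor g) b" and b: "0 \<le> b" and f: "L2fun f" and h: "L2fun h"
  shows "\<exists>z. ((\<lambda>j. L2ip f (gabor g j) * cnj (L2ip h (gabor g j))) has_sum z) gabor_index \<and>
    ((\<lambda>j. L2ip f (wilson g j) * cnj (L2ip h (wilson g j))) has_sum z / 2) (wilson_index N)"
proof -
  note B1 = gabor_bessel_parts(1)[OF B g] and B2 = gabor_bessel_parts(2)[OF B g]
  define a a' c c' where "a k = L2ip f (tf_shift k g)" and "a' k = L2ip h (tf_shift k g)"
    and "c k = L2ip f (tf_shift k g')" and "c' k = L2ip h (tf_shift k g')" for k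
  define x where "x = half_shift (reflect h)"
  have x: "L2fun x" unfolding x_def by (intro L2fun_half_shift L2fun_reflect h)
  obtain y where y: "((\<lambda>k. a k * cnj (a' k)) has_sum y) UNIV"
    using bessel_pairing[OF B1 b, of a'] B1 f h by (auto simp: bessel_seq_def a_def a'_def)
  obtain y' where y': "((\<lambda>k. c k * cnj (c' k)) has_sum y') UNIV"
    using bessel_pairing[OF B2 b, of c'] B2 f h by (auto simp: bessel_seq_def c_def c'_def)
  obtain z where z: "((\<lambda>k. L2ip f (tf_shift k g) * L2ip x (tf_shift (- k) g')) has_sum z) UNIV"
      "((\<lambda>k. L2ip x (tf_shift k g) * L2ip f (tf_shift (- k) g')) has_sum z) UNIV"
    using paired_sum_symmetric[OF B1 B2 b f x] by blast
  have ma: "sgn_of k * (a k * cnj (a' (flip k))) = L2ip f (tf_shift k g) * L2ip x (tf_shift (- k) g')" for k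
  proof -
    have "cnj (a' (flip k)) = L2ip (reflect h) (tf_shift (- k) g)"
      unfolding a'_def cnj_L2ip by (rule ip_reflect_tf[OF h])
    also have "\<dots> = L2ip x (half_shift (tf_shift (- k) g))"
      unfolding x_def by (rule L2ip_half_shift[symmetric, OF L2fun_reflect[OF h] L2fun_tf_shift[OF g]])
    also have "\<dots> = sgn_of k * L2ip x (tf_shift (- k) g')"
      unfolding half_shift_tf L2ip_cmult_right by simp
    finally show ?thesis by (simp add: a_def mult.left_commute)
  qed
  have mc: "sgn_of k * (c k * cnj (c' (flip k))) = L2ip f (tf_shift k g') * L2ip x (tf_shift (- k) g)" for k
  proof -
    have "cnj (c' (flip k)) = L2ip (reflect h) (tf_shift (- k - one_shift) g')"
      unfolding c'_def cnj_L2ip by (rule ip_reflect_tf'[OF h])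
    also have "\<dots> = L2ip x (half_shift (tf_shift (- k - one_shift) g'))"
      unfolding x_def by (rule L2ip_half_shift[symmetric, OF L2fun_reflect[OF h] L2fun_tf_shift[OF g']])
    also have "\<dots> = sgn_of k * L2ip x (tf_shift (- k) g)"
      unfolding half_shift_tf half_shift_half_shift tf_shift_add L2ip_cmult_right
      by (simp add: sgn_of_diff)
    finally show ?thesis by (simp add: c_def mult.left_commute)
  qed
  have za: "((\<lambda>k. sgn_of k * (a k * cnj (a' (flip k)))) has_sum z) UNIV"
    unfolding ma by (rule z(1))
  have zc: "((\<lambda>k. sgn_of k * (c k * cnj (c' (flip k)))) has_sum z) UNIV"
    unfolding mc
    using z(2) has_sum_neg_reindex[of "\<lambda>k. L2ip x (tf_shift k g) * L2ip f (tf_shift (- k) g')" z]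
    by (simp add: mult.commute)
  have orbit: "((\<lambda>k. (u k + r * sgn_of k * u (flip k)) * cnj (u' k + r * sgn_of k * u' (flip k)) / 4)
      has_sum (v + r * w) / 2) UNIV"
    if uv: "((\<lambda>k. u k * cnj (u' k)) has_sum v) UNIV"
      and uw: "((\<lambda>k. sgn_of k * (u k * cnj (u' (flip k)))) has_sum w) UNIV"
      and r: "r = 1 \<or> r = - 1" for u u' v w and r :: complex
  proof -
    have uv': "((\<lambda>k. u (flip k) * cnj (u' (flip k))) has_sum v) UNIV"
      using uv has_sum_flip_reindex[of "\<lambda>k. u k * cnj (u' k)" v] by simp
    have uw': "((\<lambda>k. sgn_of k * (u (flip k) * cnj (u' k))) has_sum w) UNIV"
      using uw has_sum_flip_reindex[of "\<lambda>k. sgn_of k * (u k * cnj (u' (flip k)))" w] by simp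
    have sum: "((\<lambda>k. (1 / 4) * ((u k * cnj (u' k) + u (flip k) * cnj (u' (flip k)))
          + r * (sgn_of k * (u k * cnj (u' (flip k))) + sgn_of k * (u (flip k) * cnj (u' k)))))
        has_sum (1 / 4) * ((v + v) + r * (w + w))) UNIV"
      by (intro has_sum_cmult_right has_sum_add uv uv' uw uw')
    have terms: "(1 / 4) * ((u k * cnj (u' k) + u (flip k) * cnj (u' (flip k)))
          + r * (sgn_of k * (u k * cnj (u' (flip k))) + sgn_of k * (u (flip k) * cnj (u' k))))
        = (u k + r * sgn_of k * u (flip k)) * cnj (u' k + r * sgn_of k * u' (flip k)) / 4" for k
      using r sgn_of_cases[of k] by (elim disjE) (simp_all add: algebra_simps)
    have val: "(1 / 4) * ((v + v) + r * (w + w)) = (v + r * w) / 2"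
      by (simp add: algebra_simps)
    show ?thesis using sum unfolding terms val .
  qed
  define \<phi> where "\<phi> k = (a k + 1 * sgn_of k * a (flip k)) * cnj (a' k + 1 * sgn_of k * a' (flip k)) / 4" for k
  define \<psi> where "\<psi> k = (c k + (- 1) * sgn_of k * c (flip k)) * cnj (c' k + (- 1) * sgn_of k * c' (flip k)) / 4" for k
  have \<phi>: "(\<phi> has_sum (y + 1 * z) / 2) UNIV" unfolding \<phi>_def by (rule orbit[OF y za]) simp
  have \<psi>: "(\<psi> has_sum (y' + (- 1) * z) / 2) UNIV" unfolding \<psi>_def by (rule orbit[OF y' zc]) simp
  have i\<phi>: "\<phi> (flip k) = \<phi> k" and i\<psi>: "\<psi> (flip k) = \<psi> k" for k
    using sgn_of_cases[of k] by (auto simp: \<phi>_def \<psi>_def algebra_simps)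
  obtain r t where rt: "((\<lambda>l. \<phi> (l, 0)) has_sum r) UNIV" "(\<phi> has_sum t) (UNIV \<times> N)" "(y + 1 * z) / 2 = r + 2 * t"
    using has_sum_flip_orbits[OF \<phi> i\<phi> N] by blast
  obtain r' t' where rt': "((\<lambda>l. \<psi> (l, 0)) has_sum r') UNIV" "(\<psi> has_sum t') (UNIV \<times> N)"
      "(y' + (- 1) * z) / 2 = r' + 2 * t'"
    using has_sum_flip_orbits[OF \<psi> i\<psi> N] by blast
  have f0: "flip (l, 0) = (l, 0)" "sgn_of (l, 0) = 1" for l :: "int ^ 'd"
    by (simp_all add: flip_def sgn_of_def sgn_vec_def)
  have "(\<lambda>l. \<psi> (l, 0)) = (\<lambda>l. 0)" by (simp add: \<psi>_def f0 fun_eq_iff)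
  then have r': "r' = 0" using rt'(1) has_sum_unique[OF _ has_sum_0[of UNIV "\<lambda>_. 0"]] by simp
  let ?w = "\<lambda>j. L2ip f (wilson g j) * cnj (L2ip h (wilson g j))"
  have two: "complex_of_real (sqrt 2) * complex_of_real (sqrt 2) = 2"
    by (simp flip: of_real_mult)
  have w: "?w j = weight j * weight j * ((L2ip f (tf_shift (base_idx j) v) + twist j * L2ip f (tf_shift (flip (base_idx j)) v))
      * cnj (L2ip h (tf_shift (base_idx j) v) + twist j * L2ip h (tf_shift (flip (base_idx j)) v)))"
    if "v = (if is_odd j then g' else g)" for j v
  proof -
    have v: "L2fun v" using that g g' by simp
    show ?thesis
      unfolding wilson_eq_orbit_sum that[symmetric] L2ip_orbit_sum_right[OF v f] L2ip_orbit_sum_right[OF v h]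
        complex_cnj_mult cnj_weight by (simp only: mult_ac)
  qed
  have w1: "?w (Inl l) = \<phi> (l, 0)" for l
    using w[of g "Inl l"] by (simp add: \<phi>_def a_def a'_def twist_def)
  have w2: "?w (Inr (Inl p)) = 2 * \<phi> p" for p
    using w[of g "Inr (Inl p)"] by (simp add: \<phi>_def a_def a'_def twist_def two)
  have w3: "?w (Inr (Inr p)) = 2 * \<psi> p" for p
  proof -
    have "weight (Inr (Inr p)) * weight (Inr (Inr p)) = 1 / 2"
      using sgn_of_cases[of p] two by auto
    then show ?thesis
      using w[of g' "Inr (Inr p)"] by (simp add: \<psi>_def c_def c'_def twist_def)
  qed
  have "(?w has_sum (r + (2 * t + 2 * t'))) (wilson_index N)"
    by (rule has_sum_wilson_index)
       (simp_all only: w1 w2 w3 rt(1) has_sum_cmult_right[OF rt(2)] has_sum_cmult_right[OF rt'(2)])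
  moreover have "r + (2 * t + 2 * t') = (y + y') / 2"
    using rt(3) rt'(3) r' by (simp add: field_simps)
  moreover have "((\<lambda>j. L2ip f (gabor g j) * cnj (L2ip h (gabor g j))) has_sum (y + y')) gabor_index"
  proof (rule has_sum_gabor_index)
    show "((\<lambda>k. L2ip f (gabor g (gabor_int k)) * cnj (L2ip h (gabor g (gabor_int k)))) has_sum y) UNIV"
      using y by (simp add: gabor_gabor_int a_def a'_def)
    have "L2ip f (gabor g (gabor_half k)) * cnj (L2ip h (gabor g (gabor_half k))) = c k * cnj (c' k)" for k
      unfolding gabor_gabor_half L2ip_cmult_right c_def c'_def using sgn_of_cases[of k] by auto
    then show "((\<lambda>k. L2ip f (gabor g (gabor_half k)) * cnj (L2ip h (gabor g (gabor_half k)))) has_sum y') UNIV"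
      using y' by simp
  qed
  ultimately show ?thesis by (intro exI[of _ "y + y'"]) simp
qed

end

section \<open>Comparison of the two systems\<close>

text \<open>The bound is tested on a function of norm \<open>1\<close>.\<close>

lemma bessel_seq_bound_nonneg:
  fixes F :: "'i \<Rightarrow> real ^ 'd \<Rightarrow> complex"
  assumes "bessel_seq I F b"
  shows "0 \<le> b"
proof -
  have "(L2nrm (cube :: real ^ 'd \<Rightarrow> complex))\<^sup>2 = 1"
    using ip_cube[of "0 :: (int ^ 'd) \<times> (int ^ 'd)"] by (simp add: L2nrm_sq_Re)
  moreover have "0 \<le> (\<Sum>\<^sub>\<infinity>j\<in>I. (cmod (L2ip cube (F j)))\<^sup>2)" by (intro infsum_nonneg) simp
  moreover have "(\<Sum>\<^sub>\<infinity>j\<in>I. (cmod (L2ip cube (F j)))\<^sup>2) \<le> b * (L2nrm (cube :: real ^ 'd \<Rightarrow> complex))\<^sup>2"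
    using assms L2fun_cube by (auto simp: bessel_seq_def)
  ultimately show ?thesis by simp
qed

locale hermitian_window_index = hermitian_window g
  for g :: "real ^ 'd \<Rightarrow> complex" +
  fixes N :: "(int ^ 'd) set"
  assumes N: "N \<inter> uminus ` N = {}" "N \<union> uminus ` N \<union> {0} = UNIV"
begin

sublocale V: orthonormal_basis "wilson_index N" "\<lambda>j. orbit_sum j (cube :: real ^ 'd \<Rightarrow> complex)"
  by (rule orbit_cube_basis[OF N])

definition energy :: "(real ^ 'd \<Rightarrow> complex) \<Rightarrow> real" where
  "energy f = (\<Sum>\<^sub>\<infinity>k\<in>gabor_index. (cmod (L2ip f (gabor g k)))\<^sup>2)"

lemma has_sum_energy_wilson:
  assumes B: "bessel_seq gabor_index (gabor g) b" and f: "L2fun f"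
  shows "((\<lambda>j. (cmod (L2ip f (wilson g j)))\<^sup>2) has_sum energy f / 2) (wilson_index N)"
proof -
  have b: "0 \<le> b" by (rule bessel_seq_bound_nonneg[OF B])
  obtain z where z: "((\<lambda>j. L2ip f (gabor g j) * cnj (L2ip f (gabor g j))) has_sum z) gabor_index"
    "((\<lambda>j. L2ip f (wilson g j) * cnj (L2ip f (wilson g j))) has_sum z / 2) (wilson_index N)"
    using wilson_form_half_gabor_form[OF N B b f f] by blast
  have "((\<lambda>j. (cmod (L2ip f (gabor g j)))\<^sup>2) has_sum energy f) gabor_index"
    unfolding energy_def using B f by (intro has_sum_infsum) (simp add: bessel_seq_def)
  then have "z = of_real (energy f)"
    using z(1) has_sum_unique unfolding has_sum_norm_sq[symmetric] by blast
  then have "z / 2 = of_real (energy f / 2)" by simp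
  then show ?thesis using z(2) by (simp only: has_sum_norm_sq)
qed

lemma wilson_bessel:
  assumes B: "bessel_seq gabor_index (gabor g) b"
  shows "bessel_seq (wilson_index N) (wilson g) (b / 2)"
  unfolding bessel_seq_def
proof (intro conjI ballI allI impI)
  show "L2fun (wilson g j)" for j by (rule L2fun_wilson[OF g])
  fix f :: "real ^ 'd \<Rightarrow> complex" assume f: "L2fun f"
  note s = has_sum_energy_wilson[OF B f]
  show "(\<lambda>j. (cmod (L2ip f (wilson g j)))\<^sup>2) summable_on wilson_index N"
    using s by (rule has_sum_imp_summable)
  have "energy f \<le> b * (L2nrm f)\<^sup>2" using B f by (simp add: energy_def bessel_seq_def)
  then show "(\<Sum>\<^sub>\<infinity>j\<in>wilson_index N. (cmod (L2ip f (wilson g j)))\<^sup>2) \<le> b / 2 * (L2nrm f)\<^sup>2"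
    using infsumI[OF s] by simp
qed

text \<open>Intersecting with the index set makes the partial sum a sum over basis elements for every set
  \<open>A\<close>, as in \<open>L2_has_sum_cut\<close>.\<close>

definition partial_expansion :: "(real ^ 'd \<Rightarrow> complex) \<Rightarrow> 'd wilson_idx set \<Rightarrow> real ^ 'd \<Rightarrow> complex" where
  "partial_expansion f A = (\<lambda>x. \<Sum>j\<in>A \<inter> wilson_index N. L2ip f (orbit_sum j cube) * orbit_sum j cube x)"

lemma L2fun_partial_expansion: "L2fun (partial_expansion f A)"
  unfolding partial_expansion_def by (intro L2fun_lincomb L2fun_orbit_sum L2fun_cube)

lemma partial_expansion_tendsto:
  "L2fun f \<Longrightarrow> ((\<lambda>A. L2nrm (\<lambda>x. partial_expansion f A x - f x)) \<longlongrightarrow> 0) (finite_subsets_at_top (wilson_index N))"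
  unfolding partial_expansion_def by (rule L2_has_sum_cut[OF V.expansion])

lemma partial_expansion_energy:
  assumes "finite A"
  shows "((\<lambda>k. (cmod (L2ip (partial_expansion f A) (gabor g k)))\<^sup>2) has_sum
      2 * (L2nrm (\<lambda>x. \<Sum>j\<in>A \<inter> wilson_index N. L2ip f (orbit_sum j cube) * wilson g j x))\<^sup>2) gabor_index"
    and "(L2nrm (partial_expansion f A))\<^sup>2
      = (\<Sum>j\<in>A \<inter> wilson_index N. (cmod (L2ip f (orbit_sum j cube)))\<^sup>2)"
proof -
  show "((\<lambda>k. (cmod (L2ip (partial_expansion f A) (gabor g k)))\<^sup>2) has_sum
      2 * (L2nrm (\<lambda>x. \<Sum>j\<in>A \<inter> wilson_index N. L2ip f (orbit_sum j cube) * wilson g j x))\<^sup>2) gabor_index"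
    unfolding partial_expansion_def by (rule gabor_lincomb_energy)
  show "(L2nrm (partial_expansion f A))\<^sup>2
      = (\<Sum>j\<in>A \<inter> wilson_index N. (cmod (L2ip f (orbit_sum j cube)))\<^sup>2)"
    unfolding partial_expansion_def using assms by (intro V.nrm_lincomb) auto
qed

text \<open>An upper Riesz bound of the Wilson system is an upper bound of the Gabor energy on the span of
  the basis, hence everywhere.\<close>

lemma gabor_bessel_if_synthesis_bound:
  assumes up: "\<And>A c. finite A \<Longrightarrow> A \<subseteq> wilson_index N \<Longrightarrow>
    2 * (L2nrm (\<lambda>x. \<Sum>j\<in>A. c j * wilson g j x))\<^sup>2 \<le> b * (\<Sum>j\<in>A. (cmod (c j))\<^sup>2)"
  shows "bessel_seq gabor_index (gabor g) b"
proof (rule bessel_seqI_finite)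
  show "L2fun (gabor g k)" for k by (rule L2fun_gabor[OF g])
  fix f :: "real ^ 'd \<Rightarrow> complex" and K :: "((real ^ 'd) \<times> (int ^ 'd)) set"
  assume f: "L2fun f" and K: "finite K" "K \<subseteq> gabor_index"
  let ?F = "finite_subsets_at_top (wilson_index N)"
  note lim = partial_expansion_tendsto[OF f]
  have "((\<lambda>A. \<Sum>k\<in>K. (cmod (L2ip (partial_expansion f A) (gabor g k)))\<^sup>2)
      \<longlongrightarrow> (\<Sum>k\<in>K. (cmod (L2ip f (gabor g k)))\<^sup>2)) ?F"
    by (intro tendsto_sum tendsto_power tendsto_norm L2ip_tendsto[OF lim] L2fun_partial_expansion f L2fun_gabor g)
  moreover have "((\<lambda>A. b * (L2nrm (partial_expansion f A))\<^sup>2) \<longlongrightarrow> b * (L2nrm f)\<^sup>2) ?F"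
    by (intro tendsto_mult_left tendsto_power L2nrm_tendsto[OF lim] L2fun_partial_expansion f)
  moreover have "(\<Sum>k\<in>K. (cmod (L2ip (partial_expansion f A) (gabor g k)))\<^sup>2) \<le> b * (L2nrm (partial_expansion f A))\<^sup>2"
    if A: "finite A" for A
  proof -
    note s = partial_expansion_energy(1)[OF A, of f]
    have "(\<Sum>k\<in>K. (cmod (L2ip (partial_expansion f A) (gabor g k)))\<^sup>2)
        \<le> 2 * (L2nrm (\<lambda>x. \<Sum>j\<in>A \<inter> wilson_index N. L2ip f (orbit_sum j cube) * wilson g j x))\<^sup>2"
      using finite_sum_le_infsum[OF has_sum_imp_summable[OF s] K] infsumI[OF s] by simp
    also have "\<dots> \<le> b * (L2nrm (partial_expansion f A))\<^sup>2"
      unfolding partial_expansion_energy(2)[OF A] using A by (intro up) auto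
    finally show ?thesis .
  qed
  ultimately show "(\<Sum>k\<in>K. (cmod (L2ip f (gabor g k)))\<^sup>2) \<le> b * (L2nrm f)\<^sup>2"
    by (intro tendsto_le[OF finite_subsets_at_top_neq_bot]) (auto intro: eventually_finite_subsets_at_top_weakI)
qed

text \<open>The Bessel bound makes the energy continuous, so a lower bound on the partial expansions
  passes to the limit. The parameter \<open>t\<close> of \<open>bessel_seq_energy_add\<close> tends to \<open>0\<close> at the end.\<close>

lemma gabor_lower_bound:
  assumes B: "bessel_seq gabor_index (gabor g) b"
    and low: "\<And>A c. finite A \<Longrightarrow> A \<subseteq> wilson_index N \<Longrightarrow>
      a * (\<Sum>j\<in>A. (cmod (c j))\<^sup>2) \<le> 2 * (L2nrm (\<lambda>x. \<Sum>j\<in>A. c j * wilson g j x))\<^sup>2"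
    and f: "L2fun f"
  shows "a * (L2nrm f)\<^sup>2 \<le> energy f"
proof -
  let ?F = "finite_subsets_at_top (wilson_index N)"
  let ?d = "\<lambda>A. L2nrm (\<lambda>x. partial_expansion f A x - f x)"
  note lim = partial_expansion_tendsto[OF f]
  have E0: "0 \<le> energy f" unfolding energy_def by (intro infsum_nonneg) simp
  have t: "a * (L2nrm f)\<^sup>2 \<le> (1 + t) * energy f" if t: "0 < t" for t
  proof -
    have "((\<lambda>A. a * (L2nrm (partial_expansion f A))\<^sup>2) \<longlongrightarrow> a * (L2nrm f)\<^sup>2) ?F"
      by (intro tendsto_mult_left tendsto_power L2nrm_tendsto[OF lim] L2fun_partial_expansion f)
    moreover have "((\<lambda>A. (1 + t) * energy f + (1 + 1 / t) * (b * (?d A)\<^sup>2))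
        \<longlongrightarrow> (1 + t) * energy f + (1 + 1 / t) * (b * 0\<^sup>2)) ?F"
      by (intro tendsto_add tendsto_const tendsto_mult_left tendsto_power lim)
    moreover have "a * (L2nrm (partial_expansion f A))\<^sup>2 \<le> (1 + t) * energy f + (1 + 1 / t) * (b * (?d A)\<^sup>2)"
      if A: "finite A" for A
    proof -
      have d: "L2fun (\<lambda>x. partial_expansion f A x - f x)"
        by (intro L2fun_diff L2fun_partial_expansion f)
      have "a * (L2nrm (partial_expansion f A))\<^sup>2
          \<le> 2 * (L2nrm (\<lambda>x. \<Sum>j\<in>A \<inter> wilson_index N. L2ip f (orbit_sum j cube) * wilson g j x))\<^sup>2"
        unfolding partial_expansion_energy(2)[OF A] using A by (intro low) auto
      also have "\<dots> = (\<Sum>\<^sub>\<infinity>k\<in>gabor_index. (cmod (L2ip (partial_expansion f A) (gabor g k)))\<^sup>2)"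
        using infsumI[OF partial_expansion_energy(1)[OF A]] by simp
      also have "\<dots> \<le> (1 + t) * energy f + (1 + 1 / t) * (b * (?d A)\<^sup>2)"
        using bessel_seq_energy_add[OF B f d t] by (simp add: energy_def)
      finally show ?thesis .
    qed
    ultimately have "a * (L2nrm f)\<^sup>2 \<le> (1 + t) * energy f + (1 + 1 / t) * (b * 0\<^sup>2)"
      by (intro tendsto_le[OF finite_subsets_at_top_neq_bot]) (auto intro: eventually_finite_subsets_at_top_weakI)
    then show ?thesis by simp
  qed
  show ?thesis
  proof (rule field_le_epsilon)
    fix e :: real assume e: "0 < e"
    have "e / (energy f + 1) * energy f \<le> e" using e E0 by (simp add: field_simps)
    moreover have "a * (L2nrm f)\<^sup>2 \<le> energy f + e / (energy f + 1) * energy f"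
      using t[of "e / (energy f + 1)"] e E0 by (simp add: distrib_right)
    ultimately show "a * (L2nrm f)\<^sup>2 \<le> energy f + e" by linarith
  qed
qed

text \<open>From the Wilson to the Gabor system the bound passes through the synthesis operators, since the
  energy identity presupposes a Bessel bound of the Gabor system.\<close>

lemma bessel_equivalence:
  "bessel_seq gabor_index (gabor g) b \<longleftrightarrow> bessel_seq (wilson_index N) (wilson g) (b / 2)"
proof
  assume B: "bessel_seq (wilson_index N) (wilson g) (b / 2)"
  show "bessel_seq gabor_index (gabor g) b"
  proof (rule gabor_bessel_if_synthesis_bound)
    fix A c assume "finite A" "A \<subseteq> wilson_index N"
    from bessel_seq_synthesis_bound[OF B bessel_seq_bound_nonneg[OF B] this, of c]
    show "2 * (L2nrm (\<lambda>x. \<Sum>j\<in>A. c j * wilson g j x))\<^sup>2 \<le> b * (\<Sum>j\<in>A. (cmod (c j))\<^sup>2)" by simp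
  qed
qed (rule wilson_bessel)

text \<open>The difference \<open>SG f - 2 * SW f\<close> is tested against itself.\<close>

lemma frame_operators:
  assumes B: "bessel_seq gabor_index (gabor g) b"
    and SG: "is_frame_operator gabor_index (gabor g) SG"
    and SW: "is_frame_operator (wilson_index N) (wilson g) SW" and f: "L2fun f"
  shows "AE x in lebesgue. SG f x = 2 * SW f x"
proof -
  have sg: "L2_has_sum (\<lambda>j x. L2ip f (gabor g j) * gabor g j x) gabor_index (SG f)"
    and sw: "L2_has_sum (\<lambda>j x. L2ip f (wilson g j) * wilson g j x) (wilson_index N) (SW f)"
    using SG SW f by (auto simp: is_frame_operator_def)
  have g2: "L2fun (SG f)" and w2: "L2fun (SW f)" using sg sw by (auto simp: L2_has_sum_def)
  define h where "h x = SG f x - 2 * SW f x" for x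
  have h: "L2fun h" unfolding h_def by (intro L2fun_diff L2fun_cmult g2 w2)
  obtain z where z: "((\<lambda>j. L2ip f (gabor g j) * cnj (L2ip h (gabor g j))) has_sum z) gabor_index"
    "((\<lambda>j. L2ip f (wilson g j) * cnj (L2ip h (wilson g j))) has_sum z / 2) (wilson_index N)"
    using wilson_form_half_gabor_form[OF N B bessel_seq_bound_nonneg[OF B] f h] by blast
  have "L2ip (SG f) h = z"
    using L2_has_sum_ip[OF sg h] z(1) has_sum_unique unfolding L2ip_cmult_left cnj_L2ip by blast
  moreover have "L2ip (SW f) h = z / 2"
    using L2_has_sum_ip[OF sw h] z(2) has_sum_unique unfolding L2ip_cmult_left cnj_L2ip by blast
  moreover have "L2ip h h = L2ip (SG f) h - 2 * L2ip (SW f) h"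
  proof -
    have "L2ip h h = L2ip (\<lambda>x. SG f x - 2 * SW f x) h" by (simp add: h_def[abs_def])
    also have "\<dots> = L2ip (SG f) h - 2 * L2ip (SW f) h"
      unfolding L2ip_diff_left[OF g2 L2fun_cmult[OF w2] h] L2ip_cmult_left ..
    finally show ?thesis .
  qed
  ultimately have "L2ip h h = z - 2 * (z / 2)" by (simp only:)
  then have "L2ip h h = 0" by simp
  then have "L2nrm h = 0" by (simp add: L2ip_self)
  then show ?thesis using h by (auto simp: L2nrm_eq_0_AE h_def elim: eventually_mono)
qed

text \<open>Both Riesz inequalities are frame inequalities for finite sums of the basis made from the cube.
  The density of the span is obtained from the frame property of the Wilson system, which the energy
  identity transfers from the Gabor system.\<close>

lemma frame_iff_riesz_basis:
  "is_frame gabor_index (gabor g) (2 * a) (2 * b) \<longleftrightarrow> is_riesz_basis (wilson_index N) (wilson g) a b"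
proof
  assume fr: "is_frame gabor_index (gabor g) (2 * a) (2 * b)"
  then have B: "bessel_seq gabor_index (gabor g) (2 * b)" and ab: "0 < a" "0 < b"
    and e: "\<And>f. L2fun f \<Longrightarrow> 2 * a * (L2nrm f)\<^sup>2 \<le> energy f \<and> energy f \<le> 2 * b * (L2nrm f)\<^sup>2"
    by (auto simp: is_frame_def bessel_seq_def energy_def)
  have "is_frame (wilson_index N) (wilson g) a b"
    unfolding is_frame_def
  proof (intro conjI ballI allI impI ab)
    show "L2fun (wilson g j)" for j by (rule L2fun_wilson[OF g])
    fix f :: "real ^ 'd \<Rightarrow> complex" assume f: "L2fun f"
    note s = has_sum_energy_wilson[OF B f]
    show "(\<lambda>j. (cmod (L2ip f (wilson g j)))\<^sup>2) summable_on wilson_index N"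
      using s by (rule has_sum_imp_summable)
    show "a * (L2nrm f)\<^sup>2 \<le> (\<Sum>\<^sub>\<infinity>j\<in>wilson_index N. (cmod (L2ip f (wilson g j)))\<^sup>2)"
      and "(\<Sum>\<^sub>\<infinity>j\<in>wilson_index N. (cmod (L2ip f (wilson g j)))\<^sup>2) \<le> b * (L2nrm f)\<^sup>2"
      using e[OF f] unfolding infsumI[OF s] by auto
  qed
  then have dense: "dense_span (wilson_index N) (wilson g)" by (rule frame_dense_span)
  have bounds: "a * (\<Sum>j\<in>A. (cmod (c j))\<^sup>2) \<le> (L2nrm (\<lambda>x. \<Sum>j\<in>A. c j * wilson g j x))\<^sup>2 \<and>
      (L2nrm (\<lambda>x. \<Sum>j\<in>A. c j * wilson g j x))\<^sup>2 \<le> b * (\<Sum>j\<in>A. (cmod (c j))\<^sup>2)"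
    if A: "finite A" "A \<subseteq> wilson_index N" for A c
  proof -
    let ?f = "\<lambda>x. \<Sum>j\<in>A. c j * orbit_sum j cube x"
    have "L2fun ?f" by (intro L2fun_lincomb L2fun_orbit_sum L2fun_cube)
    from e[OF this] show ?thesis
      unfolding energy_def infsumI[OF gabor_lincomb_energy] V.nrm_lincomb[OF A] by auto
  qed
  show "is_riesz_basis (wilson_index N) (wilson g) a b"
    unfolding is_riesz_basis_def using ab dense bounds L2fun_wilson[OF g] by blast
next
  assume R: "is_riesz_basis (wilson_index N) (wilson g) a b"
  then have ab: "0 < a" "0 < b"
    and r: "\<And>A c. finite A \<Longrightarrow> A \<subseteq> wilson_index N \<Longrightarrow>
      a * (\<Sum>j\<in>A. (cmod (c j))\<^sup>2) \<le> (L2nrm (\<lambda>x. \<Sum>j\<in>A. c j * wilson g j x))\<^sup>2 \<and>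
      (L2nrm (\<lambda>x. \<Sum>j\<in>A. c j * wilson g j x))\<^sup>2 \<le> b * (\<Sum>j\<in>A. (cmod (c j))\<^sup>2)"
    unfolding is_riesz_basis_def by blast+
  have B: "bessel_seq gabor_index (gabor g) (2 * b)"
    using r by (intro gabor_bessel_if_synthesis_bound) simp
  have low: "2 * a * (L2nrm f)\<^sup>2 \<le> energy f" if "L2fun f" for f
    using r that by (intro gabor_lower_bound[OF B]) simp_all
  show "is_frame gabor_index (gabor g) (2 * a) (2 * b)"
    using ab B low unfolding is_frame_def bessel_seq_def energy_def by simp
qed

end

theorem theorem3p1:
  fixes g G :: "real ^ 'd \<Rightarrow> complex" and N :: "(int ^ 'd) set"
  assumes "L2fun g"
    and "N \<inter> uminus ` N = {}"
    and "N \<union> uminus ` N \<union> {0} = UNIV"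
    and "fourier_L2 g G"
    and "AE \<omega> in lebesgue. G \<omega> = cnj (G \<omega>)"
  shows
    "(\<forall>b. (bessel_seq gabor_index (gabor g) b \<longleftrightarrow>
            bessel_seq (wilson_index N) (wilson g) (b / 2))
        \<and> (bessel_seq gabor_index (gabor g) b \<or>
            bessel_seq (wilson_index N) (wilson g) (b / 2) \<longrightarrow>
            (\<exists>SG. is_frame_operator gabor_index (gabor g) SG)
          \<and> (\<exists>SW. is_frame_operator (wilson_index N) (wilson g) SW)
          \<and> (\<forall>SG SW. is_frame_operator gabor_index (gabor g) SG \<longrightarrow>
                is_frame_operator (wilson_index N) (wilson g) SW \<longrightarrow>
                (\<forall>f. L2fun f \<longrightarrow> (AE x in lebesgue. SG f x = 2 * SW f x)))))
   \<and> (\<forall>a b. is_frame gabor_index (gabor g) (2 * a) (2 * b) \<longleftrightarrow>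
            is_riesz_basis (wilson_index N) (wilson g) a b)
   \<and> (is_tight_frame gabor_index (gabor g) 2 \<longleftrightarrow>
        is_orthonormal_basis (wilson_index N) (wilson g))"
proof -
  interpret hermitian_window_index g N
    by unfold_locales (rule assms(1) reflect_eq_if_fourier_real[OF assms(4,5)] assms(2) assms(3))+
  have operators: "(\<exists>SG. is_frame_operator gabor_index (gabor g) SG)
      \<and> (\<exists>SW. is_frame_operator (wilson_index N) (wilson g) SW)
      \<and> (\<forall>SG SW. is_frame_operator gabor_index (gabor g) SG \<longrightarrow>
            is_frame_operator (wilson_index N) (wilson g) SW \<longrightarrow>
            (\<forall>f. L2fun f \<longrightarrow> (AE x in lebesgue. SG f x = 2 * SW f x)))"
    if B: "bessel_seq gabor_index (gabor g) b" for b
    using bessel_seq_frame_operator[OF B bessel_seq_bound_nonneg[OF B]]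
      bessel_seq_frame_operator[OF wilson_bessel[OF B] bessel_seq_bound_nonneg[OF wilson_bessel[OF B]]]
      frame_operators[OF B] by blast
  moreover have "is_tight_frame gabor_index (gabor g) 2 \<longleftrightarrow> is_orthonormal_basis (wilson_index N) (wilson g)"
    using frame_iff_riesz_basis[of 1 1] riesz_basis_1_1_iff_orthonormal_basis[of "wilson_index N" "wilson g"]
    by (simp add: is_tight_frame_def)
  ultimately show ?thesis
    using bessel_equivalence frame_iff_riesz_basis by blast
qed

end
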